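(* Let $\mathfrak A$ be an admissible Banach algebra for a topological dynamical system $(\Omega,T)$, let $W\in\mathfrak A$ and let $V\in C^\omega(\mathbb T,\mathbb R)$ be non-constant. For every $E\in\mathbb R$ there exists $\varepsilon_0=\varepsilon_0(E,V,W)>0$ such that for all $|\varepsilon|<\varepsilon_0$ the fibered solution bundle admits an $\mathscr T$-invariant splitting $$\mathcal M_{V,E,\varepsilon}(\theta)=\mathcal M^u_{V,E,\varepsilon}(\theta)\oplus\mathcal M^c_{V,E,\varepsilon}(\theta)\oplus\mathcal M^s_{V,E,\varepsilon}(\theta),\qquad \forall\,\theta\in\Omega,$$ with the following properties. (1) (Uniform partial hyperbolicity) There exist $0<r_s<r_-<1<r_+<r_u$ and $C>0$ such that for all $\theta\in\Omega$ and $n\ge 0$, $$\|\mathscr T^n|_{\mathcal M^s_{V,E,\varepsilon}(\theta)}\|\le C r_s^n,\qquad \|\mathscr T^{-n}|_{\mathcal M^u_{V,E,\varepsilon}(\theta)}\|\le C r_u^{-n},$$ $$\|\mathscr T^n|_{\mathcal M^c_{V,E,\varepsilon}(\theta)}\|\le C r_+^n,\qquad \|\mathscr T^{-n}|_{\mathcal M^c_{V,E,\varepsilon}(\theta)}\|\le C r_-^{-n}.$$ (2) The canonical center bundle $\boldsymbol{\mathcal M}^c_{V,E,\varepsilon}:=\{(\theta,u)\in\Omega\times\mathcal X_\xi: u\in\mathcal M^c_{V,E,\varepsilon}(\theta)\}$ has constant fiber dimension $2m(E)$ and is globally trivial. (3) Writing $m=m(E)$, there exists a global frame $U^\infty_\varepsilon(E,\cdot)=\{U^\infty_{\varepsilon,1}(E,\cdot),\dots,U^\infty_{\varepsilon,2m}(E,\cdot)\}$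 of $\boldsymbol{\mathcal M}^c_{V,E,\varepsilon}$ consisting of $\mathcal X_\xi$-valued sections with $\mathfrak A$-valued coordinates, and the shift dynamics on the canonical center bundle is represented by an induced cocycle $C^\infty_\varepsilon(E,\cdot)$, taking values in invertible $2m\times 2m$ complex matrices: $$S U^\infty_\varepsilon(E,\theta)=U^\infty_\varepsilon(E,T\theta)\,C^\infty_\varepsilon(E,\theta),\qquad \theta\in\Omega.$$
   Context: A topological dynamical system $(\Omega,T)$ is a compact metric space $\Omega$ with a homeomorphism $T:\Omega\to\Omega$. A complex unital Banach algebra $\mathfrak A$ of complex-valued functions on $\Omega$ is admissible for $(\Omega,T)$ if: (i) $f\mapsto f\circ T$ is an isometric automorphism of $\mathfrak A$; (ii) $\|f\|_\infty:=\sup_\Omega|f|\le\|f\|_{\mathfrak A}$ for $f\in\mathfrak A$; (iii) $\mathfrak A$ is inverse-closed: if $f\in\mathfrak A$ and $\inf_\Omega|f|>0$ then $1/f\in\mathfrak A$. $W:\Omega\to\mathbb R$ is real-valued and continuous. $V$ is identified, via $z=e^{2\pi i x}$, with its Laurent series $V(z)=\sum_{n\in\mathbb Z}\widehat v_n z^n$, where $\widehat v_n$ are the Fourier coefficients of $V$; fix $h>0$ such that $V(z)$ is analytic in $\mathbb A_h=\{e^{-h}<|z|<e^h\}$, and fix $0<\xi<h$. Let $$\mathcal X_\xi=\Big\{u=(u_n)_{n\in\mathbb Z}\subset\mathbb C:\ \|u\|_\xi=\sum_{n}|u_n|e^{-\xi|n|}<\infty\Big\},\qquad (Su)_n=u_{n+1}.$$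 The long-range operator is $(\mathbf L_{V,\varepsilon W,T,\theta}u)_n=\sum_{k\in\mathbb Z}\widehat v_k u_{n+k}+\varepsilon W(T^n\theta)u_n$, and the fibered solution bundle has fibers $\mathcal M_{V,E,\varepsilon}(\theta)=\{u\in\mathcal X_\xi:\mathbf L_{V,\varepsilon W,T,\theta}u=Eu\}$. It is invariant under $\mathscr T(\theta,u)=(T\theta,Su)$; operator norms of $\mathscr T^{\pm n}$ restricted to fibers are those of $S^{\pm n}$ with respect to $\|\cdot\|_\xi$. Invariance of the splitting means $S\mathcal M^\ast_{V,E,\varepsilon}(\theta)=\mathcal M^\ast_{V,E,\varepsilon}(T\theta)$ for $\ast\in\{s,c,u\}$. $2m(E)$ is the number of zeros of $L_E(z)=V(z)-E$ on $|z|=1$, counted with multiplicity (it is even because $V$ is real on $|z|=1$). Globally trivial means that there are global sections which form a basis of each fiber. A section $\theta\mapsto u(\theta)\in\mathcal X_\xi$ has $\mathfrak A$-valued coordinates if $\theta\mapsto u_k(\theta)$ belongs to $\mathfrak A$ for every $k\in\mathbb Z$. *)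

theory Defs
  imports
    "Jordan_Normal_Form.Matrix"
    "HOL-Library.Function_Algebras"
    "HOL-Complex_Analysis.Complex_Analysis"
begin

subsection \<open>Admissible function algebras\<close>

locale banach_function_algebra =
  fixes A :: "('w \<Rightarrow> complex) set"
    and N :: "('w \<Rightarrow> complex) \<Rightarrow> real"
  assumes one: "(\<lambda>\<theta>. 1) \<in> A"
    and add: "f \<in> A \<Longrightarrow> g \<in> A \<Longrightarrow> (\<lambda>\<theta>. f \<theta> + g \<theta>) \<in> A"
    and mult: "f \<in> A \<Longrightarrow> g \<in> A \<Longrightarrow> (\<lambda>\<theta>. f \<theta> * g \<theta>) \<in> A"
    and scale: "f \<in> A \<Longrightarrow> (\<lambda>\<theta>. c * f \<theta>) \<in> A"
    and norm_nonneg: "f \<in> A \<Longrightarrow> 0 \<le> N f"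
    and norm_eq_0: "f \<in> A \<Longrightarrow> N f = 0 \<longleftrightarrow> f = (\<lambda>\<theta>. 0)"
    and norm_triangle: "f \<in> A \<Longrightarrow> g \<in> A \<Longrightarrow> N (\<lambda>\<theta>. f \<theta> + g \<theta>) \<le> N f + N g"
    and norm_scale: "f \<in> A \<Longrightarrow> N (\<lambda>\<theta>. c * f \<theta>) = cmod c * N f"
    and norm_mult: "f \<in> A \<Longrightarrow> g \<in> A \<Longrightarrow> N (\<lambda>\<theta>. f \<theta> * g \<theta>) \<le> N f * N g"
    and complete:
      "(\<And>i. F i \<in> A) \<Longrightarrow>
       (\<And>e::real. e > 0 \<Longrightarrow> \<exists>K::nat. \<forall>i\<ge>K. \<forall>j\<ge>K. N (\<lambda>\<theta>. F i \<theta> - F j \<theta>) < e) \<Longrightarrow>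
       \<exists>f\<in>A. (\<lambda>i. N (\<lambda>\<theta>. F i \<theta> - f \<theta>)) \<longlonglongrightarrow> 0"

text \<open>Composition with \<open>T\<close> is always linear and multiplicative, so being an isometric
  automorphism of the algebra means being a norm-preserving bijection of it.\<close>

locale admissible = banach_function_algebra A N
  for A :: "('w::metric_space \<Rightarrow> complex) set"
    and N :: "('w \<Rightarrow> complex) \<Rightarrow> real" +
  fixes T :: "'w \<Rightarrow> 'w"
  assumes compact_UNIV: "compact (UNIV :: 'w set)"
    and homeo: "homeomorphism UNIV UNIV T (inv_into UNIV T)"
    and compose_bij: "bij_betw (\<lambda>f. f \<circ> T) A A"
    and compose_isometric: "f \<in> A \<Longrightarrow> N (f \<circ> T) = N f"
    and sup_le_norm: "f \<in> A \<Longrightarrow> cmod (f \<theta>) \<le> N f"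
    and inverse_closed: "f \<in> A \<Longrightarrow> (INF \<theta>. cmod (f \<theta>)) > 0 \<Longrightarrow> (\<lambda>\<theta>. 1 / f \<theta>) \<in> A"

definition int_iterate :: "('w \<Rightarrow> 'w) \<Rightarrow> int \<Rightarrow> 'w \<Rightarrow> 'w" where
  "int_iterate T n = (if n \<ge> 0 then T ^^ nat n else inv_into UNIV T ^^ nat (- n))"

subsection \<open>Analytic functions on the circle\<close>

text \<open>Functions on the circle \<open>\<real>/\<int>\<close> are 1-periodic functions on the line.\<close>

definition circle_analytic :: "(real \<Rightarrow> real) \<Rightarrow> bool" where
  "circle_analytic V \<longleftrightarrow>
     (\<forall>x. V (x + 1) = V x) \<and>
     (\<forall>x0. \<exists>a::nat \<Rightarrow> real. \<exists>r>0. \<forall>x. \<bar>x - x0\<bar> < r \<longrightarrow> (\<lambda>n. a n * (x - x0) ^ n) sums V x)"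

definition fourier_coeff :: "(real \<Rightarrow> real) \<Rightarrow> int \<Rightarrow> complex" where
  "fourier_coeff V n =
     integral {0..1} (\<lambda>x. complex_of_real (V x) * exp (- (2 * pi * \<i> * of_int n * of_real x)))"

definition laurent :: "(real \<Rightarrow> real) \<Rightarrow> complex \<Rightarrow> complex" where
  "laurent V z = (\<Sum>\<^sub>\<infinity>n\<in>UNIV. fourier_coeff V n * z powi n)"

definition annulus :: "real \<Rightarrow> complex set" where
  "annulus h = {z. exp (- h) < cmod z \<and> cmod z < exp h}"

text \<open>Summability is stated separately because \<open>infsum\<close> is \<open>0\<close> on divergent families.\<close>

definition laurent_analytic :: "(real \<Rightarrow> real) \<Rightarrow> real \<Rightarrow> bool" where
  "laurent_analytic V h \<longleftrightarrow>
     (\<forall>z\<in>annulus h. (\<lambda>n. fourier_coeff V n * z powi n) summable_on (UNIV :: int set)) \<and>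
     laurent V holomorphic_on annulus h"

definition circle_zero_count :: "(real \<Rightarrow> real) \<Rightarrow> real \<Rightarrow> nat" where
  "circle_zero_count V E =
     (\<Sum>z | cmod z = 1 \<and> laurent V z - of_real E = 0.
        nat (zorder (\<lambda>w. laurent V w - of_real E) z))"

text \<open>The number of zeros on the unit circle is even, because \<open>V\<close> is real there; the division
  is therefore exact.\<close>

definition half_zero_count :: "(real \<Rightarrow> real) \<Rightarrow> real \<Rightarrow> nat" where
  "half_zero_count V E = circle_zero_count V E div 2"

subsection \<open>Weighted sequence spaces and the solution bundle\<close>

definition cscale :: "complex \<Rightarrow> (int \<Rightarrow> complex) \<Rightarrow> int \<Rightarrow> complex" where
  "cscale c u = (\<lambda>n. c * u n)"

interpretation cseq: vector_space cscale
  by unfold_locales (auto simp: cscale_def fun_eq_iff algebra_simps)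

definition xspace :: "real \<Rightarrow> (int \<Rightarrow> complex) set" where
  "xspace \<xi> = {u. (\<lambda>n. cmod (u n) * exp (- \<xi> * \<bar>real_of_int n\<bar>)) summable_on UNIV}"

definition xnorm :: "real \<Rightarrow> (int \<Rightarrow> complex) \<Rightarrow> real" where
  "xnorm \<xi> u = (\<Sum>\<^sub>\<infinity>n\<in>UNIV. cmod (u n) * exp (- \<xi> * \<bar>real_of_int n\<bar>))"

text \<open>\<open>shift 1\<close> is the shift \<open>S\<close>, and \<open>shift n\<close> is its \<open>n\<close>-th power for every integer \<open>n\<close>.\<close>

definition shift :: "int \<Rightarrow> (int \<Rightarrow> complex) \<Rightarrow> int \<Rightarrow> complex" where
  "shift n u = (\<lambda>k. u (k + n))"

text \<open>Operator norm of the restriction of \<open>\<Phi>\<close> to a subspace \<open>F\<close> of \<open>xspace \<xi>\<close>. For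
  \<open>\<Phi> = shift n\<close> the supremum is finite: the set is bounded by \<open>exp (\<xi> * \<bar>n\<bar>)\<close>.\<close>

definition fiber_opnorm ::
    "real \<Rightarrow> ((int \<Rightarrow> complex) \<Rightarrow> int \<Rightarrow> complex) \<Rightarrow> (int \<Rightarrow> complex) set \<Rightarrow> real" where
  "fiber_opnorm \<xi> \<Phi> F = (SUP u\<in>{u \<in> F. xnorm \<xi> u \<le> 1}. xnorm \<xi> (\<Phi> u))"

definition long_range_op ::
    "(real \<Rightarrow> real) \<Rightarrow> real \<Rightarrow> ('w \<Rightarrow> real) \<Rightarrow> ('w \<Rightarrow> 'w) \<Rightarrow> 'w \<Rightarrow> (int \<Rightarrow> complex) \<Rightarrow> int \<Rightarrow> complex"
  where
  "long_range_op V \<epsilon> W T \<theta> u =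
     (\<lambda>n. (\<Sum>\<^sub>\<infinity>k\<in>UNIV. fourier_coeff V k * u (n + k))
          + of_real (\<epsilon> * W (int_iterate T n \<theta>)) * u n)"

definition solution_fiber ::
    "real \<Rightarrow> (real \<Rightarrow> real) \<Rightarrow> real \<Rightarrow> real \<Rightarrow> ('w \<Rightarrow> real) \<Rightarrow> ('w \<Rightarrow> 'w) \<Rightarrow> 'w \<Rightarrow> (int \<Rightarrow> complex) set"
  where
  "solution_fiber \<xi> V E \<epsilon> W T \<theta> =
     {u \<in> xspace \<xi>. long_range_op V \<epsilon> W T \<theta> u = cscale (of_real E) u}"

definition direct_sum3 ::
    "(int \<Rightarrow> complex) set \<Rightarrow> (int \<Rightarrow> complex) set \<Rightarrow> (int \<Rightarrow> complex) set \<Rightarrow>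
     (int \<Rightarrow> complex) set \<Rightarrow> bool" where
  "direct_sum3 M M1 M2 M3 \<longleftrightarrow>
     cseq.subspace M1 \<and> cseq.subspace M2 \<and> cseq.subspace M3 \<and>
     bij_betw (\<lambda>(a, b, c). a + b + c) (M1 \<times> M2 \<times> M3) M"

definition shift_invariant ::
    "('w \<Rightarrow> 'w) \<Rightarrow> ('w \<Rightarrow> (int \<Rightarrow> complex) set) \<Rightarrow> bool" where
  "shift_invariant T F \<longleftrightarrow> (\<forall>\<theta>. shift 1 ` F \<theta> = F (T \<theta>))"

text \<open>The sections \<open>U 0, \<dots>, U (d - 1)\<close> form a basis of each fiber; injectivity makes the family,
  and not just its range, linearly independent.\<close>

definition global_frame ::
    "('w \<Rightarrow> (int \<Rightarrow> complex) set) \<Rightarrow> nat \<Rightarrow> (nat \<Rightarrow> 'w \<Rightarrow> int \<Rightarrow> complex) \<Rightarrow> bool" where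
  "global_frame F d U \<longleftrightarrow>
     (\<forall>\<theta>. inj_on (\<lambda>i. U i \<theta>) {..<d} \<and>
          cseq.independent ((\<lambda>i. U i \<theta>) ` {..<d}) \<and>
          cseq.span ((\<lambda>i. U i \<theta>) ` {..<d}) = F \<theta>)"

definition globally_trivial :: "('w \<Rightarrow> (int \<Rightarrow> complex) set) \<Rightarrow> bool" where
  "globally_trivial F \<longleftrightarrow> (\<exists>d U. global_frame F d U)"

end

(*
Write the operator as convolution with a kernel plus a small potential. On the sequences u with
sum |u_n| e^(rn) < oo, convolution is invertible unless its symbol V - E has a zero of modulus e^r
or e^(-r): the inverse is convolution with the Laurent coefficients of 1 / (V - E). Choose eta so
small that all zeros of V - E with modulus in (e^(-3 eta), e^(3 eta)) lie on the unit circle. Then the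
operator is invertible for r near eta and 2 eta, and for r near -eta and -2 eta, and a Neumann
series keeps it so after adding a small potential; call the two inverses B_s and B_u.

Cut a solution at the origin, u = u_+ + u_-. The source f = A u_+ = - A u_- decays in both
directions, and u = (u_+ - B_u f) + (B_u f - B_s f) + (u_- + B_s f) is the splitting into unstable,
center and stable solutions; injectivity of A on the weighted spaces makes it unique and gives the
exponential bounds. This does not need V - E to be free of zeros on the boundary |z| = e^xi.

On sequences decaying like e^(-eta |n|) the range of A has a complement e_1, ..., e_d, where d is the
number of zeros on the unit circle: factor V - E into linear factors and a nonvanishing function, and
divide with remainder by one factor at a time. This persists under small potentials, and
B_u e_j - B_s e_j is the frame of the center bundle; its coordinates lie in the function algebra
because the Neumann series converges there. The number d is even, because V is real on the circle
and the coordinate z has no continuous square root there.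
*)
theory Submission
  imports Defs
begin

subsection \<open>Weighted summable sequences and convolution\<close>


text \<open>The two inverses solve A v = f in weights of opposite sign, and they disagree in
  general. For a source f decaying in both directions, B_u f - B_s f is a center solution, and it
  vanishes exactly when f = A v with v decaying in both directions. Every center solution arises
  this way from its own source. The center space is therefore the quotient of the decaying sequences
  by the range of A, which is why a complement of that range, fixed once for V - E, yields a frame
  for every \<theta>.

  The obstacle is that X_\<xi> permits growth in both directions, so a solution lies in no single
  convolution algebra. Every estimate passes through the two halves of the solution and their common
  source.

  The Neumann series is run twice: once for each \<theta> separately to keep range and complement,
  and once with explicit inverse kernels and coordinates in the function algebra, because
  solvability for each \<theta> says nothing about the dependence on \<theta>. All constants come
  from norms of fixed kernels and from |\<epsilon>| N(W), so they are uniform in \<theta>. Stable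
  and unstable solutions are measured with 2 \<eta> and center solutions with \<eta>; this
  difference opens the gaps between the rates.\<close>

definition wt :: "real \<Rightarrow> int \<Rightarrow> real" where
  "wt r n = exp (r * real_of_int n)"

text \<open>The weight e^(r n) is one-sided and multiplicative, which makes each space a convolution
  algebra for either sign of r. For r > 0 it forces decay at +\<infinity> and permits growth at
  -\<infinity>; for r < 0 the roles are exchanged.\<close>

definition ell :: "real \<Rightarrow> (int \<Rightarrow> complex) set" where
  "ell r = {u. (\<lambda>n. cmod (u n) * wt r n) summable_on UNIV}"

definition enorm :: "real \<Rightarrow> (int \<Rightarrow> complex) \<Rightarrow> real" where
  "enorm r u = (\<Sum>\<^sub>\<infinity>n. cmod (u n) * wt r n)"

definition conv :: "(int \<Rightarrow> complex) \<Rightarrow> (int \<Rightarrow> complex) \<Rightarrow> int \<Rightarrow> complex" where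
  "conv a u = (\<lambda>n. \<Sum>\<^sub>\<infinity>k. a k * u (n - k))"

definition kdelta :: "int \<Rightarrow> complex" where
  "kdelta n = (if n = 0 then 1 else 0)"

definition symb :: "(int \<Rightarrow> complex) \<Rightarrow> complex \<Rightarrow> complex" where
  "symb a z = (\<Sum>\<^sub>\<infinity>n. a n * z powi n)"

lemma wt_pos [simp]: "wt r n > 0" and wt_nonneg [simp]: "wt r n \<ge> 0"
  by (auto simp: wt_def)

lemma wt_not_le_0 [simp]: "\<not> wt r n \<le> 0" and wt_neq_0 [simp]: "wt r n \<noteq> 0"
  using wt_pos[of r n] by linarith+

lemma wt_add: "wt r (m + n) = wt r m * wt r n"
  by (simp add: wt_def algebra_simps exp_add)

lemma wt_diff: "wt r m * wt r (n - m) = wt r n"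
  by (simp flip: wt_add)

lemma norm_powi_exp: "cmod z = exp r \<Longrightarrow> cmod (z powi n) = wt r n"
  by (simp add: norm_power_int wt_def exp_power_int mult.commute)

lemma enorm_nonneg [simp]: "enorm r u \<ge> 0"
  unfolding enorm_def by (intro infsum_nonneg) auto

lemma coord_le_enorm: assumes "u \<in> ell r" shows "cmod (u n) * wt r n \<le> enorm r u"
  using finite_sum_le_infsum[of "\<lambda>n. cmod (u n) * wt r n" UNIV "{n}"] assms
  by (simp add: enorm_def ell_def)

lemma enorm_eq_0: "u \<in> ell r \<Longrightarrow> enorm r u = 0 \<Longrightarrow> u = (\<lambda>_. 0)"
  using coord_le_enorm[of u r] by (auto simp: fun_eq_iff mult_le_0_iff)

lemma ell_mono_norm:
  assumes "v \<in> ell r" "\<And>n. cmod (u n) \<le> cmod (v n)"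
  shows "u \<in> ell r" "enorm r u \<le> enorm r v"
proof -
  show u: "u \<in> ell r"
    using assms(1) unfolding ell_def mem_Collect_eq
    by (rule summable_on_comparison_test) (auto intro: mult_right_mono assms(2))
  show "enorm r u \<le> enorm r v"
    unfolding enorm_def using assms u
    by (intro infsum_mono mult_right_mono) (auto simp: ell_def)
qed

lemma ell_add: assumes "u \<in> ell r" "v \<in> ell r"
  shows "(\<lambda>n. u n + v n) \<in> ell r" "enorm r (\<lambda>n. u n + v n) \<le> enorm r u + enorm r v"
proof -
  have s: "(\<lambda>n. cmod (u n) * wt r n + cmod (v n) * wt r n) summable_on UNIV"
    using assms by (intro summable_on_add) (auto simp: ell_def)
  have le: "cmod (u n + v n) * wt r n \<le> cmod (u n) * wt r n + cmod (v n) * wt r n" for n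
    by (metis mult_right_mono norm_triangle_ineq ring_class.ring_distribs(2) wt_nonneg)
  show uv: "(\<lambda>n. u n + v n) \<in> ell r"
    using le unfolding ell_def mem_Collect_eq
    by (intro summable_on_comparison_test[OF s]) auto
  have "enorm r (\<lambda>n. u n + v n) \<le> (\<Sum>\<^sub>\<infinity>n. cmod (u n) * wt r n + cmod (v n) * wt r n)"
    unfolding enorm_def using uv s le by (intro infsum_mono) (auto simp: ell_def)
  also have "\<dots> = enorm r u + enorm r v"
    unfolding enorm_def using assms by (intro infsum_add) (auto simp: ell_def)
  finally show "enorm r (\<lambda>n. u n + v n) \<le> enorm r u + enorm r v" .
qed

lemma ell_zero [simp]: "(\<lambda>n. 0) \<in> ell r" "enorm r (\<lambda>n. 0) = 0"
  by (auto simp: ell_def enorm_def)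

lemma ell_scale: assumes "u \<in> ell r"
  shows "(\<lambda>n. c * u n) \<in> ell r" "enorm r (\<lambda>n. c * u n) = cmod c * enorm r u"
  using assms by (auto simp: ell_def enorm_def norm_mult mult.assoc infsum_cmult_right'
    intro: summable_on_cmult_right)

lemma ell_minus: "u \<in> ell r \<Longrightarrow> (\<lambda>n. - u n) \<in> ell r" "enorm r (\<lambda>n. - u n) = enorm r u"
  by (auto simp: ell_def enorm_def)

lemma ell_diff: assumes "u \<in> ell r" "v \<in> ell r"
  shows "(\<lambda>n. u n - v n) \<in> ell r" "enorm r (\<lambda>n. u n - v n) \<le> enorm r u + enorm r v"
  using ell_add[OF assms(1) ell_minus(1)[OF assms(2)]] ell_minus(2)[of r v] by auto

lemma ell_sum: assumes "finite J" "\<And>j. j \<in> J \<Longrightarrow> u j \<in> ell r"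
  shows "(\<lambda>n. \<Sum>j\<in>J. u j n) \<in> ell r"
  using assms by (induction J rule: finite_induct) (auto intro: ell_add)

lemma ell_mult_bounded: assumes "u \<in> ell r" "\<And>n. cmod (w n) \<le> B"
  shows "(\<lambda>n. w n * u n) \<in> ell r" "enorm r (\<lambda>n. w n * u n) \<le> B * enorm r u"
proof -
  have B: "B \<ge> 0" using assms(2)[of 0] norm_ge_zero order_trans by blast
  have "cmod (w n * u n) \<le> cmod (complex_of_real B * u n)" for n
    using assms(2)[of n] B by (auto simp: norm_mult intro: mult_right_mono)
  from ell_mono_norm[of "\<lambda>n. complex_of_real B * u n" r, OF _ this] ell_scale[OF assms(1), of "complex_of_real B"] B
  show "(\<lambda>n. w n * u n) \<in> ell r" "enorm r (\<lambda>n. w n * u n) \<le> B * enorm r u" by auto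
qed

lemma ell_finite_support: assumes "finite {n. u n \<noteq> 0}" shows "u \<in> ell r"
  unfolding ell_def by (auto intro!: finite_nonzero_values_imp_summable_on finite_subset[OF _ assms])

lemma kdelta_ell [simp]: "kdelta \<in> ell r"
  by (intro ell_finite_support) (simp add: kdelta_def)

lemma enorm_kdelta [simp]: "enorm r kdelta = 1"
proof -
  have "enorm r kdelta = (\<Sum>\<^sub>\<infinity>n\<in>{0}. cmod (kdelta n) * wt r n)"
    unfolding enorm_def by (intro infsum_cong_neutral) (auto simp: kdelta_def)
  thus ?thesis by (simp add: kdelta_def wt_def)
qed

section \<open>Convolution on the weighted spaces\<close>

lemma summable_on_product_nonneg:
  fixes x :: "'a \<Rightarrow> real" and y :: "'b \<Rightarrow> real"
  assumes "x summable_on A" "y summable_on B" "\<And>k. k \<in> A \<Longrightarrow> x k \<ge> 0" "\<And>k. k \<in> B \<Longrightarrow> y k \<ge> 0"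
  shows "(\<lambda>(k,m). x k * y m) summable_on A \<times> B"
proof (rule summable_on_SigmaI)
  show "((\<lambda>m. case (k, m) of (k, m) \<Rightarrow> x k * y m) has_sum x k * infsum y B) B" for k
    using assms by (auto intro!: has_sum_cmult_right)
  show "(\<lambda>k. x k * infsum y B) summable_on A"
    using assms by (intro summable_on_cmult_left)
qed (use assms in auto)

text \<open>The shear (n, k) -> (k, n - k) is a bijection that turns the double family of a
  convolution into a product family.\<close>

lemma summable_conv_real:
  fixes x y :: "int \<Rightarrow> real"
  assumes "x summable_on UNIV" "y summable_on UNIV" "\<And>k. x k \<ge> 0" "\<And>k. y k \<ge> 0"
  shows "(\<lambda>(n,k). x k * y (n - k)) summable_on UNIV \<times> UNIV"
    and "infsum (\<lambda>(n,k). x k * y (n - k)) (UNIV \<times> UNIV) = infsum x UNIV * infsum y UNIV"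
proof -
  have p: "(\<lambda>(k,m). x k * y m) summable_on UNIV \<times> UNIV"
    by (intro summable_on_product_nonneg assms)
  have bij: "bij_betw (\<lambda>(n,k). (k, n - k)) (UNIV \<times> UNIV) (UNIV \<times> UNIV :: (int \<times> int) set)"
    by (rule bij_betw_byWitness[of _ "\<lambda>(k,m). (k + m, k)"]) auto
  have eq: "(\<lambda>(n,k). x k * y (n - k)) = (\<lambda>p. (\<lambda>(k,m). x k * y m) ((\<lambda>(n,k). (k, n - k)) p))"
    by (auto simp: fun_eq_iff)
  show "(\<lambda>(n,k). x k * y (n - k)) summable_on UNIV \<times> UNIV"
    unfolding eq summable_on_reindex_bij_betw[OF bij] by (rule p)
  have "infsum (\<lambda>(n,k). x k * y (n - k)) (UNIV \<times> UNIV) = infsum (\<lambda>(k,m). x k * y m) (UNIV \<times> UNIV)"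
    unfolding eq infsum_reindex_bij_betw[OF bij] ..
  also have "\<dots> = (\<Sum>\<^sub>\<infinity>k. \<Sum>\<^sub>\<infinity>m. x k * y m)"
    using infsum_Sigma'_banach[OF p] by simp
  also have "\<dots> = infsum x UNIV * infsum y UNIV"
    by (simp add: infsum_cmult_right' infsum_cmult_left')
  finally show "infsum (\<lambda>(n,k). x k * y (n - k)) (UNIV \<times> UNIV) = infsum x UNIV * infsum y UNIV" .
qed

context
  fixes a b :: "int \<Rightarrow> complex" and r :: real
  assumes a: "a \<in> ell r" and b: "b \<in> ell r"
begin

private lemma
  shows dsum: "(\<lambda>(n,k). (cmod (a k) * wt r k) * (cmod (b (n - k)) * wt r (n - k))) summable_on UNIV \<times> UNIV"
  and deq: "infsum (\<lambda>(n,k). (cmod (a k) * wt r k) * (cmod (b (n - k)) * wt r (n - k))) (UNIV \<times> UNIV)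
    = enorm r a * enorm r b"
  unfolding enorm_def using a b by (intro summable_conv_real; auto simp: ell_def)+

private lemma wsplit: "(cmod (a k) * wt r k) * (cmod (b (n - k)) * wt r (n - k)) = cmod (a k * b (n - k)) * wt r n"
  by (simp add: norm_mult mult_ac flip: wt_diff[of r k n])

lemma conv_double_summable:
  "(\<lambda>(n,k). cmod (a k * b (n - k)) * wt r n) summable_on UNIV \<times> UNIV"
  using dsum unfolding wsplit .

lemma conv_abs_summable: "(\<lambda>k. cmod (a k * b (n - k))) summable_on UNIV"
proof -
  have "(\<lambda>k. cmod (a k * b (n - k)) * wt r n) summable_on UNIV"
    using summable_on_SigmaD1[OF conv_double_summable, of n] by simp
  from summable_on_cmult_left[OF this, of "inverse (wt r n)"] show ?thesis
    using wt_pos[of r n] by (simp add: mult.assoc)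
qed

lemma conv_summable: "(\<lambda>k. a k * b (n - k)) summable_on UNIV"
  by (rule Infinite_Sum.abs_summable_summable[OF conv_abs_summable])

lemma conv_ell: "conv a b \<in> ell r" and conv_enorm: "enorm r (conv a b) \<le> enorm r a * enorm r b"
proof -
  define H where "H n = (\<Sum>\<^sub>\<infinity>k. cmod (a k * b (n - k)) * wt r n)" for n
  have H: "H summable_on UNIV" and Heq: "infsum H UNIV = enorm r a * enorm r b"
    using summable_on_Sigma_banach[OF conv_double_summable] infsum_Sigma'_banach[OF conv_double_summable] deq
    unfolding H_def wsplit by auto
  have le: "cmod (conv a b n) * wt r n \<le> H n" for n
    using norm_infsum_bound[OF conv_abs_summable[of n]]
    by (simp add: H_def conv_def infsum_cmult_left' mult_right_mono)
  show 1: "conv a b \<in> ell r"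
    using le unfolding ell_def mem_Collect_eq
    by (intro summable_on_comparison_test[OF H]) auto
  have "enorm r (conv a b) \<le> infsum H UNIV"
    unfolding enorm_def using 1 H le by (intro infsum_mono) (auto simp: ell_def)
  thus "enorm r (conv a b) \<le> enorm r a * enorm r b" by (simp add: Heq)
qed

lemma symb_conv: assumes z: "cmod z = exp r"
  shows "symb (conv a b) z = symb a z * symb b z"
proof -
  have z0: "z \<noteq> 0" using z by auto
  have s: "(\<lambda>(n,k). a k * b (n - k) * z powi n) summable_on UNIV \<times> UNIV"
    by (rule Infinite_Sum.abs_summable_summable)
      (use conv_double_summable in \<open>simp add: norm_mult norm_powi_exp[OF z] case_prod_unfold\<close>)
  have "symb (conv a b) z = (\<Sum>\<^sub>\<infinity>n. \<Sum>\<^sub>\<infinity>k. a k * b (n - k) * z powi n)"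
    by (simp add: symb_def conv_def infsum_cmult_left')
  also have "\<dots> = (\<Sum>\<^sub>\<infinity>k. \<Sum>\<^sub>\<infinity>n. a k * b (n - k) * z powi n)"
    by (rule infsum_swap_banach[OF s])
  also have "\<dots> = (\<Sum>\<^sub>\<infinity>k. \<Sum>\<^sub>\<infinity>m. (a k * z powi k) * (b m * z powi m))"
  proof (rule infsum_cong)
    fix k
    show "(\<Sum>\<^sub>\<infinity>n. a k * b (n - k) * z powi n) = (\<Sum>\<^sub>\<infinity>m. (a k * z powi k) * (b m * z powi m))"
      by (rule infsum_reindex_bij_witness[of _ "\<lambda>m. m + k" "\<lambda>n. n - k"])
        (use z0 in \<open>auto simp: power_int_add[symmetric] mult_ac power_int_diff\<close>)
  qed
  also have "\<dots> = symb a z * symb b z"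
    by (simp add: symb_def infsum_cmult_right' infsum_cmult_left')
  finally show ?thesis .
qed

end

lemma conv_commute: "conv a b = conv b a"
proof
  fix n
  show "conv a b n = conv b a n" unfolding conv_def
    by (rule infsum_reindex_bij_witness[of _ "\<lambda>k. n - k" "\<lambda>k. n - k"]) auto
qed

text \<open>One weight common to all three factors is essential: a symbol with zeros on the circle
  has two inverse kernels in different weights, and associativity across those weights would make
  them equal.\<close>

lemma conv_assoc:
  assumes a: "a \<in> ell r" and b: "b \<in> ell r" and c: "c \<in> ell r"
  shows "conv (conv a b) c = conv a (conv b c)"
proof
  fix n
  have s: "(\<lambda>(m,k). a k * b (m - k) * c (n - m)) summable_on UNIV \<times> UNIV"
  proof (rule Infinite_Sum.abs_summable_summable)
    have S: "(\<lambda>p. (enorm r c * inverse (wt r n)) * (case p of (m,k) \<Rightarrow> cmod (a k * b (m - k)) * wt r m)) summable_on UNIV \<times> UNIV"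
      by (intro summable_on_cmult_right conv_double_summable[OF a b])
    show "(\<lambda>p. cmod (case p of (m,k) \<Rightarrow> a k * b (m - k) * c (n - m))) summable_on UNIV \<times> UNIV"
    proof (rule Infinite_Sum.abs_summable_on_comparison_test'[OF S], clarsimp)
      fix m k
      \<comment> \<open>A single coordinate of c is at most a constant times \<open>wt r m\<close>,
        so the double family of a and b alone serves as a summable majorant.\<close>
      have "cmod (c (n - m)) * wt r (n - m) \<le> enorm r c" by (rule coord_le_enorm[OF c])
      hence "cmod (c (n - m)) \<le> enorm r c * inverse (wt r n) * wt r m"
        using wt_pos[of r "n"] wt_pos[of r "n-m"] wt_pos[of r m] wt_diff[of r m n, symmetric]
        by (simp add: field_simps)
      from mult_left_mono[OF this, of "cmod (a k * b (m - k))"]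
      show "cmod (a k * b (m - k) * c (n - m)) \<le> enorm r c * inverse (wt r n) * (cmod (a k * b (m - k)) * wt r m)"
        by (simp add: norm_mult mult_ac)
    qed
  qed
  have "conv (conv a b) c n = (\<Sum>\<^sub>\<infinity>m. \<Sum>\<^sub>\<infinity>k. a k * b (m - k) * c (n - m))"
    by (simp add: conv_def infsum_cmult_left')
  also have "\<dots> = (\<Sum>\<^sub>\<infinity>k. \<Sum>\<^sub>\<infinity>m. a k * b (m - k) * c (n - m))"
    by (rule infsum_swap_banach[OF s])
  also have "\<dots> = (\<Sum>\<^sub>\<infinity>k. \<Sum>\<^sub>\<infinity>j. a k * (b j * c (n - k - j)))"
  proof (rule infsum_cong)
    fix k
    show "(\<Sum>\<^sub>\<infinity>m. a k * b (m - k) * c (n - m)) = (\<Sum>\<^sub>\<infinity>j. a k * (b j * c (n - k - j)))"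
      by (rule infsum_reindex_bij_witness[of _ "\<lambda>m. m + k" "\<lambda>n. n - k"]) (auto simp: algebra_simps)
  qed
  also have "\<dots> = conv a (conv b c) n"
    by (simp add: conv_def infsum_cmult_right')
  finally show "conv (conv a b) c n = conv a (conv b c) n" .
qed

lemma conv_kdelta [simp]: "conv kdelta u = u" "conv u kdelta = u"
proof -
  show *: "conv kdelta u = u"
  proof
    fix n
    have "conv kdelta u n = (\<Sum>\<^sub>\<infinity>k\<in>{0}. kdelta k * u (n - k))"
      unfolding conv_def by (intro infsum_cong_neutral) (auto simp: kdelta_def)
    thus "conv kdelta u n = u n" by (simp add: kdelta_def)
  qed
  thus "conv u kdelta = u" by (simp add: conv_commute)
qed

lemma conv_zero [simp]: "conv a (\<lambda>_. 0) = (\<lambda>_. 0)" "conv (\<lambda>_. 0) a = (\<lambda>_. 0)"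
  by (auto simp: conv_def)

lemma conv_add_right:
  assumes "a \<in> ell r" "u \<in> ell r" "v \<in> ell r"
  shows "conv a (\<lambda>n. u n + v n) = (\<lambda>n. conv a u n + conv a v n)"
  using conv_summable[OF assms(1,2)] conv_summable[OF assms(1,3)]
  by (auto simp: conv_def ring_distribs infsum_add)

lemma conv_scale_right: "conv a (\<lambda>n. c * u n) = (\<lambda>n. c * conv a u n)"
  by (simp add: conv_def mult.left_commute[of _ c] infsum_cmult_right')

lemma conv_minus_right: "conv a (\<lambda>n. - u n) = (\<lambda>n. - conv a u n)"
  using conv_scale_right[of a "-1" u] by simp

lemma conv_diff_right:
  assumes "a \<in> ell r" "u \<in> ell r" "v \<in> ell r"
  shows "conv a (\<lambda>n. u n - v n) = (\<lambda>n. conv a u n - conv a v n)"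
  using conv_add_right[OF assms(1,2) ell_minus(1)[OF assms(3)]] by (simp add: conv_minus_right)

text \<open>This plays the part of completeness of \<open>ell r\<close>: Neumann series are summed
  coordinate by coordinate, and summable norms keep the sum in the space and let convolution pass
  under it.\<close>

lemma ell_series:
  fixes b :: "nat \<Rightarrow> int \<Rightarrow> complex"
  assumes b: "\<And>k. b k \<in> ell r" and s: "(\<lambda>k. enorm r (b k)) summable_on UNIV"
  shows ell_series_summable: "(\<lambda>k. b k n) summable_on UNIV"
    and ell_series_ell: "(\<lambda>n. \<Sum>\<^sub>\<infinity>k. b k n) \<in> ell r"
    and ell_series_enorm: "enorm r (\<lambda>n. \<Sum>\<^sub>\<infinity>k. b k n) \<le> (\<Sum>\<^sub>\<infinity>k. enorm r (b k))"
    and conv_series: "a \<in> ell r \<Longrightarrow> conv a (\<lambda>n. \<Sum>\<^sub>\<infinity>k. b k n) n = (\<Sum>\<^sub>\<infinity>k. conv a (b k) n)"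
proof -
  have bd: "cmod (b k n) \<le> enorm r (b k) * inverse (wt r n)" for k n
    using coord_le_enorm[OF b[of k], of n] wt_pos[of r n] by (simp add: field_simps)
  show abs: "(\<lambda>k. b k n) summable_on UNIV" for n
    by (rule Infinite_Sum.abs_summable_summable,
        rule Infinite_Sum.abs_summable_on_comparison_test'[OF summable_on_cmult_left[OF s] bd])
  have abs': "(\<lambda>k. cmod (b k n)) summable_on UNIV" for n
    by (rule summable_on_iff_abs_summable_on_complex[THEN iffD1, OF abs])
  have S: "(\<lambda>(k,n). cmod (b k n) * wt r n) summable_on UNIV \<times> UNIV"
  proof (rule summable_on_SigmaI)
    show "((\<lambda>n. case (k,n) of (k,n) \<Rightarrow> cmod (b k n) * wt r n) has_sum enorm r (b k)) UNIV" for k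
      using b[of k] unfolding enorm_def ell_def by auto
  qed (use s in auto)
  have S': "(\<lambda>(n,k). cmod (b k n) * wt r n) summable_on UNIV \<times> UNIV"
    using summable_on_swap[of "\<lambda>(k,n). cmod (b k n) * wt r n" UNIV UNIV] S by (simp add: case_prod_unfold)
  define H where "H n = (\<Sum>\<^sub>\<infinity>k. cmod (b k n) * wt r n)" for n
  have H: "H summable_on UNIV" unfolding H_def by (rule summable_on_Sigma_banach[OF S'])
  have Heq: "infsum H UNIV = (\<Sum>\<^sub>\<infinity>k. enorm r (b k))"
    unfolding H_def enorm_def by (rule infsum_swap_banach[OF S'])
  have le: "cmod (\<Sum>\<^sub>\<infinity>k. b k n) * wt r n \<le> H n" for n
    using norm_infsum_bound[OF abs'[of n]] by (simp add: H_def infsum_cmult_left' mult_right_mono)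
  show 1: "(\<lambda>n. \<Sum>\<^sub>\<infinity>k. b k n) \<in> ell r"
    using le unfolding ell_def mem_Collect_eq
    by (intro summable_on_comparison_test[OF H]) auto
  show "enorm r (\<lambda>n. \<Sum>\<^sub>\<infinity>k. b k n) \<le> (\<Sum>\<^sub>\<infinity>k. enorm r (b k))"
    unfolding Heq[symmetric] unfolding enorm_def using 1 H le by (intro infsum_mono) (auto simp: ell_def)
  show "conv a (\<lambda>n. \<Sum>\<^sub>\<infinity>k. b k n) n = (\<Sum>\<^sub>\<infinity>k. conv a (b k) n)" if a: "a \<in> ell r"
  proof -
    have P: "(\<lambda>(m,k). (cmod (a m) * wt r m) * enorm r (b k)) summable_on UNIV \<times> UNIV"
      using a s by (intro summable_on_product_nonneg) (auto simp: ell_def)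
    have "(\<lambda>(m,k). a m * b k (n - m)) summable_on UNIV \<times> UNIV"
    proof (rule Infinite_Sum.abs_summable_summable, rule Infinite_Sum.abs_summable_on_comparison_test'[OF summable_on_cmult_right[OF P, of "inverse (wt r n)"]], clarsimp)
      fix m k
      have "cmod (a m * b k (n - m)) \<le> cmod (a m) * (enorm r (b k) * inverse (wt r (n - m)))"
        using bd by (simp add: norm_mult mult_left_mono)
      also have "inverse (wt r (n - m)) = wt r m * inverse (wt r n)"
        using wt_diff[of r m n] wt_pos[of r m] wt_pos[of r n] wt_pos[of r "n-m"] by (simp add: field_simps)
      finally show "cmod (a m * b k (n - m)) \<le> inverse (wt r n) * (cmod (a m) * wt r m * enorm r (b k))"
        by (simp add: mult_ac)
    qed
    from infsum_swap_banach[OF this] show ?thesis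
      by (simp add: conv_def infsum_cmult_right')
  qed
qed

subsection \<open>Analytic symbols and their inverse kernels\<close>


text \<open>The radii are logarithmic, so the circle |z| = e^r pairs with the weight r of
  \<open>ell r\<close>.\<close>

definition ann :: "real \<Rightarrow> real \<Rightarrow> complex set" where
  "ann s t = {z. exp s < cmod z \<and> cmod z < exp t}"

lemma annD: "z \<in> ann s t \<Longrightarrow> z \<noteq> 0" "z \<in> ann s t \<Longrightarrow> s < ln (cmod z)" "z \<in> ann s t \<Longrightarrow> ln (cmod z) < t"
  "z \<in> ann s t \<Longrightarrow> cmod z = exp (ln (cmod z))"
proof -
  assume z: "z \<in> ann s t"
  hence "0 < cmod z" using less_trans[OF exp_gt_zero, of s "cmod z"] by (auto simp: ann_def)
  moreover from this show "z \<noteq> 0" by auto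
  ultimately show "s < ln (cmod z)" "ln (cmod z) < t" "cmod z = exp (ln (cmod z))"
    using z ln_less_cancel_iff[of "exp s" "cmod z"] ln_less_cancel_iff[of "cmod z" "exp t"] by (auto simp: ann_def)
qed

lemma annI: "cmod z = exp r \<Longrightarrow> s < r \<Longrightarrow> r < t \<Longrightarrow> z \<in> ann s t"
  by (auto simp: ann_def)

lemma open_ann: "open (ann s t)"
  unfolding ann_def by (intro open_Collect_conj open_Collect_less continuous_intros)

lemma connected_ann: "connected (ann s t)"
  using connected_annulus(1)[where a = "0::complex"] by (simp add: ann_def)

text \<open>For fixed n the weight is monotone in r, so one of the two end points dominates.
  Membership at two weights thereby gives membership at every weight between them.\<close>

lemma wt_between: assumes "s \<le> r" "r \<le> t" shows "wt r n \<le> wt s n + wt t n"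
proof (cases "n \<ge> 0")
  case True
  hence "wt r n \<le> wt t n" using assms by (auto simp: wt_def intro: mult_right_mono)
  thus ?thesis using wt_nonneg[of s n] by linarith
next
  case False
  hence "wt r n \<le> wt s n" using assms by (auto simp: wt_def intro: mult_right_mono_neg)
  thus ?thesis using wt_nonneg[of t n] by linarith
qed

lemma ell_between_bound:
  assumes "f \<in> ell s" "f \<in> ell t"
  shows "(\<lambda>n. cmod (f n) * (wt s n + wt t n)) summable_on UNIV"
  using summable_on_add[of "\<lambda>n. cmod (f n) * wt s n" UNIV "\<lambda>n. cmod (f n) * wt t n"] assms
  by (simp add: ell_def ring_distribs)

lemma ell_between:
  assumes "f \<in> ell s" "f \<in> ell t" "s \<le> r" "r \<le> t"
  shows "f \<in> ell r" "enorm r f \<le> enorm s f + enorm t f"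
proof -
  have le: "cmod (f n) * wt r n \<le> cmod (f n) * (wt s n + wt t n)" for n
    using wt_between[OF assms(3,4)] by (intro mult_left_mono) auto
  show 1: "f \<in> ell r"
    unfolding ell_def mem_Collect_eq
    by (rule summable_on_comparison_test[OF ell_between_bound[OF assms(1,2)] le]) auto
  have "enorm r f \<le> (\<Sum>\<^sub>\<infinity>n. cmod (f n) * (wt s n + wt t n))"
    unfolding enorm_def using 1 le ell_between_bound[OF assms(1,2)]
    by (intro infsum_mono) (auto simp: ell_def)
  also have "\<dots> = enorm s f + enorm t f"
    unfolding enorm_def ring_distribs using assms(1,2) by (intro infsum_add) (auto simp: ell_def)
  finally show "enorm r f \<le> enorm s f + enorm t f" .
qed

lemma symb_uniform_limit:
  assumes "f \<in> ell s" "f \<in> ell t"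
  shows "uniform_limit {z. exp s \<le> cmod z \<and> cmod z \<le> exp t}
    (\<lambda>X z. \<Sum>n\<in>X. f n * z powi n) (symb f) (finite_subsets_at_top UNIV)"
  unfolding symb_def
proof (rule Weierstrass_m_test_general[OF _ ell_between_bound[OF assms]])
  fix n z assume z: "z \<in> {z. exp s \<le> cmod z \<and> cmod z \<le> exp t}"
  define r where "r = ln (cmod z)"
  have "cmod z > 0" using z less_le_trans[OF exp_gt_zero, of s "cmod z"] by auto
  hence r: "cmod z = exp r" by (simp add: r_def)
  with z have "s \<le> r" "r \<le> t" by auto
  thus "cmod (f n * z powi n) \<le> cmod (f n) * (wt s n + wt t n)"
    using wt_between by (auto simp: norm_mult norm_powi_exp[OF r] intro!: mult_left_mono)
qed

lemma symb_holomorphic: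
  assumes f: "\<And>r. r1 < r \<Longrightarrow> r < r2 \<Longrightarrow> f \<in> ell r"
  shows "symb f holomorphic_on ann r1 r2"
proof -
  have "symb f field_differentiable (at z)" if z: "z \<in> ann r1 r2" for z
  proof -
    define r where "r = ln (cmod z)"
    note r = annD[OF z, folded r_def]
    obtain s where s: "r1 < s" "s < r" using r(2) dense by blast
    obtain t where t: "r < t" "t < r2" using r(3) dense by blast
    have "z \<in> ann s t" using annI[OF r(4)] s t by auto
    then obtain e where e: "e > 0" "cball z e \<subseteq> ann s t"
      using open_ann open_contains_cball by metis
    have sub: "cball z e \<subseteq> {z. exp s \<le> cmod z \<and> cmod z \<le> exp t}"
      using e(2) by (auto simp: ann_def)
    have nz: "\<And>w. w \<in> cball z e \<Longrightarrow> w \<noteq> 0" using e(2) annD(1) by blast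
    obtain "symb f holomorphic_on ball z e"
    proof (rule holomorphic_uniform_limit)
      show "\<forall>\<^sub>F X in finite_subsets_at_top UNIV. continuous_on (cball z e) (\<lambda>w. \<Sum>n\<in>X. f n * w powi n) \<and>
          (\<lambda>w. \<Sum>n\<in>X. f n * w powi n) holomorphic_on ball z e"
        using nz by (intro always_eventually allI conjI continuous_intros holomorphic_intros) auto
      have "f \<in> ell s" "f \<in> ell t" using f s t r by auto
      from symb_uniform_limit[OF this] show "uniform_limit (cball z e) (\<lambda>X w. \<Sum>n\<in>X. f n * w powi n) (symb f) (finite_subsets_at_top UNIV)"
        using sub by (rule uniform_limit_on_subset)
    qed auto
    thus ?thesis using e(1) by (meson centre_in_ball holomorphic_on_imp_differentiable_at open_ball)
  qed
  thus ?thesis by (auto simp: holomorphic_on_def intro: field_differentiable_at_within)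
qed

section \<open>Laurent coefficients by contour integration\<close>

lemma contour_integral_powi:
  assumes "\<rho> > 0"
  shows "contour_integral (circlepath 0 \<rho>) (\<lambda>z. z powi m) = (if m = -1 then 2 * pi * \<i> else 0)"
proof (cases "m = -1")
  case True
  thus ?thesis using contour_integral_circlepath[OF assms, of 0]
    by (simp add: power_int_minus inverse_eq_divide)
next
  case False
  hence m: "of_int (m + 1) \<noteq> (0::complex)" by (metis add_eq_0_iff2 of_int_eq_0_iff)
  have "((\<lambda>z. z powi m) has_contour_integral 0) (circlepath 0 \<rho>)"
  proof (rule Cauchy_theorem_primitive[of "-{0}" "\<lambda>z. z powi (m + 1) / of_int (m + 1)"])
    fix x :: complex assume "x \<in> - {0}"
    hence "((\<lambda>z. z powi (m + 1) / of_int (m + 1)) has_field_derivative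
        (of_int (m + 1) * x powi (m + 1 - 1) * 1) / of_int (m + 1)) (at x within - {0})"
      by (intro DERIV_cdivide DERIV_power_int DERIV_ident) auto
    thus "((\<lambda>z. z powi (m + 1) / of_int (m + 1)) has_field_derivative x powi m) (at x within - {0})"
      using m by simp
  qed (use assms in auto)
  with False show ?thesis by (simp add: contour_integral_unique)
qed

lemma powi_mult_powi: "cmod x = exp r \<Longrightarrow> x powi k * x powi m = x powi (k + m)"
  by (subst power_int_add) auto

lemma bounded_on_sphere:
  fixes g :: "complex \<Rightarrow> complex"
  assumes "continuous_on (sphere 0 \<rho>) g"
  obtains B where "B \<ge> 0" "\<And>z. cmod z = \<rho> \<Longrightarrow> cmod (g z) \<le> B"
proof -
  have "bounded (g ` sphere 0 \<rho>)"
    by (intro compact_imp_bounded compact_continuous_image assms compact_sphere)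
  then obtain B where "\<forall>x\<in>g ` sphere 0 \<rho>. cmod x \<le> B" unfolding bounded_iff by blast
  thus ?thesis by (intro that[of "max B 0"]) (auto intro: max.coboundedI1)
qed

text \<open>The Laurent series converges uniformly on its circle, so it may be integrated term by
  term. Uniqueness of coefficients and the inversion of symbols both rest on this.\<close>

lemma contour_integral_symb:
  assumes f: "f \<in> ell r" and g: "continuous_on (sphere 0 (exp r)) g"
  shows "((\<lambda>n. f n * contour_integral (circlepath 0 (exp r)) (\<lambda>z. z powi n * g z)) has_sum
    contour_integral (circlepath 0 (exp r)) (\<lambda>z. symb f z * g z)) UNIV"
proof -
  have gint: "(\<lambda>z. z powi n * g z) contour_integrable_on circlepath 0 (exp r)" for n
    by (intro contour_integrable_continuous_circlepath) (auto intro!: continuous_intros g)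
  obtain B where B: "B \<ge> 0" "\<And>z. cmod z = exp r \<Longrightarrow> cmod (g z) \<le> B"
    using bounded_on_sphere[OF g] by blast
  have UL: "uniform_limit (sphere 0 (exp r)) (\<lambda>X z. \<Sum>n\<in>X. f n * (z powi n * g z))
     (\<lambda>z. \<Sum>\<^sub>\<infinity>n. f n * (z powi n * g z)) (finite_subsets_at_top UNIV)"
  proof (rule Weierstrass_m_test_general)
    show "(\<lambda>n. cmod (f n) * wt r n * B) summable_on UNIV"
      using f by (intro summable_on_cmult_left) (simp add: ell_def)
    fix n and z :: complex assume z: "z \<in> sphere 0 (exp r)"
    thus "cmod (f n * (z powi n * g z)) \<le> cmod (f n) * wt r n * B"
      using norm_powi_exp[of z r] B(2)[of z]
      by (auto simp: norm_mult mult.assoc intro!: mult_left_mono)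
  qed
  have eq: "(\<Sum>\<^sub>\<infinity>n. f n * (z powi n * g z)) = symb f z * g z" for z
    by (simp add: symb_def infsum_cmult_left' mult.assoc[symmetric])
  have "((\<lambda>X. contour_integral (circlepath 0 (exp r)) (\<lambda>z. \<Sum>n\<in>X. f n * (z powi n * g z))) \<longlongrightarrow>
     contour_integral (circlepath 0 (exp r)) (\<lambda>z. symb f z * g z)) (finite_subsets_at_top UNIV)"
    using UL unfolding eq
    by (rule contour_integral_uniform_limit_circlepath(2)[rotated])
      (auto intro!: eventually_finite_subsets_at_top_weakI contour_integrable_sum contour_integrable_lmul gint)
  moreover have "\<forall>\<^sub>F X in finite_subsets_at_top UNIV.
     contour_integral (circlepath 0 (exp r)) (\<lambda>z. \<Sum>n\<in>X. f n * (z powi n * g z)) =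
     (\<Sum>n\<in>X. f n * contour_integral (circlepath 0 (exp r)) (\<lambda>z. z powi n * g z))"
    by (intro eventually_finite_subsets_at_top_weakI)
      (simp add: contour_integral_sum contour_integrable_lmul gint contour_integral_lmul)
  ultimately show ?thesis
    unfolding has_sum_def by (rule Lim_transform_eventually)
qed

text \<open>Integrating against z^(-n-1) isolates the n-th coefficient.\<close>

lemma symb_eq_0_imp:
  assumes f: "f \<in> ell r" and z: "\<And>z. cmod z = exp r \<Longrightarrow> symb f z = 0"
  shows "f = (\<lambda>_. 0)"
proof
  fix n
  have "((\<lambda>k. f k * contour_integral (circlepath 0 (exp r)) (\<lambda>z. z powi k * z powi (- n - 1))) has_sum
    contour_integral (circlepath 0 (exp r)) (\<lambda>z. symb f z * z powi (- n - 1))) UNIV"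
    by (intro contour_integral_symb f continuous_intros) auto
  moreover have "contour_integral (circlepath 0 (exp r)) (\<lambda>z. z powi k * z powi (- n - 1)) =
    (if k = n then 2 * pi * \<i> else 0)" for k
  proof -
    have "contour_integral (circlepath 0 (exp r)) (\<lambda>z. z powi k * z powi (- n - 1)) =
       contour_integral (circlepath 0 (exp r)) (\<lambda>z. z powi (k - n - 1))"
      by (intro contour_integral_cong) (auto simp: powi_mult_powi algebra_simps)
    thus ?thesis by (auto simp: contour_integral_powi)
  qed
  moreover have "contour_integral (circlepath 0 (exp r)) (\<lambda>z. symb f z * z powi (- n - 1)) =
     contour_integral (circlepath 0 (exp r)) (\<lambda>z. 0)"
    using z by (intro contour_integral_cong) auto
  ultimately have "((\<lambda>k. f k * (if k = n then 2 * pi * \<i> else 0)) has_sum 0) UNIV" by simp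
  hence "infsum (\<lambda>k. f k * (if k = n then 2 * pi * \<i> else 0)) UNIV = 0" by (rule infsumI)
  also have "infsum (\<lambda>k. f k * (if k = n then 2 * pi * \<i> else 0)) UNIV =
     infsum (\<lambda>k. f k * (if k = n then 2 * pi * \<i> else 0)) {n}"
    by (intro infsum_cong_neutral) auto
  finally show "f n = 0" by simp
qed

lemma summable_on_exp_abs:
  assumes "\<delta> > 0" shows "(\<lambda>n::int. exp (- \<delta> * \<bar>real_of_int n\<bar>)) summable_on UNIV"
proof -
  let ?f = "\<lambda>n::int. exp (- \<delta> * \<bar>real_of_int n\<bar>)"
  have "summable (\<lambda>n::nat. exp (- \<delta>) ^ n)"
    using assms by (intro summable_geometric) auto
  hence N: "(\<lambda>n::nat. exp (- \<delta> * real n)) summable_on UNIV"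
    by (subst summable_on_UNIV_nonneg_real_iff) (auto simp: exp_of_nat_mult[symmetric] mult.commute)
  have "?f summable_on range int"
    using N by (subst summable_on_reindex) (auto simp: o_def)
  moreover have "?f summable_on range (\<lambda>n. - int n)"
    using N by (subst summable_on_reindex) (auto simp: o_def inj_on_def)
  ultimately have "?f summable_on (range int \<union> range (\<lambda>n. - int n))"
    by (rule summable_on_union)
  also have "range int \<union> range (\<lambda>n. - int n) = UNIV"
    by (auto simp: image_iff) (metis int_cases2)
  finally show ?thesis .
qed

text \<open>Boundedness at a slightly larger weight handles n >= 0 and at a slightly smaller weight
  n < 0, each with a factor e^(-\<delta>|n|) to spare, and that factor is summable.\<close>

lemma ell_of_bounds:
  assumes B: "\<And>r. r1 < r \<Longrightarrow> r < r2 \<Longrightarrow> \<exists>B. \<forall>n. cmod (g n) * wt r n \<le> B" and r: "r1 < r" "r < r2"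
  shows "g \<in> ell r"
proof -
  define \<delta> where "\<delta> = min (r - r1) (r2 - r) / 2"
  have \<delta>: "\<delta> > 0" "r1 < r - \<delta>" "r + \<delta> < r2" using r by (auto simp: \<delta>_def min_def field_simps)
  obtain B1 where B1: "\<And>n. cmod (g n) * wt (r + \<delta>) n \<le> B1" using B[of "r + \<delta>"] \<delta> r by auto
  obtain B2 where B2: "\<And>n. cmod (g n) * wt (r - \<delta>) n \<le> B2" using B[of "r - \<delta>"] \<delta> r by auto
  have "cmod (g n) * wt r n \<le> (\<bar>B1\<bar> + \<bar>B2\<bar>) * exp (- \<delta> * \<bar>real_of_int n\<bar>)" for n
  proof -
    have 1: "cmod (g n) * wt (if n \<ge> 0 then r + \<delta> else r - \<delta>) n \<le> \<bar>B1\<bar> + \<bar>B2\<bar>"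
      using B1[of n] B2[of n] by (auto intro: order_trans)
    have 2: "wt r n = wt (if n \<ge> 0 then r + \<delta> else r - \<delta>) n * exp (- \<delta> * \<bar>real_of_int n\<bar>)"
      by (auto simp: wt_def algebra_simps simp flip: exp_add)
    show ?thesis using mult_right_mono[OF 1, of "exp (- \<delta> * \<bar>real_of_int n\<bar>)"]
      by (subst 2) (simp add: mult.assoc)
  qed
  thus ?thesis unfolding ell_def mem_Collect_eq
    by (intro summable_on_comparison_test[OF summable_on_cmult_right[OF summable_on_exp_abs[OF \<delta>(1)]]]) auto
qed

lemma contour_integral_circle_radius:
  assumes "F holomorphic_on ann r1 r2" "r1 < s" "s < r2" "r1 < t" "t < r2"
  shows "contour_integral (circlepath 0 (exp s)) F = contour_integral (circlepath 0 (exp t)) F"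
proof (rule Cauchy_theorem_homotopic_loops[of "ann r1 r2"])
  show "homotopic_loops (ann r1 r2) (circlepath 0 (exp s)) (circlepath 0 (exp t))"
  proof (rule homotopic_loops_linear)
    fix x :: real
    show "closed_segment (circlepath 0 (exp s) x) (circlepath 0 (exp t) x) \<subseteq> ann r1 r2"
    proof
      fix w assume "w \<in> closed_segment (circlepath 0 (exp s) x) (circlepath 0 (exp t) x)"
      then obtain u where u: "0 \<le> u" "u \<le> 1"
        and w: "w = (1 - u) *\<^sub>R circlepath 0 (exp s) x + u *\<^sub>R circlepath 0 (exp t) x"
        by (auto simp: in_segment)
      define \<rho> where "\<rho> = (1 - u) * exp s + u * exp t"
      \<comment> \<open>The two circles are joined radially: points with the same parameter have the
        same argument, so only the modulus varies along the segment.\<close>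
      have "w = complex_of_real \<rho> * exp (2 * of_real pi * \<i> * of_real x)"
        by (simp add: w \<rho>_def circlepath scaleR_conv_of_real algebra_simps)
      moreover have \<rho>: "exp r1 < \<rho>" "\<rho> < exp r2"
      proof -
        have "min (exp s) (exp t) \<le> \<rho>" "\<rho> \<le> max (exp s) (exp t)"
          using convex_bound_le[of "exp s" "max (exp s) (exp t)" "exp t" "1 - u" u]
            convex_bound_le[of "- exp s" "- min (exp s) (exp t)" "- exp t" "1 - u" u] u
          by (auto simp: \<rho>_def)
        thus "exp r1 < \<rho>" "\<rho> < exp r2" using assms by (auto simp: min_def max_def split: if_splits intro: less_le_trans le_less_trans)
      qed
      moreover have "\<rho> > 0" using \<rho>(1) less_trans[OF exp_gt_zero] by blast
      ultimately show "w \<in> ann r1 r2"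
        by (simp add: ann_def norm_mult)
    qed
  qed auto
qed (use assms open_ann in auto)

text \<open>The kernel g consists of the Laurent coefficients of the reciprocal symbol. Their Cauchy
  integrals do not depend on the radius, so the Cauchy estimate on each circle of the annulus gives
  a bound at every admissible weight. Disjoint annuli may give different kernels for the same
  f.\<close>

theorem inverse_kernel:
  assumes r12: "r1 < r2" and f: "\<And>r. r1 < r \<Longrightarrow> r < r2 \<Longrightarrow> f \<in> ell r"
    and nz: "\<And>z. z \<in> ann r1 r2 \<Longrightarrow> symb f z \<noteq> 0"
  obtains g where "\<And>r. r1 < r \<Longrightarrow> r < r2 \<Longrightarrow> g \<in> ell r" "conv f g = kdelta"
proof -
  obtain r0 where r0: "r1 < r0" "r0 < r2" using r12 dense by blast
  define H where "H n z = 1 / symb f z * z powi (- n - 1) / (2 * pi * \<i>)" for n and z :: complex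
  define g where "g n = contour_integral (circlepath 0 (exp r0)) (H n)" for n
  have hol: "H n holomorphic_on ann r1 r2" for n
    unfolding H_def using nz annD(1)
    by (intro holomorphic_intros symb_holomorphic f) auto
  have g_alt: "g n = contour_integral (circlepath 0 (exp r)) (H n)" if "r1 < r" "r < r2" for r n
    unfolding g_def by (rule contour_integral_circle_radius[OF hol r0 that])
  have sub: "sphere 0 (exp r) \<subseteq> ann r1 r2" if "r1 < r" "r < r2" for r
    using annI[OF _ that] by auto
  \<comment> \<open>Cauchy estimate on the circle of radius e^r: the integrand contributes
    e^(r(-n-1)) and the length of the circle the missing e^r.\<close>
  have "\<exists>B. \<forall>n. cmod (g n) * wt r n \<le> B" if r: "r1 < r" "r < r2" for r
  proof -
    have "continuous_on (sphere 0 (exp r)) (\<lambda>z. 1 / symb f z)"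
      using nz sub[OF r]
      by (intro holomorphic_on_imp_continuous_on holomorphic_intros holomorphic_on_subset[OF symb_holomorphic[of r1 r2]] f) auto
    from bounded_on_sphere[OF this]
    obtain B where B0: "B \<ge> 0" and B: "\<And>z. cmod z = exp r \<Longrightarrow> cmod (1 / symb f z) \<le> B" by blast
    have "cmod (g n) * wt r n \<le> B" for n
    proof -
      have "H n contour_integrable_on circlepath 0 (exp r)"
        using sub[OF r] by (intro contour_integrable_continuous_circlepath holomorphic_on_imp_continuous_on
           holomorphic_on_subset[OF hol]) auto
      hence "(H n has_contour_integral g n) (circlepath 0 (exp r))"
        using g_alt[OF r] has_contour_integral_integral by metis
      hence "cmod (g n) \<le> (B * wt r (- n - 1) / (2 * pi)) * (2 * pi * exp r)"
      proof (rule has_contour_integral_bound_circlepath)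
        fix x :: complex assume "cmod (x - 0) = exp r"
        hence x: "cmod x = exp r" by simp
        have "cmod (H n x) = cmod (1 / symb f x) * wt r (- n - 1) / (2 * pi)"
          by (simp add: H_def norm_mult norm_divide norm_powi_exp[OF x])
        also have "\<dots> \<le> B * wt r (- n - 1) / (2 * pi)"
          using B[of x] x by (intro divide_right_mono mult_right_mono) auto
        finally show "cmod (H n x) \<le> B * wt r (- n - 1) / (2 * pi)" .
      qed (use B0 in auto)
      also have "\<dots> = B * (wt r (- n - 1) * exp r)" by simp
      also have "wt r (- n - 1) * exp r = inverse (wt r n)"
        by (simp add: wt_def exp_minus[symmetric] algebra_simps flip: exp_add)
      finally show ?thesis by (simp add: field_simps)
    qed
    thus ?thesis by blast
  qed
  hence "g \<in> ell r" if "r1 < r" "r < r2" for r using ell_of_bounds that by blast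
  moreover have "conv f g = kdelta"
  proof
    fix n
    let ?C = "circlepath 0 (exp r0)"
    have cont: "continuous_on (sphere 0 (exp r0)) (H n)"
      using sub[OF r0] by (intro holomorphic_on_imp_continuous_on holomorphic_on_subset[OF hol]) auto
    have "((\<lambda>k. f k * contour_integral ?C (\<lambda>z. z powi k * H n z)) has_sum
        contour_integral ?C (\<lambda>z. symb f z * H n z)) UNIV"
      by (intro contour_integral_symb f r0 cont)
    \<comment> \<open>Multiplication by z^k lowers the index n by k, so termwise integration of f /
      f produces the convolution of f and g.\<close>
    moreover have "contour_integral ?C (\<lambda>z. z powi k * H n z) = g (n - k)" for k
      unfolding g_def H_def
      by (intro contour_integral_cong) (auto simp: powi_mult_powi mult.left_commute[of "_ powi k"] add_diff_eq diff_add_eq)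
    moreover have "contour_integral ?C (\<lambda>z. symb f z * H n z) = kdelta n"
    proof -
      have "contour_integral ?C (\<lambda>z. symb f z * H n z) = contour_integral ?C (\<lambda>z. (1 / (2 * pi * \<i>)) * z powi (- n - 1))"
        using sub[OF r0] nz by (intro contour_integral_cong) (auto simp: H_def subset_iff)
      also have "\<dots> = (1 / (2 * pi * \<i>)) * contour_integral ?C (\<lambda>z. z powi (- n - 1))"
        by (intro contour_integral_lmul contour_integrable_continuous_circlepath continuous_intros) auto
      finally show ?thesis by (auto simp: contour_integral_powi kdelta_def)
    qed
    ultimately show "conv f g n = kdelta n"
      unfolding conv_def by (simp add: infsumI)
  qed
  ultimately show thesis using that by blast
qed

subsection \<open>Division by linear factors and the circle zeros\<close>


definition lin :: "complex \<Rightarrow> int \<Rightarrow> complex" where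
  "lin z0 n = (if n = 1 then 1 else if n = 0 then - z0 else 0)"

text \<open>The Laurent coefficients of \<open>1 / (z - z0)\<close> inside and outside the unit circle.\<close>

definition green_in :: "complex \<Rightarrow> int \<Rightarrow> complex" where
  "green_in z0 n = (if n \<ge> 0 then - (z0 powi (- n - 1)) else 0)"

definition green_out :: "complex \<Rightarrow> int \<Rightarrow> complex" where
  "green_out z0 n = (if n < 0 then z0 powi (- n - 1) else 0)"

lemma lin_ell [simp]: "lin z0 \<in> ell r"
  by (rule ell_finite_support, rule finite_subset[of _ "{0, 1}"]) (auto simp: lin_def)

lemma symb_lin: "symb (lin z0) z = z - z0"
proof -
  have "symb (lin z0) z = (\<Sum>\<^sub>\<infinity>n\<in>{0, 1}. lin z0 n * z powi n)"
    unfolding symb_def by (intro infsum_cong_neutral) (auto simp: lin_def)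
  thus ?thesis by (simp add: lin_def)
qed

lemma symb_kdelta [simp]: "symb kdelta z = 1"
proof -
  have "symb kdelta z = (\<Sum>\<^sub>\<infinity>n\<in>{0}. kdelta n * z powi n)"
    unfolding symb_def by (intro infsum_cong_neutral) (auto simp: kdelta_def)
  thus ?thesis by (simp add: kdelta_def)
qed

lemma conv_lin: "conv (lin z0) w n = w (n - 1) - z0 * w n"
proof -
  have "conv (lin z0) w n = (\<Sum>\<^sub>\<infinity>k\<in>{0, 1}. lin z0 k * w (n - k))"
    unfolding conv_def by (intro infsum_cong_neutral) (auto simp: lin_def)
  thus ?thesis by (simp add: lin_def)
qed

lemma norm_powi_1: "cmod z = 1 \<Longrightarrow> cmod (z powi n) = 1"
  by (simp add: norm_power_int)

lemma green_in_ell: assumes "cmod z0 = 1" "s < 0" shows "green_in z0 \<in> ell s"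
  unfolding ell_def mem_Collect_eq
  by (rule summable_on_comparison_test[OF summable_on_exp_abs[of "- s"]])
    (use assms in \<open>auto simp: green_in_def norm_powi_1 wt_def\<close>)

lemma green_out_ell: assumes "cmod z0 = 1" "t > 0" shows "green_out z0 \<in> ell t"
  unfolding ell_def mem_Collect_eq
  by (rule summable_on_comparison_test[OF summable_on_exp_abs[of t]])
    (use assms in \<open>auto simp: green_out_def norm_powi_1 wt_def\<close>)

lemma powi_step: "z \<noteq> 0 \<Longrightarrow> z * z powi m = z powi (m + 1)" for z :: complex
  by (simp add: power_int_add)

lemma conv_lin_green_in: assumes "z0 \<noteq> 0" shows "conv (lin z0) (green_in z0) = kdelta"
  using powi_step[OF assms, of "- n - 1" for n] assms
  by (auto simp: conv_lin green_in_def kdelta_def fun_eq_iff)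

lemma symb_summable: assumes "f \<in> ell r" "cmod z = exp r"
  shows "(\<lambda>n. cmod (f n * z powi n)) summable_on UNIV" "(\<lambda>n. f n * z powi n) summable_on UNIV"
proof -
  show 1: "(\<lambda>n. cmod (f n * z powi n)) summable_on UNIV"
    using assms by (simp add: norm_mult norm_powi_exp ell_def)
  show "(\<lambda>n. f n * z powi n) summable_on UNIV"
    by (rule Infinite_Sum.abs_summable_summable[OF 1])
qed

lemma norm_symb_le: assumes "f \<in> ell r" "cmod z = exp r" shows "cmod (symb f z) \<le> enorm r f"
  using norm_infsum_bound[OF symb_summable(1)[OF assms]] assms
  by (simp add: symb_def enorm_def norm_mult norm_powi_exp)

lemma symb_diff: assumes "f \<in> ell r" "g \<in> ell r" "cmod z = exp r"
  shows "symb (\<lambda>n. f n - c * g n) z = symb f z - c * symb g z"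
proof -
  have "symb (\<lambda>n. f n - c * g n) z = (\<Sum>\<^sub>\<infinity>n. f n * z powi n + (- c) * (g n * z powi n))"
    unfolding symb_def by (intro infsum_cong) (simp add: algebra_simps)
  also have "\<dots> = symb f z + (\<Sum>\<^sub>\<infinity>n. (- c) * (g n * z powi n))"
    unfolding symb_def
    by (intro infsum_add summable_on_cmult_right symb_summable[OF _ assms(3)] assms(1,2))
  finally show ?thesis by (simp only: infsum_cmult_right' symb_def) simp
qed

text \<open>Division with remainder: y - y(z0) vanishes at z0, so its quotient by z - z0 has no
  singularity there. The inner and outer expansions of that quotient are then the same sequence,
  which inherits both the weights below 0 and those above 0.\<close>

lemma division_by_lin:
  assumes z0: "cmod z0 = 1" and s0: "s0 < 0" "y \<in> ell s0" and t0: "t0 > 0" "y \<in> ell t0"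
  obtains w where "y = (\<lambda>n. conv (lin z0) w n + symb y z0 * kdelta n)"
    "\<And>s. s < 0 \<Longrightarrow> y \<in> ell s \<Longrightarrow> w \<in> ell s \<and> enorm s w \<le> enorm s (green_in z0) * (enorm s y + cmod (symb y z0))"
    "\<And>t. t > 0 \<Longrightarrow> y \<in> ell t \<Longrightarrow> w \<in> ell t \<and> enorm t w \<le> enorm t (green_out z0) * (enorm t y + cmod (symb y z0))"
proof -
  define c where "c = symb y z0"
  define y' where "y' = (\<lambda>n. y n - c * kdelta n)"
  define w where "w = conv (green_in z0) y'"
  have z0': "z0 \<noteq> 0" "cmod z0 = exp 0" using z0 by auto
  have y': "y' \<in> ell r" "enorm r y' \<le> enorm r y + cmod c" if "y \<in> ell r" for r
    using ell_diff[OF that ell_scale(1)[OF kdelta_ell, of c r]] ell_scale(2)[OF kdelta_ell, of r c]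
    by (auto simp: y'_def)
  have y0: "y \<in> ell 0" using ell_between(1)[OF s0(2) t0(2)] s0 t0 by auto
  have sy': "symb y' z0 = 0"
    using symb_diff[OF y0 kdelta_ell z0'(2), of c] by (simp add: y'_def c_def)
  \<comment> \<open>The outer expansion minus the inner one is the full sequence z0^(-n-1). Its
    convolution with y' is z0^(-n-1) times the value of the symbol of y' at z0, which is
    zero.\<close>
  have w_out: "w = conv (green_out z0) y'"
  proof
    fix n
    have "conv y' (green_out z0) n - conv y' (green_in z0) n
      = (\<Sum>\<^sub>\<infinity>k. y' k * green_out z0 (n - k) + - (y' k * green_in z0 (n - k)))"
      unfolding conv_def
      using conv_summable[OF y'(1)[OF t0(2)] green_out_ell[OF z0 t0(1)], of n]
        conv_summable[OF y'(1)[OF s0(2)] green_in_ell[OF z0 s0(1)], of n]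
      by (subst infsum_add) (auto simp: infsum_uminus summable_on_uminus)
    also have "\<dots> = (\<Sum>\<^sub>\<infinity>k. z0 powi (- n - 1) * (y' k * z0 powi k))"
    proof (rule infsum_cong)
      fix k
      have "z0 powi (- (n - k) - 1) = z0 powi (- n - 1) * z0 powi k"
        using z0' by (simp add: power_int_add[symmetric] algebra_simps)
      thus "y' k * green_out z0 (n - k) + - (y' k * green_in z0 (n - k)) = z0 powi (- n - 1) * (y' k * z0 powi k)"
        by (auto simp: green_out_def green_in_def)
    qed
    also have "\<dots> = 0" using sy' by (simp only: infsum_cmult_right' symb_def) simp
    finally show "w n = conv (green_out z0) y' n" by (simp add: w_def conv_commute[of _ y'])
  qed
  show thesis
  proof (rule that)
    have "conv (lin z0) w = conv (conv (lin z0) (green_in z0)) y'"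
      unfolding w_def by (rule conv_assoc[symmetric, of _ s0]) (use z0 s0 y' green_in_ell in auto)
    hence "conv (lin z0) w = y'" by (simp add: conv_lin_green_in z0')
    thus "y = (\<lambda>n. conv (lin z0) w n + symb y z0 * kdelta n)" by (auto simp: y'_def c_def)
  next
    fix s :: real assume s: "s < 0" "y \<in> ell s"
    have "enorm s w \<le> enorm s (green_in z0) * enorm s y'"
      unfolding w_def using conv_enorm green_in_ell[OF z0 s(1)] y'(1)[OF s(2)] by blast
    also have "\<dots> \<le> enorm s (green_in z0) * (enorm s y + cmod c)"
      using y'(2)[OF s(2)] by (intro mult_left_mono) auto
    finally show "w \<in> ell s \<and> enorm s w \<le> enorm s (green_in z0) * (enorm s y + cmod (symb y z0))"
      using conv_ell[OF green_in_ell[OF z0 s(1)] y'(1)[OF s(2)]] by (simp add: w_def c_def)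
  next
    fix t :: real assume t: "t > 0" "y \<in> ell t"
    have "enorm t w \<le> enorm t (green_out z0) * enorm t y'"
      unfolding w_out using conv_enorm green_out_ell[OF z0 t(1)] y'(1)[OF t(2)] by blast
    also have "\<dots> \<le> enorm t (green_out z0) * (enorm t y + cmod c)"
      using y'(2)[OF t(2)] by (intro mult_left_mono) auto
    finally show "w \<in> ell t \<and> enorm t w \<le> enorm t (green_out z0) * (enorm t y + cmod (symb y z0))"
      using conv_ell[OF green_out_ell[OF z0 t(1)] y'(1)[OF t(2)]] by (simp add: w_out c_def)
  qed
qed

text \<open>For s = -\<eta> and t = \<eta> this is equivalent to the norm with the two-sided weight
  e^(\<eta>|n|). The case s = t is also used, where it only doubles the norm.\<close>

definition enorm2 :: "real \<Rightarrow> real \<Rightarrow> (int \<Rightarrow> complex) \<Rightarrow> real" where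
  "enorm2 s t u = enorm s u + enorm t u"

lemma enorm2_nonneg [simp]: "enorm2 s t u \<ge> 0"
  by (simp add: enorm2_def)

lemma enorm_le_enorm2: "enorm s u \<le> enorm2 s t u" "enorm t u \<le> enorm2 s t u"
  by (simp_all add: enorm2_def)

text \<open>The \<open>e j\<close> span a complement of the range of an injective \<open>A\<close>; for \<open>d = 0\<close> this is invertibility.\<close>

definition complemented ::
    "real \<Rightarrow> real \<Rightarrow> ((int \<Rightarrow> complex) \<Rightarrow> int \<Rightarrow> complex) \<Rightarrow> nat \<Rightarrow> (nat \<Rightarrow> int \<Rightarrow> complex) \<Rightarrow> real \<Rightarrow> bool" where
  "complemented s t A d e K \<longleftrightarrow> K > 0 \<and>
     (\<forall>j<d. e j \<in> ell s \<inter> ell t) \<and>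
     (\<forall>y \<in> ell s \<inter> ell t. \<exists>v \<in> ell s \<inter> ell t. \<exists>c. y = (\<lambda>n. A v n + (\<Sum>j<d. c j * e j n)) \<and>
        enorm2 s t v + (\<Sum>j<d. cmod (c j)) \<le> K * enorm2 s t y) \<and>
     (\<forall>v \<in> ell s \<inter> ell t. \<forall>c. (\<lambda>n. A v n + (\<Sum>j<d. c j * e j n)) = (\<lambda>_. 0) \<longrightarrow>
        v = (\<lambda>_. 0) \<and> (\<forall>j<d. c j = 0))"

text \<open>Start of the factor-by-factor construction: a symbol with an inverse kernel has full
  range. The summand 1 makes the constant positive without a lower bound on the norm of g.\<close>

lemma complemented_inverse:
  assumes q: "q \<in> ell s" "q \<in> ell t" and g: "g \<in> ell s" "g \<in> ell t" and qg: "conv q g = kdelta"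
  shows "complemented s t (conv q) 0 e (1 + enorm2 s t g)"
  unfolding complemented_def
proof (intro conjI ballI allI impI; (elim IntE)?)
  fix y assume y: "y \<in> ell s" "y \<in> ell t"
  have "enorm2 s t (conv g y) \<le> enorm s g * enorm s y + enorm t g * enorm t y"
    unfolding enorm2_def using conv_enorm[OF g(1) y(1)] conv_enorm[OF g(2) y(2)] by simp
  also have "\<dots> \<le> (1 + enorm2 s t g) * enorm2 s t y"
    by (simp add: enorm2_def algebra_simps)
  finally show "\<exists>v\<in>ell s \<inter> ell t. \<exists>c. y = (\<lambda>n. conv q v n + (\<Sum>j<0. c j * e j n)) \<and>
      enorm2 s t v + (\<Sum>j<0::nat. cmod (c j)) \<le> (1 + enorm2 s t g) * enorm2 s t y"
    using conv_ell[OF g(1) y(1)] conv_ell[OF g(2) y(2)] conv_assoc[OF q(1) g(1) y(1)] qg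
    by (intro bexI[of _ "conv g y"]) auto
next
  fix v c assume v: "v \<in> ell s" "(\<lambda>n. conv q v n + (\<Sum>j<0. c j * e j n)) = (\<lambda>_. 0)"
  hence "conv q v = (\<lambda>_. 0)" by simp
  hence "conv (conv g q) v = (\<lambda>_. 0)" by (simp add: conv_assoc[OF g(1) q(1) v(1)])
  thus "v = (\<lambda>_. 0)" using qg by (simp add: conv_commute[of g q])
qed (auto simp: add_pos_nonneg)

text \<open>First solve with a, then divide the solution w' by z - z0. The remainder is w'(z0) times
  \<open>kdelta\<close>, and a maps it to w'(z0) a, so a itself is the new complementary vector. In
  the constant, the quotient accounts for the Green kernel norms and the remainder for one further
  summand.\<close>

lemma complemented_lin:
  assumes C: "complemented s t (conv a) d e K" and a: "a \<in> ell s" "a \<in> ell t"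
    and s: "s < 0" and t: "t > 0" and z0: "cmod z0 = 1"
  shows "complemented s t (conv (conv (lin z0) a)) (Suc d) (e(d := a))
     ((2 * (enorm s (green_in z0) + enorm t (green_out z0)) + 2) * K)"
proof -
  define H where "H = enorm s (green_in z0) + enorm t (green_out z0)"
  have H: "H \<ge> 0" by (simp add: H_def)
  have z0': "z0 \<noteq> 0" "cmod z0 = exp 0" using z0 by auto
  have K: "K > 0" and e: "\<And>j. j < d \<Longrightarrow> e j \<in> ell s \<inter> ell t" using C by (auto simp: complemented_def)
  have assoc: "conv (conv (lin z0) a) w = conv a (conv (lin z0) w)" if "w \<in> ell s" for w
    using conv_assoc[OF a(1) lin_ell that, of z0] by (simp add: conv_commute[of "lin z0" a])
  have sumS: "(\<Sum>j<Suc d. c j * (e(d := a)) j n) = (\<Sum>j<d. c j * e j n) + c d * a n" for c n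
    by simp
  have split: "(\<lambda>n. conv a (\<lambda>n. conv (lin z0) w n + x * kdelta n) n) = (\<lambda>n. conv a (conv (lin z0) w) n + x * a n)"
    if w: "w \<in> ell s" for w x
    using conv_add_right[OF a(1) conv_ell[OF lin_ell w] ell_scale(1)[OF kdelta_ell], of z0 x]
    by (simp add: conv_scale_right)
  show ?thesis
    unfolding complemented_def H_def[symmetric]
  proof (intro conjI allI ballI impI; (elim IntE)?)
    show "(2 * H + 2) * K > 0" using K H by simp
    show "(e(d := a)) j \<in> ell s \<inter> ell t" if "j < Suc d" for j
      using that a e[of j] by (auto simp: less_Suc_eq)
  next
    fix y assume y: "y \<in> ell s" "y \<in> ell t"
    then obtain w' c where w': "w' \<in> ell s" "w' \<in> ell t" and y_eq: "y = (\<lambda>n. conv a w' n + (\<Sum>j<d. c j * e j n))"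
      and le: "enorm2 s t w' + (\<Sum>j<d. cmod (c j)) \<le> K * enorm2 s t y"
      using C unfolding complemented_def by blast
    define x where "x = symb w' z0"
    obtain w where w_eq: "w' = (\<lambda>n. conv (lin z0) w n + x * kdelta n)"
      and w: "w \<in> ell s" "enorm s w \<le> enorm s (green_in z0) * (enorm s w' + cmod x)"
         "w \<in> ell t" "enorm t w \<le> enorm t (green_out z0) * (enorm t w' + cmod x)"
      unfolding x_def using division_by_lin[OF z0 s w'(1) t w'(2)] s t w' by metis
    have x: "cmod x \<le> enorm2 s t w'"
      unfolding x_def using norm_symb_le[OF _ z0'(2)] ell_between[OF w', of 0] s t
      by (force simp: enorm2_def)
    have "enorm2 s t w \<le> enorm s (green_in z0) * (2 * enorm2 s t w') + enorm t (green_out z0) * (2 * enorm2 s t w')"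
    proof -
      have "A + y \<le> 2 * (A + B)" "B + y \<le> 2 * (A + B)" if "0 \<le> A" "0 \<le> B" "y \<le> A + B" for A B y :: real
        using that by auto
      from this[OF enorm_nonneg enorm_nonneg x[unfolded enorm2_def]]
      have "enorm s w' + cmod x \<le> 2 * enorm2 s t w'" "enorm t w' + cmod x \<le> 2 * enorm2 s t w'"
        by (simp_all only: enorm2_def)
      thus ?thesis unfolding enorm2_def[of s t w]
        by (intro add_mono order_trans[OF w(2)] order_trans[OF w(4)] mult_left_mono) auto
    qed
    hence "enorm2 s t w + cmod x + (\<Sum>j<d. cmod (c j)) \<le> (2 * H + 1) * enorm2 s t w' + (\<Sum>j<d. cmod (c j))"
      using x by (simp add: H_def algebra_simps)
    also have "\<dots> \<le> (2 * H + 2) * (enorm2 s t w' + (\<Sum>j<d. cmod (c j)))"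
    proof -
      have "0 \<le> enorm2 s t w' + (2 * H + 1) * (\<Sum>j<d. cmod (c j))"
        using H by (intro add_nonneg_nonneg mult_nonneg_nonneg sum_nonneg) auto
      thus ?thesis by (simp add: algebra_simps)
    qed
    also have "\<dots> \<le> (2 * H + 2) * (K * enorm2 s t y)"
      using le H by (intro mult_left_mono) auto
    finally have bound: "enorm2 s t w + (\<Sum>j<Suc d. cmod ((c(d := x)) j)) \<le> (2 * H + 2) * K * enorm2 s t y"
      by (simp add: algebra_simps)
    have "y = (\<lambda>n. conv (conv (lin z0) a) w n + (\<Sum>j<Suc d. (c(d := x)) j * (e(d := a)) j n))"
      unfolding y_eq sumS assoc[OF w(1)] using split[OF w(1), of x]
      by (subst w_eq) (auto simp: fun_eq_iff algebra_simps)
    with bound w(1,3) show "\<exists>v\<in>ell s \<inter> ell t. \<exists>c. y = (\<lambda>n. conv (conv (lin z0) a) v n + (\<Sum>j<Suc d. c j * (e(d := a)) j n)) \<and>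
        enorm2 s t v + (\<Sum>j<Suc d. cmod (c j)) \<le> (2 * H + 2) * K * enorm2 s t y"
      by blast
  next
    fix v c assume v: "v \<in> ell s" "v \<in> ell t"
      and eq: "(\<lambda>n. conv (conv (lin z0) a) v n + (\<Sum>j<Suc d. c j * (e(d := a)) j n)) = (\<lambda>_. 0)"
    define w' where "w' = (\<lambda>n. conv (lin z0) v n + c d * kdelta n)"
    have w': "w' \<in> ell s \<inter> ell t"
      unfolding w'_def using v by (auto intro!: ell_add ell_scale conv_ell)
    have "(\<lambda>n. conv a w' n + (\<Sum>j<d. c j * e j n)) = (\<lambda>_. 0)"
      using eq unfolding sumS assoc[OF v(1)] w'_def split[OF v(1)] by (simp add: algebra_simps)
    hence w'0: "w' = (\<lambda>_. 0)" and c: "\<And>j. j < d \<Longrightarrow> c j = 0"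
      using C w' unfolding complemented_def by blast+
    have v0: "v \<in> ell 0" using ell_between(1)[OF v] s t by auto
    \<comment> \<open>Evaluating at z0 annihilates the multiple of z - z0 and leaves the last
      coefficient alone.\<close>
    have "symb w' z0 = symb (conv (lin z0) v) z0 + c d"
      using symb_diff[OF conv_ell[OF lin_ell v0] kdelta_ell z0'(2), of z0 "- c d"] by (simp add: w'_def)
    also have "symb (conv (lin z0) v) z0 = 0"
      by (simp add: symb_conv[OF lin_ell v0 z0'(2)] symb_lin)
    finally have cd: "c d = 0" using w'0 by (simp add: symb_def)
    have lin0: "conv (lin z0) v = (\<lambda>_. 0)"
      using w'0 unfolding w'_def cd by simp
    have "conv (conv (green_in z0) (lin z0)) v = (\<lambda>_. 0)"
      using lin0 by (simp add: conv_assoc[OF green_in_ell[OF z0 s] lin_ell v(1)])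
    thus "v = (\<lambda>_. 0)"
      by (simp add: conv_commute[of "green_in z0"] conv_lin_green_in z0')
    show "c j = 0" if "j < Suc d" for j
      using that c cd by (auto simp: less_Suc_eq)
  qed
qed

section \<open>Counting the zeros on the unit circle and splitting them off\<close>

definition circle_order :: "(complex \<Rightarrow> complex) \<Rightarrow> nat" where
  "circle_order f = (\<Sum>z | cmod z = 1 \<and> f z = 0. nat (zorder f z))"

lemma finite_circle_zeros:
  assumes R: "R > 0" and f: "f holomorphic_on ann (-R) R" and nz: "\<exists>z\<in>ann (-R) R. f z \<noteq> 0"
  shows "finite {z. cmod z = 1 \<and> f z = 0}"
proof (cases "f constant_on ann (-R) R")
  case True
  hence "{z. cmod z = 1 \<and> f z = 0} = {}"
    using nz R annI[of _ 0 "-R" R] unfolding constant_on_def by force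
  thus ?thesis by (metis finite.emptyI)
next
  case False
  have "finite {z \<in> sphere 0 1. f z = 0}"
    using annI[of _ 0 "-R" R] R
    by (intro holomorphic_compact_finite_zeros[OF f open_ann connected_ann _ _ False]) auto
  thus ?thesis by simp
qed

text \<open>Orders add under multiplication, and z - z0 has order 1 at z0 and order 0
  elsewhere.\<close>

lemma circle_order_mult_lin:
  assumes R: "R > 0" and f: "f holomorphic_on ann (-R) R" and g: "g holomorphic_on ann (-R) R"
    and fg: "\<And>z. z \<in> ann (-R) R \<Longrightarrow> f z = (z - z0) * g z"
    and nz: "\<exists>z\<in>ann (-R) R. g z \<noteq> 0" and z0: "cmod z0 = 1"
  shows "circle_order f = Suc (circle_order g)"
proof -
  define Z where "Z = {z. cmod z = 1 \<and> g z = 0}"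
  have Z: "finite Z" unfolding Z_def by (rule finite_circle_zeros[OF R g nz])
  have circ: "z \<in> ann (-R) R" if "cmod z = 1" for z using annI[of z 0] that R by auto
  have Zf: "{z. cmod z = 1 \<and> f z = 0} = insert z0 Z"
    using fg circ z0 by (auto simp: Z_def)
  obtain \<beta> where \<beta>: "\<beta> \<in> ann (-R) R" "g \<beta> \<noteq> 0" using nz by auto
  have ev: "\<forall>\<^sub>F w in at z. g w \<noteq> 0 \<and> w \<in> ann (-R) R" if "cmod z = 1" for z
    by (rule non_zero_neighbour_alt[OF g open_ann connected_ann circ[OF that] \<beta>])
  have ana: "g analytic_on {z}" if "cmod z = 1" for z
    using analytic_at circ[OF that] g open_ann by blast
  have ord: "zorder f z = zorder g z + (if z = z0 then 1 else 0)" if z: "cmod z = 1" for z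
  proof -
    have "zorder f z = zorder (\<lambda>w. (w - z0) * g w) z"
      by (rule zorder_cong) (use ev[OF z] fg in \<open>auto elim: eventually_mono\<close>)
    also have "\<dots> = zorder (\<lambda>w. w - z0) z + zorder g z"
    proof (rule zorder_times_analytic)
      have "\<forall>\<^sub>F w in at z. w \<noteq> z0" by (cases "z = z0") (auto simp: eventually_neq_at_within)
      with ev[OF z] show "\<forall>\<^sub>F w in at z. (w - z0) * g w \<noteq> 0"
        by eventually_elim auto
    qed (use ana[OF z] in \<open>auto intro!: analytic_intros\<close>)
    also have "zorder (\<lambda>w. w - z0) z = (if z = z0 then 1 else 0)"
    proof (cases "z = z0")
      case True
      have "zorder (\<lambda>w. w - z0) z0 = 1"
        by (rule zorder_eqI[of UNIV z0 "\<lambda>_. 1"]) auto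
      with True show ?thesis by simp
    next
      case False
      thus ?thesis by (auto intro!: zorder_eq_0I analytic_intros)
    qed
    finally show ?thesis by simp
  qed
  have ge0: "zorder g z \<ge> 0" if "cmod z = 1" for z
    using zorder_ge_0[OF ana[OF that]] ev[OF that]
    by (metis (mono_tags, lifting) eventually_frequently eventually_mono trivial_limit_at)
  have eq0: "zorder g z = 0" if "cmod z = 1" "z \<notin> Z" for z
    using zorder_eq_0I[OF ana[OF that(1)]] that by (auto simp: Z_def)
  \<comment> \<open>The point z0 may or may not be a zero of g. Summing over
    \<open>insert z0 Z\<close> covers both cases, since g has order 0 outside Z.\<close>
  have "circle_order f = (\<Sum>z\<in>insert z0 Z. nat (zorder g z + (if z = z0 then 1 else 0)))"
    unfolding circle_order_def Zf using z0 ord by (intro sum.cong) (auto simp: Z_def)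
  also have "\<dots> = (\<Sum>z\<in>insert z0 Z. nat (zorder g z) + (if z = z0 then 1 else 0))"
    using z0 ge0 by (intro sum.cong) (auto simp: Z_def nat_add_distrib)
  also have "\<dots> = (\<Sum>z\<in>insert z0 Z. nat (zorder g z)) + 1"
    using Z by (simp add: sum.distrib)
  also have "(\<Sum>z\<in>insert z0 Z. nat (zorder g z)) = (\<Sum>z\<in>Z. nat (zorder g z))"
    using Z eq0[OF z0] by (intro sum.mono_neutral_right) auto
  finally show ?thesis by (simp add: circle_order_def Z_def)
qed

definition mult_lins :: "complex list \<Rightarrow> (int \<Rightarrow> complex) \<Rightarrow> int \<Rightarrow> complex" where
  "mult_lins zs q = foldr (\<lambda>z b. conv (lin z) b) zs q"

lemma mult_lins_simps [simp]: "mult_lins [] q = q" "mult_lins (z # zs) q = conv (lin z) (mult_lins zs q)"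
  by (auto simp: mult_lins_def)

lemma mult_lins_ell: "q \<in> ell r \<Longrightarrow> mult_lins zs q \<in> ell r"
  by (induction zs) (auto intro: conv_ell)

lemma symb_mult_lins: "q \<in> ell r \<Longrightarrow> cmod z = exp r \<Longrightarrow> symb (mult_lins zs q) z = (\<Prod>z'\<leftarrow>zs. z - z') * symb q z"
  by (induction zs) (auto simp: symb_conv[of _ r] mult_lins_ell symb_lin)

text \<open>Division at a zero on the circle leaves no remainder and lowers the order count by one,
  so induction on that count removes all these zeros with their multiplicities.\<close>

theorem circle_factorization:
  assumes R: "R > 0" and a: "\<And>r. - R < r \<Longrightarrow> r < R \<Longrightarrow> a \<in> ell r"
    and nz: "\<exists>z\<in>ann (-R) R. symb a z \<noteq> 0"
  shows "\<exists>zs q. a = mult_lins zs q \<and> length zs = circle_order (symb a) \<and> (\<forall>z\<in>set zs. cmod z = 1) \<and>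
     (\<forall>r. - R < r \<longrightarrow> r < R \<longrightarrow> q \<in> ell r) \<and> (\<forall>z. cmod z = 1 \<longrightarrow> symb q z \<noteq> 0)"
  using a nz
proof (induction "circle_order (symb a)" arbitrary: a rule: less_induct)
  case less
  note hol = symb_holomorphic[OF less.prems(1)]
  show ?case
  proof (cases "\<exists>z0. cmod z0 = 1 \<and> symb a z0 = 0")
    case False
    hence E: "{z. cmod z = 1 \<and> symb a z = 0} = {}" by auto
    have "circle_order (symb a) = 0" unfolding circle_order_def E by simp
    with False less.prems show ?thesis
      by (intro exI[of _ "[]"] exI[of _ a]) auto
  next
    case True
    then obtain z0 where z0: "cmod z0 = 1" "symb a z0 = 0" by auto
    have R2: "- R < - R / 2" "- R / 2 < 0" "R / 2 > 0" "R / 2 < R" "- R / 2 < R" "- R < R / 2" using R by auto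
    obtain b where ab: "a = (\<lambda>n. conv (lin z0) b n + symb a z0 * kdelta n)"
      and b1: "\<And>s. s < 0 \<Longrightarrow> a \<in> ell s \<Longrightarrow> b \<in> ell s" and b2: "\<And>t. t > 0 \<Longrightarrow> a \<in> ell t \<Longrightarrow> b \<in> ell t"
      using division_by_lin[OF z0(1) R2(2) less.prems(1)[OF R2(1,5)] R2(3) less.prems(1)[OF R2(6,4)]]
      by metis
    have ab: "a = conv (lin z0) b" by (subst ab) (simp add: z0(2))
    \<comment> \<open>Division controls the quotient only at nonzero weights; weight 0 follows by
      interpolation between -R/2 and R/2.\<close>
    have b: "b \<in> ell r" if r: "- R < r" "r < R" for r
    proof (cases "r = 0")
      case True
      thus ?thesis
        using ell_between(1)[of b "- R / 2" "R / 2" 0] b1[OF R2(2) less.prems(1)] b2[OF R2(3) less.prems(1)] R2 by auto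
    next
      case False
      thus ?thesis using b1[of r] b2[of r] less.prems(1)[OF r] by linarith
    qed
    have sab: "symb a z = (z - z0) * symb b z" if "z \<in> ann (-R) R" for z
      using symb_conv[OF lin_ell b annD(4)[OF that]] annD(2,3)[OF that] by (simp add: ab symb_lin)
    have nzb: "\<exists>z\<in>ann (-R) R. symb b z \<noteq> 0"
      using less.prems(2) sab by auto
    have ord: "circle_order (symb a) = Suc (circle_order (symb b))"
      by (rule circle_order_mult_lin[OF R hol symb_holomorphic[OF b] sab nzb z0(1)])
    obtain zs q where zs: "b = mult_lins zs q" "length zs = circle_order (symb b)" "\<forall>z\<in>set zs. cmod z = 1"
       "\<forall>r. - R < r \<longrightarrow> r < R \<longrightarrow> q \<in> ell r" "\<forall>z. cmod z = 1 \<longrightarrow> symb q z \<noteq> 0"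
      using less.hyps[OF _ b nzb] ord by auto
    show ?thesis
      by (rule exI[of _ "z0 # zs"], rule exI[of _ q]) (use zs ab ord z0 in auto)
  qed
qed

theorem complemented_mult_lins:
  assumes "s < 0" "t > 0" "\<And>z. z \<in> set zs \<Longrightarrow> cmod z = 1" "q \<in> ell s" "q \<in> ell t"
    "g \<in> ell s" "g \<in> ell t" "conv q g = kdelta"
  shows "\<exists>e K. complemented s t (conv (mult_lins zs q)) (length zs) e K"
  using assms(3)
proof (induction zs)
  case Nil
  show ?case using complemented_inverse[OF assms(4-8)] by auto
next
  case (Cons z zs)
  then obtain e K where "complemented s t (conv (mult_lins zs q)) (length zs) e K" by auto
  from complemented_lin[OF this mult_lins_ell mult_lins_ell assms(1,2), OF assms(4,5), of z] Cons.prems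
  show ?case by auto
qed

subsection \<open>Small potentials\<close>


lemma infsum_nat_split:
  fixes f :: "nat \<Rightarrow> complex"
  assumes "f summable_on UNIV"
  shows "infsum f UNIV = f 0 + (\<Sum>\<^sub>\<infinity>k. f (Suc k))" "(\<lambda>k. f (Suc k)) summable_on UNIV"
proof -
  have s: "f summable_on range Suc" by (rule summable_on_subset_banach[OF assms]) auto
  show "(\<lambda>k. f (Suc k)) summable_on UNIV"
    using s by (subst (asm) summable_on_reindex) (auto simp: o_def)
  have "infsum f UNIV = infsum f (insert 0 (range Suc))"
    by (rule arg_cong[of _ _ "infsum f"]) (auto simp: image_iff, metis not0_implies_Suc)
  also have "\<dots> = f 0 + infsum f (range Suc)"
    by (rule infsum_insert[OF s]) auto
  also have "infsum f (range Suc) = (\<Sum>\<^sub>\<infinity>k. f (Suc k))"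
    by (subst infsum_reindex) (auto simp: o_def)
  finally show "infsum f UNIV = f 0 + (\<Sum>\<^sub>\<infinity>k. f (Suc k))" .
qed

lemma infsum_finite_sum:
  fixes f :: "'j \<Rightarrow> 'k \<Rightarrow> complex"
  assumes "finite J" "\<And>j. j \<in> J \<Longrightarrow> f j summable_on S"
  shows "(\<lambda>k. \<Sum>j\<in>J. f j k) summable_on S \<and> (\<Sum>\<^sub>\<infinity>k\<in>S. \<Sum>j\<in>J. f j k) = (\<Sum>j\<in>J. infsum (f j) S)"
  using assms by (induction J rule: finite_induct) (auto simp: infsum_add intro: summable_on_add)

lemma summable_on_half_powers: "(\<lambda>k::nat. C * (1 / 2 :: real) ^ k) summable_on UNIV"
  and infsum_half_powers: "(\<Sum>\<^sub>\<infinity>k::nat. C * (1 / 2 :: real) ^ k) = 2 * C"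
proof -
  have "((\<lambda>k::nat. (1 / 2 :: real) ^ k) has_sum 2) UNIV"
    using geometric_sums[of "1/2::real"] by (intro norm_summable_imp_has_sum) (auto simp: summable_geometric)
  hence "((\<lambda>k::nat. C * (1 / 2 :: real) ^ k) has_sum C * 2) UNIV" by (rule has_sum_cmult_right)
  thus "(\<lambda>k::nat. C * (1 / 2 :: real) ^ k) summable_on UNIV" "(\<Sum>\<^sub>\<infinity>k::nat. C * (1 / 2 :: real) ^ k) = 2 * C"
    by (auto simp: has_sum_iff)
qed

lemma geometric_bound_sum:
  fixes x :: "nat \<Rightarrow> real"
  assumes "\<And>k. 0 \<le> x k" "\<And>k. x k \<le> C * (1 / 2) ^ k"
  shows "x summable_on UNIV" "infsum x UNIV \<le> 2 * C"
proof -
  show s: "x summable_on UNIV"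
    by (rule summable_on_comparison_test[OF summable_on_half_powers[of C]]) (use assms in auto)
  show "infsum x UNIV \<le> 2 * C"
    unfolding infsum_half_powers[symmetric] using s summable_on_half_powers assms(2) by (rule infsum_mono)
qed

text \<open>Solving with the unperturbed operator leaves a residual of at most half the norm, so the
  corrections form a geometric series. The vectors \<open>e j\<close> stay the same, hence one
  complement serves all small potentials. In the constant, the two weighted norms of v contribute 4
  K and each of the d coefficients contributes 2 K.\<close>

lemma complemented_perturb:
  assumes C: "complemented s t (conv a) d e K" and a: "a \<in> ell s" "a \<in> ell t"
    and w: "\<And>n. cmod (w n) \<le> \<delta>" and \<delta>: "\<delta> * K \<le> 1 / 2"
  shows "complemented s t (\<lambda>v n. conv a v n + w n * v n) d e (2 * K * (2 + real d))"
proof -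
  have K: "K > 0" and e: "\<And>j. j < d \<Longrightarrow> e j \<in> ell s \<inter> ell t" using C by (auto simp: complemented_def)
  have \<delta>0: "\<delta> \<ge> 0" using w[of 0] norm_ge_zero order_trans by blast
  have mw: "(\<lambda>n. - (w n * v n)) \<in> ell s \<inter> ell t"
    "enorm2 s t (\<lambda>n. - (w n * v n)) \<le> \<delta> * enorm2 s t v" if "v \<in> ell s \<inter> ell t" for v
    using ell_mult_bounded[of v s w \<delta>] ell_mult_bounded[of v t w \<delta>] w that
    by (auto simp: ell_minus enorm2_def ring_distribs intro: add_mono)
  have "\<forall>y. \<exists>v c. y \<in> ell s \<inter> ell t \<longrightarrow> v \<in> ell s \<inter> ell t \<and> y = (\<lambda>n. conv a v n + (\<Sum>j<d. c j * e j n)) \<and>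
        enorm2 s t v + (\<Sum>j<d. cmod (c j)) \<le> K * enorm2 s t y"
    using C unfolding complemented_def by blast
  then obtain F G where FG: "\<And>y. y \<in> ell s \<inter> ell t \<Longrightarrow> F y \<in> ell s \<inter> ell t"
    "\<And>y. y \<in> ell s \<inter> ell t \<Longrightarrow> y = (\<lambda>n. conv a (F y) n + (\<Sum>j<d. G y j * e j n))"
    "\<And>y. y \<in> ell s \<inter> ell t \<Longrightarrow> enorm2 s t (F y) + (\<Sum>j<d. cmod (G y j)) \<le> K * enorm2 s t y"
    unfolding choice_iff by blast
  have inj: "v = (\<lambda>_. 0) \<and> (\<forall>j<d. c j = 0)"
    if "v \<in> ell s \<inter> ell t" "(\<lambda>n. conv a v n + (\<Sum>j<d. c j * e j n)) = (\<lambda>_. 0)" for v c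
    using C that unfolding complemented_def by blast
  show ?thesis
    unfolding complemented_def
  proof (intro conjI allI ballI impI)
    show "2 * K * (2 + real d) > 0" using K by (intro mult_pos_pos) auto
    show "e j \<in> ell s \<inter> ell t" if "j < d" for j by (rule e[OF that])
  next
    fix y assume y: "y \<in> ell s \<inter> ell t"
    \<comment> \<open>\<open>Y k\<close> is the residual after k corrections. Summing the
      unperturbed equations over k telescopes: the residuals after the first add up to
      \<open>- (w n * v n)\<close>.\<close>
    define Y where "Y k = ((\<lambda>y n. - (w n * F y n)) ^^ k) y" for k
    have Y0: "Y 0 = y" and YS: "Y (Suc k) = (\<lambda>n. - (w n * F (Y k) n))" for k by (auto simp: Y_def)
    have Yin: "Y k \<in> ell s \<inter> ell t" for k
      by (induction k) (use y mw(1) FG(1) in \<open>auto simp: Y0 YS\<close>)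
    have Fb: "enorm2 s t (F (Y k)) \<le> K * enorm2 s t (Y k)" "j < d \<Longrightarrow> cmod (G (Y k) j) \<le> K * enorm2 s t (Y k)" for k j
    proof -
      note * = FG(3)[OF Yin[of k]]
      have "0 \<le> (\<Sum>j<d. cmod (G (Y k) j))" by (intro sum_nonneg) auto
      with * show "enorm2 s t (F (Y k)) \<le> K * enorm2 s t (Y k)" by linarith
      assume "j < d"
      hence "cmod (G (Y k) j) \<le> (\<Sum>j<d. cmod (G (Y k) j))" by (intro member_le_sum) auto
      also have "\<dots> \<le> K * enorm2 s t (Y k)"
        using * by (rule order_trans[rotated]) simp
      finally show "cmod (G (Y k) j) \<le> K * enorm2 s t (Y k)" .
    qed
    have Yb: "enorm2 s t (Y k) \<le> enorm2 s t y * (1 / 2) ^ k" for k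
    proof (induction k)
      case (Suc k)
      have "enorm2 s t (Y (Suc k)) \<le> \<delta> * enorm2 s t (F (Y k))"
        unfolding YS by (rule mw(2)[OF FG(1)[OF Yin]])
      also have "\<dots> \<le> \<delta> * (K * enorm2 s t (Y k))" using Fb(1) \<delta>0 by (intro mult_left_mono)
      also have "\<dots> = (\<delta> * K) * enorm2 s t (Y k)" by simp
      also have "\<dots> \<le> (1 / 2) * enorm2 s t (Y k)" using \<delta> by (intro mult_right_mono) auto
      also have "\<dots> \<le> (1 / 2) * (enorm2 s t y * (1 / 2) ^ k)" using Suc by (intro mult_left_mono) auto
      finally show ?case by simp
    qed (simp add: Y0)
    define c0 where "c0 = K * enorm2 s t y"
    have KY: "K * enorm2 s t (Y k) \<le> c0 * (1 / 2) ^ k" for k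
      using mult_left_mono[OF Yb, of K k] K by (simp add: c0_def mult.assoc)
    have Fk: "enorm s (F (Y k)) \<le> c0 * (1 / 2) ^ k" "enorm t (F (Y k)) \<le> c0 * (1 / 2) ^ k" for k
      using order_trans[OF enorm_le_enorm2(1) order_trans[OF Fb(1) KY]]
        order_trans[OF enorm_le_enorm2(2) order_trans[OF Fb(1) KY]] by auto
    have Gk: "cmod (G (Y k) j) \<le> c0 * (1 / 2) ^ k" if "j < d" for k j
      using Fb(2)[OF that, of k] KY[of k] by linarith
    note Fs = geometric_bound_sum[OF enorm_nonneg Fk(1)] and Ft = geometric_bound_sum[OF enorm_nonneg Fk(2)]
    have Gs: "(\<lambda>k. cmod (G (Y k) j)) summable_on UNIV" "(\<Sum>\<^sub>\<infinity>k. cmod (G (Y k) j)) \<le> 2 * c0" if "j < d" for j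
      using geometric_bound_sum[OF norm_ge_zero Gk[OF that]] by auto
    have Fin: "F (Y k) \<in> ell s" "F (Y k) \<in> ell t" for k using FG(1)[OF Yin] by auto
    define v where "v = (\<lambda>n. \<Sum>\<^sub>\<infinity>k. F (Y k) n)"
    define c where "c j = (\<Sum>\<^sub>\<infinity>k. G (Y k) j)" for j
    have v: "v \<in> ell s \<inter> ell t"
      unfolding v_def using ell_series_ell[OF Fin(1) Fs(1)] ell_series_ell[OF Fin(2) Ft(1)] by auto
    have bound: "enorm2 s t v + (\<Sum>j<d. cmod (c j)) \<le> 2 * K * (2 + real d) * enorm2 s t y"
    proof -
      have "enorm s v \<le> 2 * c0" "enorm t v \<le> 2 * c0"
        unfolding v_def
        using order_trans[OF ell_series_enorm[OF Fin(1) Fs(1)] Fs(2)] order_trans[OF ell_series_enorm[OF Fin(2) Ft(1)] Ft(2)]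
        by auto
      moreover have "(\<Sum>j<d. cmod (c j)) \<le> (\<Sum>j<d. 2 * c0)"
      proof (rule sum_mono)
        fix j assume j: "j \<in> {..<d}"
        have "cmod (c j) \<le> (\<Sum>\<^sub>\<infinity>k. cmod (G (Y k) j))"
          unfolding c_def by (rule norm_infsum_bound) (use Gs(1) j in auto)
        thus "cmod (c j) \<le> 2 * c0" using Gs(2)[of j] j by simp
      qed
      ultimately have "enorm2 s t v + (\<Sum>j<d. cmod (c j)) \<le> 4 * c0 + real d * (2 * c0)"
        by (simp add: enorm2_def)
      thus ?thesis by (simp add: c0_def algebra_simps)
    qed
    have "y n = conv a v n + w n * v n + (\<Sum>j<d. c j * e j n)" for n
    proof -
      have "(\<lambda>k. enorm s (Y k)) summable_on UNIV"
        by (rule geometric_bound_sum(1)[OF enorm_nonneg order_trans[OF enorm_le_enorm2(1) Yb]])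
      from ell_series_summable[OF _ this, of n] Yin have Ysum: "(\<lambda>k. Y k n) summable_on UNIV" by auto
      have Gsum: "(\<lambda>k. G (Y k) j * e j n) summable_on UNIV" if "j \<in> {..<d}" for j
        by (intro summable_on_cmult_left Infinite_Sum.abs_summable_summable[OF Gs(1)]) (use that in auto)
      have Gsum': "(\<lambda>k. \<Sum>j<d. G (Y k) j * e j n) summable_on UNIV"
        "(\<Sum>\<^sub>\<infinity>k. \<Sum>j<d. G (Y k) j * e j n) = (\<Sum>j<d. c j * e j n)"
        using infsum_finite_sum[of "{..<d}" "\<lambda>j k. G (Y k) j * e j n" UNIV] Gsum
        by (auto simp: c_def infsum_cmult_left')
      have Yeq: "Y k n = conv a (F (Y k)) n + (\<Sum>j<d. G (Y k) j * e j n)" for k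
        using FG(2)[OF Yin[of k]] by (auto dest: fun_cong)
      have cs: "(\<lambda>k. conv a (F (Y k)) n) summable_on UNIV"
      proof -
        have "(\<lambda>k. Y k n + - (\<Sum>j<d. G (Y k) j * e j n)) summable_on UNIV"
          by (intro summable_on_add summable_on_uminus[THEN iffD2] Ysum Gsum')
        thus ?thesis by (simp add: Yeq)
      qed
      have "(\<Sum>\<^sub>\<infinity>k. Y k n) = (\<Sum>\<^sub>\<infinity>k. conv a (F (Y k)) n) + (\<Sum>j<d. c j * e j n)"
        unfolding Yeq Gsum'(2)[symmetric] by (rule infsum_add[OF cs Gsum'(1)])
      also have "(\<Sum>\<^sub>\<infinity>k. conv a (F (Y k)) n) = conv a v n"
        unfolding v_def by (rule conv_series[OF Fin(1) Fs(1) a(1), symmetric])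
      finally have 1: "(\<Sum>\<^sub>\<infinity>k. Y k n) = conv a v n + (\<Sum>j<d. c j * e j n)" .
      have "(\<Sum>\<^sub>\<infinity>k. Y k n) = y n + (\<Sum>\<^sub>\<infinity>k. Y (Suc k) n)"
        using infsum_nat_split(1)[OF Ysum] by (simp add: Y0)
      also have "(\<Sum>\<^sub>\<infinity>k. Y (Suc k) n) = - (w n * v n)"
        unfolding YS v_def by (simp add: infsum_uminus infsum_cmult_right')
      finally show ?thesis using 1 by (simp add: algebra_simps)
    qed
    with v bound show "\<exists>v\<in>ell s \<inter> ell t. \<exists>c. y = (\<lambda>n. conv a v n + w n * v n + (\<Sum>j<d. c j * e j n)) \<and>
        enorm2 s t v + (\<Sum>j<d. cmod (c j)) \<le> 2 * K * (2 + real d) * enorm2 s t y"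
      by blast
  next
    fix v c assume v: "v \<in> ell s \<inter> ell t"
      and eq: "(\<lambda>n. conv a v n + w n * v n + (\<Sum>j<d. c j * e j n)) = (\<lambda>_. 0)"
    \<comment> \<open>Read the homogeneous equation as an unperturbed one with right side y.
      Uniqueness identifies v and c with the chosen solution, so the norm of v is at most half of
      itself.\<close>
    define y where "y = (\<lambda>n. - (w n * v n))"
    have y: "y \<in> ell s \<inter> ell t" "enorm2 s t y \<le> \<delta> * enorm2 s t v" unfolding y_def using mw[OF v] by auto
    have vF: "(\<lambda>n. v n - F y n) \<in> ell s \<inter> ell t" using v FG(1)[OF y(1)] by (auto intro: ell_diff)
    have "(\<lambda>n. conv a (\<lambda>n. v n - F y n) n + (\<Sum>j<d. (c j - G y j) * e j n)) = (\<lambda>_. 0)"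
    proof
      fix n
      have aux: "p + (c' - g) = 0" if "p = q - r" "z = r + g" "q + b + c' = 0" "b = - z" for p q r z b c' g :: complex
      proof -
        have "p + (c' - g) = (q + b + c') - b - (r + g)" using that(1) by (simp add: algebra_simps)
        also have "\<dots> = - b - z" by (simp only: that(3) that(2)[symmetric] diff_0)
        also have "\<dots> = 0" by (simp add: that(4))
        finally show ?thesis .
      qed
      have "conv a (\<lambda>n. v n - F y n) n = conv a v n - conv a (F y) n"
        using conv_diff_right[OF a(1), of v "F y"] v FG(1)[OF y(1)] by auto
      moreover have "y n = conv a (F y) n + (\<Sum>j<d. G y j * e j n)" using FG(2)[OF y(1)] by (rule fun_cong)
      moreover have "conv a v n + w n * v n + (\<Sum>j<d. c j * e j n) = 0" using eq by (rule fun_cong)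
      moreover have "w n * v n = - y n" by (simp add: y_def)
      ultimately have "conv a (\<lambda>n. v n - F y n) n + ((\<Sum>j<d. c j * e j n) - (\<Sum>j<d. G y j * e j n)) = 0"
        by (rule aux)
      thus "conv a (\<lambda>n. v n - F y n) n + (\<Sum>j<d. (c j - G y j) * e j n) = 0"
        by (simp add: left_diff_distrib sum_subtractf)
    qed
    from inj[OF vF this] have vF: "v = F y" and cG: "\<And>j. j < d \<Longrightarrow> c j = G y j" by (auto simp: fun_eq_iff)
    have "enorm2 s t v + (\<Sum>j<d. cmod (c j)) \<le> K * enorm2 s t y"
      using FG(3)[OF y(1)] cG by (simp add: vF[symmetric])
    also have "\<dots> \<le> K * (\<delta> * enorm2 s t v)" using y(2) K by (intro mult_left_mono) auto
    also have "\<dots> = (\<delta> * K) * enorm2 s t v" by simp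
    also have "\<dots> \<le> (1 / 2) * enorm2 s t v" using \<delta> by (intro mult_right_mono) auto
    finally have le: "enorm2 s t v + (\<Sum>j<d. cmod (c j)) \<le> (1 / 2) * enorm2 s t v" .
    have c0: "0 \<le> (\<Sum>j<d. cmod (c j))" by (intro sum_nonneg) auto
    have v0: "enorm2 s t v = 0"
      using le c0 by (intro antisym[OF _ enorm2_nonneg]) linarith
    thus "v = (\<lambda>_. 0)" using v enorm_eq_0[of v s]
      unfolding enorm2_def by (auto simp: add_nonneg_eq_0_iff)
    have "(\<Sum>j<d. cmod (c j)) = 0" using le c0 v0 by linarith
    thus "c j = 0" if "j < d" for j using that by (subst (asm) sum_nonneg_eq_0_iff) auto
  qed
qed

section \<open>Series and equations with values in the function algebra\<close>

lemma (in banach_function_algebra) zero_in: "(\<lambda>\<theta>. 0) \<in> A"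
  using scale[OF one, of 0] by simp

lemma (in banach_function_algebra) minus_in: "f \<in> A \<Longrightarrow> (\<lambda>\<theta>. - f \<theta>) \<in> A" "f \<in> A \<Longrightarrow> N (\<lambda>\<theta>. - f \<theta>) = N f"
  using scale[of f "-1"] norm_scale[of f "-1"] by auto

lemma (in banach_function_algebra) sum_in:
  assumes "finite I" "\<And>i. i \<in> I \<Longrightarrow> F i \<in> A"
  shows "(\<lambda>\<theta>. \<Sum>i\<in>I. F i \<theta>) \<in> A \<and> N (\<lambda>\<theta>. \<Sum>i\<in>I. F i \<theta>) \<le> (\<Sum>i\<in>I. N (F i))"
  using assms
proof (induction I rule: finite_induct)
  case empty
  thus ?case using zero_in norm_eq_0[OF zero_in] by simp
next
  case (insert x I)
  thus ?case using add[of "F x" "\<lambda>\<theta>. \<Sum>i\<in>I. F i \<theta>"] norm_triangle[of "F x" "\<lambda>\<theta>. \<Sum>i\<in>I. F i \<theta>"] by auto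
qed

text \<open>Completeness provides a limit in norm only. Domination of the supremum by the norm makes
  convergence pointwise as well, which identifies this limit with the pointwise sum.\<close>

lemma (in admissible) infsum_in_nat:
  fixes F :: "nat \<Rightarrow> 'w \<Rightarrow> complex"
  assumes F: "\<And>i. F i \<in> A" and s: "(\<lambda>i. N (F i)) summable_on UNIV"
  shows "(\<lambda>\<theta>. \<Sum>\<^sub>\<infinity>i. F i \<theta>) \<in> A \<and> N (\<lambda>\<theta>. \<Sum>\<^sub>\<infinity>i. F i \<theta>) \<le> (\<Sum>\<^sub>\<infinity>i. N (F i))"
proof -
  define S where "S n = (\<lambda>\<theta>. \<Sum>i<n. F i \<theta>)" for n
  have N0: "N (F i) \<ge> 0" for i by (rule norm_nonneg[OF F])
  have SA: "S n \<in> A" "N (S n) \<le> (\<Sum>i<n. N (F i))" for n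
    unfolding S_def using sum_in[of "{..<n}" F] F by auto
  have Sd: "(\<lambda>\<theta>. S i \<theta> - S j \<theta>) \<in> A \<and> N (\<lambda>\<theta>. S i \<theta> - S j \<theta>) \<le> (\<Sum>k=j..<i. N (F k))" if "j \<le> i" for i j
  proof -
    have "(\<lambda>\<theta>. S i \<theta> - S j \<theta>) = (\<lambda>\<theta>. \<Sum>k=j..<i. F k \<theta>)"
      unfolding S_def using sum_diff_nat_ivl[of 0 j i] that by (auto simp: fun_eq_iff atLeast0LessThan)
    thus ?thesis using sum_in[of "{j..<i}" F] F by auto
  qed
  have sym: "N (\<lambda>\<theta>. S i \<theta> - S j \<theta>) = N (\<lambda>\<theta>. S j \<theta> - S i \<theta>)" if "j \<le> i" for i j
    using minus_in(2)[OF conjunct1[OF Sd[OF that]]] by simp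
  have sm: "summable (\<lambda>i. N (F i))" by (rule summable_on_imp_summable[OF s])
  have "\<exists>K. \<forall>i\<ge>K. \<forall>j\<ge>K. N (\<lambda>\<theta>. S i \<theta> - S j \<theta>) < e" if "e > 0" for e
  proof -
    obtain K where K: "\<And>m n. m \<ge> K \<Longrightarrow> norm (\<Sum>k=m..<n. N (F k)) < e"
      using sm[unfolded summable_Cauchy] \<open>e > 0\<close> by blast
    have *: "N (\<lambda>\<theta>. S i \<theta> - S j \<theta>) < e" if "K \<le> j" "j \<le> i" for i j
    proof -
      have "N (\<lambda>\<theta>. S i \<theta> - S j \<theta>) \<le> (\<Sum>k=j..<i. N (F k))" using Sd[OF that(2)] by simp
      also have "\<dots> < e" using K[OF that(1), of i] by simp
      finally show ?thesis .
    qed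
    show ?thesis
    proof (intro exI[of _ K] allI impI)
      fix i j assume "K \<le> i" "K \<le> j"
      thus "N (\<lambda>\<theta>. S i \<theta> - S j \<theta>) < e"
        using *[of j i] *[of i j] sym[of i j] by (metis nat_le_linear)
    qed
  qed
  with complete[of S, OF SA(1)] obtain f where f: "f \<in> A" "(\<lambda>i. N (\<lambda>\<theta>. S i \<theta> - f \<theta>)) \<longlonglongrightarrow> 0" by blast
  have dA: "(\<lambda>\<theta>. S i \<theta> - f \<theta>) \<in> A" for i
    using add[OF SA(1) minus_in(1)[OF f(1)], of i] by simp
  have f_eq: "f \<theta> = (\<Sum>\<^sub>\<infinity>i. F i \<theta>)" for \<theta>
  proof -
    have "(\<lambda>i. S i \<theta> - f \<theta>) \<longlonglongrightarrow> 0"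
      by (rule Lim_null_comparison[OF _ f(2)]) (use sup_le_norm[OF dA] in auto)
    hence L: "(\<lambda>i. S i \<theta>) \<longlonglongrightarrow> f \<theta>" by (simp add: LIM_zero_iff)
    have "(\<lambda>i. norm (F i \<theta>)) summable_on UNIV"
      by (rule Infinite_Sum.abs_summable_on_comparison_test'[OF s sup_le_norm[OF F]])
    hence "(\<lambda>i. F i \<theta>) summable_on UNIV" by (rule Infinite_Sum.abs_summable_summable)
    hence "(\<lambda>i. F i \<theta>) sums (\<Sum>\<^sub>\<infinity>i. F i \<theta>)" by (intro has_sum_imp_sums has_sum_infsum)
    hence "(\<lambda>i. S i \<theta>) \<longlonglongrightarrow> (\<Sum>\<^sub>\<infinity>i. F i \<theta>)" unfolding sums_def S_def .
    thus ?thesis using L LIMSEQ_unique by blast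
  qed
  have "N f \<le> (\<Sum>\<^sub>\<infinity>i. N (F i))"
  proof (rule tendsto_lowerbound)
    show "(\<lambda>i. N (\<lambda>\<theta>. S i \<theta> - f \<theta>) + (\<Sum>\<^sub>\<infinity>i. N (F i))) \<longlonglongrightarrow> (\<Sum>\<^sub>\<infinity>i. N (F i))"
      using tendsto_add[OF f(2) tendsto_const[of "\<Sum>\<^sub>\<infinity>i. N (F i)"]] by simp
    show "\<forall>\<^sub>F i in sequentially. N f \<le> N (\<lambda>\<theta>. S i \<theta> - f \<theta>) + (\<Sum>\<^sub>\<infinity>i. N (F i))"
    proof (intro always_eventually allI)
      fix i
      have "N f \<le> N (S i) + N (\<lambda>\<theta>. - (S i \<theta> - f \<theta>))"
        using norm_triangle[OF SA(1)[of i] minus_in(1)[OF dA[of i]]] by simp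
      also have "\<dots> = N (S i) + N (\<lambda>\<theta>. S i \<theta> - f \<theta>)" by (simp only: minus_in(2)[OF dA])
      also have "N (S i) \<le> (\<Sum>\<^sub>\<infinity>i. N (F i))"
        using SA(2)[of i] finite_sum_le_infsum[OF s, of "{..<i}"] N0 by auto
      finally show "N f \<le> N (\<lambda>\<theta>. S i \<theta> - f \<theta>) + (\<Sum>\<^sub>\<infinity>i. N (F i))" by simp
    qed
  qed simp
  moreover have "f = (\<lambda>\<theta>. \<Sum>\<^sub>\<infinity>i. F i \<theta>)" using f_eq by auto
  ultimately show ?thesis using f(1) by simp
qed

lemma (in admissible) infsum_in_int:
  fixes F :: "int \<Rightarrow> 'w \<Rightarrow> complex"
  assumes F: "\<And>i. F i \<in> A" and s: "(\<lambda>i. N (F i)) summable_on UNIV"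
  shows "(\<lambda>\<theta>. \<Sum>\<^sub>\<infinity>i. F i \<theta>) \<in> A \<and> N (\<lambda>\<theta>. \<Sum>\<^sub>\<infinity>i. F i \<theta>) \<le> (\<Sum>\<^sub>\<infinity>i. N (F i))"
proof -
  note b = bij_int_decode
  have "(\<lambda>i. N (F (int_decode i))) summable_on UNIV"
    using summable_on_reindex_bij_betw[OF b, of "\<lambda>i. N (F i)"] s by simp
  from infsum_in_nat[OF F this] show ?thesis
    by (simp add: infsum_reindex_bij_betw[OF b, of "\<lambda>i. N (F i)"] infsum_reindex_bij_betw[OF b, of "\<lambda>i. F i _"])
qed

text \<open>\<open>complemented_perturb\<close> treats each \<theta> by itself and gives no
  information on the dependence on \<theta>. Here the Neumann series is written with the explicit
  inverse kernel g, so each coordinate of each term is an absolutely convergent series in the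
  algebra.\<close>

lemma (in admissible) algebra_valued_solution:
  assumes a: "a \<in> ell s" and g: "g \<in> ell s" and ag: "conv a g = kdelta" and f: "f \<in> ell s"
    and w: "\<And>n. (\<lambda>\<theta>. w \<theta> n) \<in> A" "\<And>n. N (\<lambda>\<theta>. w \<theta> n) \<le> \<delta>" and \<delta>: "\<delta> * enorm s g \<le> 1 / 2"
  shows "\<exists>v. (\<forall>\<theta>. v \<theta> \<in> ell s \<and> (\<forall>n. conv a (v \<theta>) n + w \<theta> n * v \<theta> n = f n)) \<and> (\<forall>n. (\<lambda>\<theta>. v \<theta> n) \<in> A)"
proof -
  have \<delta>0: "\<delta> \<ge> 0" using w(2)[of 0] norm_nonneg[OF w(1)] order_trans by blast
  \<comment> \<open>The k-th term of the Neumann series for v = g * (f - w v).\<close>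
  define b where "b k = rec_nat (\<lambda>\<theta>. conv g f) (\<lambda>_ b \<theta>. conv g (\<lambda>n. - (w \<theta> n * b \<theta> n))) k" for k :: nat
  have b0: "b 0 = (\<lambda>\<theta>. conv g f)" and bS: "b (Suc k) = (\<lambda>\<theta>. conv g (\<lambda>n. - (w \<theta> n * b k \<theta> n)))" for k
    by (auto simp: b_def)
  \<comment> \<open>Replacing each coordinate function by its algebra norm turns the term into one
    complex sequence, for which the weighted estimates are available. It dominates
    \<open>b k \<theta>\<close> for all \<theta> at once.\<close>
  define \<beta> where "\<beta> k n = complex_of_real (N (\<lambda>\<theta>. b k \<theta> n))" for k n
  define g' where "g' n = complex_of_real (cmod (g n))" for n
  have g': "g' \<in> ell s" "enorm s g' = enorm s g"
    using g by (auto simp: g'_def ell_def enorm_def)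
  \<comment> \<open>The first term is constant in \<theta>, and the axioms do not normalize the norm
    of the unit; hence the factor \<open>N (\<lambda>\<theta>. 1)\<close>.\<close>
  define c0 where "c0 = N (\<lambda>\<theta>. 1) * enorm s (conv g f)"
  have ind: "(\<forall>n. (\<lambda>\<theta>. b k \<theta> n) \<in> A) \<and> \<beta> k \<in> ell s \<and> enorm s (\<beta> k) \<le> c0 * (1 / 2) ^ k" for k
  proof (induction k)
    case 0
    have "\<beta> 0 n = complex_of_real (N (\<lambda>\<theta>. 1)) * complex_of_real (cmod (conv g f n))" for n
      using norm_scale[OF one, of "conv g f n"] by (simp add: \<beta>_def b0)
    hence "\<beta> 0 = (\<lambda>n. complex_of_real (N (\<lambda>\<theta>. 1)) * complex_of_real (cmod (conv g f n)))" by auto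
    moreover have "(\<lambda>n. complex_of_real (cmod (conv g f n))) \<in> ell s"
      "enorm s (\<lambda>n. complex_of_real (cmod (conv g f n))) = enorm s (conv g f)"
      using conv_ell[OF g f] by (auto simp: ell_def enorm_def)
    ultimately show ?case
      using scale[OF one] ell_scale[of "\<lambda>n. complex_of_real (cmod (conv g f n))" s "complex_of_real (N (\<lambda>\<theta>. 1))"] norm_nonneg[OF one]
      by (auto simp: b0 c0_def)
  next
    case (Suc k)
    hence bA: "\<And>n. (\<lambda>\<theta>. b k \<theta> n) \<in> A" and \<beta>: "\<beta> k \<in> ell s" "enorm s (\<beta> k) \<le> c0 * (1 / 2) ^ k" by auto
    have \<beta>r: "N (\<lambda>\<theta>. b k \<theta> n) = cmod (\<beta> k n)" for n
      using norm_nonneg[OF bA] by (simp add: \<beta>_def)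
    have FA: "(\<lambda>\<theta>. g m * - (w \<theta> (n - m) * b k \<theta> (n - m))) \<in> A" for m n
      by (intro scale minus_in(1) mult w(1) bA)
    have FN: "N (\<lambda>\<theta>. g m * - (w \<theta> (n - m) * b k \<theta> (n - m))) \<le> \<delta> * cmod (g' m * \<beta> k (n - m))" for m n
    proof -
      have "N (\<lambda>\<theta>. w \<theta> (n - m) * b k \<theta> (n - m)) \<le> N (\<lambda>\<theta>. w \<theta> (n - m)) * N (\<lambda>\<theta>. b k \<theta> (n - m))"
        by (intro norm_mult w(1) bA)
      also have "\<dots> \<le> \<delta> * N (\<lambda>\<theta>. b k \<theta> (n - m))"
        using w(2) norm_nonneg[OF bA] by (intro mult_right_mono)
      finally have "cmod (g m) * N (\<lambda>\<theta>. w \<theta> (n - m) * b k \<theta> (n - m)) \<le> cmod (g m) * (\<delta> * N (\<lambda>\<theta>. b k \<theta> (n - m)))"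
        by (intro mult_left_mono) auto
      moreover have wbA: "(\<lambda>\<theta>. w \<theta> (n - m) * b k \<theta> (n - m)) \<in> A" by (intro mult w(1) bA)
      ultimately show ?thesis
        using norm_scale[OF minus_in(1)[OF wbA], of "g m"] minus_in(2)[OF wbA]
        by (simp add: \<beta>r g'_def Real_Vector_Spaces.norm_mult mult_ac)
    qed
    have sm: "(\<lambda>m. \<delta> * cmod (g' m * \<beta> k (n - m))) summable_on UNIV" for n
      by (intro summable_on_cmult_right conv_abs_summable[OF g'(1) \<beta>(1)])
    have sN: "(\<lambda>m. N (\<lambda>\<theta>. g m * - (w \<theta> (n - m) * b k \<theta> (n - m)))) summable_on UNIV" for n
      by (rule summable_on_comparison_test[OF sm FN norm_nonneg[OF FA]])
    have bSA: "(\<lambda>\<theta>. b (Suc k) \<theta> n) \<in> A"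
      "N (\<lambda>\<theta>. b (Suc k) \<theta> n) \<le> (\<Sum>\<^sub>\<infinity>m. N (\<lambda>\<theta>. g m * - (w \<theta> (n - m) * b k \<theta> (n - m))))" for n
      using infsum_in_int[OF FA sN] unfolding bS conv_def by auto
    have conv_eq: "cmod (conv g' \<beta>' n) = (\<Sum>\<^sub>\<infinity>m. cmod (g' m * \<beta>' (n - m)))" if "\<beta>' = \<beta> k" for \<beta>' n
    proof -
      have "conv g' \<beta>' n = (\<Sum>\<^sub>\<infinity>m. complex_of_real (cmod (g' m * \<beta>' (n - m))))"
        unfolding conv_def that using \<beta>r norm_nonneg[OF bA] by (intro infsum_cong) (auto simp: g'_def \<beta>_def Real_Vector_Spaces.norm_mult)
      also have "\<dots> = complex_of_real (\<Sum>\<^sub>\<infinity>m. cmod (g' m * \<beta>' (n - m)))"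
        by (rule infsumI, rule has_sum_of_real, rule has_sum_infsum) (unfold that, rule conv_abs_summable[OF g'(1) \<beta>(1)])
      finally show ?thesis by (simp add: infsum_nonneg)
    qed
    have le: "cmod (\<beta> (Suc k) n) \<le> cmod (complex_of_real \<delta> * conv g' (\<beta> k) n)" for n
    proof -
      have "cmod (\<beta> (Suc k) n) = N (\<lambda>\<theta>. b (Suc k) \<theta> n)" using norm_nonneg[OF bSA(1)] by (simp add: \<beta>_def)
      also have "\<dots> \<le> (\<Sum>\<^sub>\<infinity>m. \<delta> * cmod (g' m * \<beta> k (n - m)))"
        using order_trans[OF bSA(2) infsum_mono[OF sN sm FN]] .
      also have "\<dots> = \<delta> * cmod (conv g' (\<beta> k) n)" by (simp add: infsum_cmult_right' conv_eq)
      finally show ?thesis using \<delta>0 by (simp add: Real_Vector_Spaces.norm_mult)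
    qed
    have eS: "(\<lambda>n. complex_of_real \<delta> * conv g' (\<beta> k) n) \<in> ell s"
      by (intro ell_scale conv_ell g' \<beta>)
    have "enorm s (\<beta> (Suc k)) \<le> enorm s (\<lambda>n. complex_of_real \<delta> * conv g' (\<beta> k) n)"
      by (rule ell_mono_norm(2)[OF eS le])
    also have "\<dots> = \<delta> * enorm s (conv g' (\<beta> k))"
      using ell_scale(2)[OF conv_ell[OF g'(1) \<beta>(1)], of "complex_of_real \<delta>"] \<delta>0 by simp
    also have "\<dots> \<le> \<delta> * (enorm s g * enorm s (\<beta> k))"
      using conv_enorm[OF g'(1) \<beta>(1)] \<delta>0 g'(2) by (intro mult_left_mono) auto
    also have "\<dots> = (\<delta> * enorm s g) * enorm s (\<beta> k)" by simp
    also have "\<dots> \<le> (1 / 2) * (c0 * (1 / 2) ^ k)"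
      using \<delta> \<delta>0 \<beta>(2) by (intro mult_mono) auto
    finally have "enorm s (\<beta> (Suc k)) \<le> c0 * (1 / 2) ^ Suc k" by simp
    thus ?case using bSA(1) ell_mono_norm(1)[OF eS le] by blast
  qed
  have bA: "\<And>k n. (\<lambda>\<theta>. b k \<theta> n) \<in> A" and \<beta>: "\<And>k. \<beta> k \<in> ell s" "\<And>k. enorm s (\<beta> k) \<le> c0 * (1 / 2) ^ k"
    using ind by auto
  have \<beta>n: "cmod (\<beta> k n) = N (\<lambda>\<theta>. b k \<theta> n)" for k n using norm_nonneg[OF bA] by (simp add: \<beta>_def)
  have b_le: "cmod (b k \<theta> n) \<le> cmod (\<beta> k n)" for k n \<theta>
    unfolding \<beta>n using sup_le_norm[OF bA] .
  have b_ell: "b k \<theta> \<in> ell s" for k \<theta>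
    by (rule ell_mono_norm(1)[OF \<beta>(1) b_le])
  have b_enorm: "enorm s (b k \<theta>) \<le> c0 * (1 / 2) ^ k" for k \<theta>
    by (rule order_trans[OF ell_mono_norm(2)[OF \<beta>(1) b_le] \<beta>(2)])
  note bsum = geometric_bound_sum(1)[OF enorm_nonneg b_enorm]
  define v where "v \<theta> n = (\<Sum>\<^sub>\<infinity>k. b k \<theta> n)" for \<theta> n
  have v_ell: "v \<theta> \<in> ell s" for \<theta>
    unfolding v_def using ell_series_ell[OF b_ell bsum] .
  have wb: "cmod (w \<theta> n) \<le> \<delta>" for \<theta> n using sup_le_norm[OF w(1)] w(2) order_trans by blast
  have wv: "(\<lambda>n. - (w \<theta> n * u n)) \<in> ell s" "enorm s (\<lambda>n. - (w \<theta> n * u n)) \<le> \<delta> * enorm s u" if "u \<in> ell s" for \<theta> u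
    using ell_mult_bounded[OF that wb] by (auto simp: ell_minus)
  have "(\<lambda>\<theta>. v \<theta> n) \<in> A" for n
  proof -
    have "N (\<lambda>\<theta>. b k \<theta> n) \<le> (c0 * inverse (wt s n)) * (1 / 2) ^ k" for k
    proof -
      have "N (\<lambda>\<theta>. b k \<theta> n) * wt s n \<le> c0 * (1 / 2) ^ k"
        using coord_le_enorm[OF \<beta>(1), of k n] \<beta>(2)[of k] unfolding \<beta>n by linarith
      thus ?thesis using wt_pos[of s n] by (simp add: field_simps)
    qed
    from infsum_in_nat[OF bA geometric_bound_sum(1)[OF norm_nonneg[OF bA] this]]
    show ?thesis unfolding v_def by (rule conjunct1)
  qed
  moreover have "conv a (v \<theta>) n + w \<theta> n * v \<theta> n = f n" for \<theta> n
  proof -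
    \<comment> \<open>The series solves the fixed point equation v = g * (f - w v); convolving with
      a then removes g.\<close>
    have vg: "v \<theta> = (\<lambda>n. conv g f n + conv g (\<lambda>n. - (w \<theta> n * v \<theta> n)) n)"
    proof
      fix n
      have "v \<theta> n = b 0 \<theta> n + (\<Sum>\<^sub>\<infinity>k. b (Suc k) \<theta> n)"
        unfolding v_def by (rule infsum_nat_split(1)[OF ell_series_summable[OF b_ell bsum]])
      also have "(\<Sum>\<^sub>\<infinity>k. b (Suc k) \<theta> n) = (\<Sum>\<^sub>\<infinity>k. conv g (\<lambda>n. - (w \<theta> n * b k \<theta> n)) n)"
        by (simp add: bS)
      also have "\<dots> = conv g (\<lambda>n. \<Sum>\<^sub>\<infinity>k. - (w \<theta> n * b k \<theta> n)) n"
      proof (rule conv_series[symmetric, OF wv(1)[OF b_ell] _ g])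
        have "enorm s (\<lambda>n. - (w \<theta> n * b k \<theta> n)) \<le> (\<delta> * c0) * (1 / 2) ^ k" for k
          using order_trans[OF wv(2)[OF b_ell] mult_left_mono[OF b_enorm \<delta>0]] by (simp add: mult.assoc)
        thus "(\<lambda>k. enorm s (\<lambda>n. - (w \<theta> n * b k \<theta> n))) summable_on UNIV"
          by (rule geometric_bound_sum(1)[OF enorm_nonneg])
      qed
      also have "(\<lambda>n. \<Sum>\<^sub>\<infinity>k. - (w \<theta> n * b k \<theta> n)) = (\<lambda>n. - (w \<theta> n * v \<theta> n))"
        by (simp add: v_def infsum_uminus infsum_cmult_right')
      finally show "v \<theta> n = conv g f n + conv g (\<lambda>n. - (w \<theta> n * v \<theta> n)) n" by (simp add: b0)
    qed
    have "conv a (v \<theta>) = (\<lambda>n. conv a (conv g f) n + conv a (conv g (\<lambda>n. - (w \<theta> n * v \<theta> n))) n)"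
      by (subst vg, rule conv_add_right[OF a conv_ell[OF g f] conv_ell[OF g wv(1)[OF v_ell]]])
    also have "\<dots> = (\<lambda>n. f n - w \<theta> n * v \<theta> n)"
      by (simp add: conv_assoc[OF a g, symmetric] f wv(1)[OF v_ell] ag)
    finally show ?thesis by simp
  qed
  ultimately show ?thesis using v_ell by blast
qed

subsection \<open>The trichotomy of solutions\<close>


definition pos_part :: "(int \<Rightarrow> complex) \<Rightarrow> int \<Rightarrow> complex" where
  "pos_part u n = (if n \<ge> 0 then u n else 0)"

definition neg_part :: "(int \<Rightarrow> complex) \<Rightarrow> int \<Rightarrow> complex" where
  "neg_part u n = (if n < 0 then u n else 0)"

lemma pos_neg_part: "(\<lambda>n. pos_part u n + neg_part u n) = u"
  by (auto simp: pos_part_def neg_part_def)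

lemma part_simps:
  "pos_part (\<lambda>n. u n + v n) = (\<lambda>n. pos_part u n + pos_part v n)"
  "neg_part (\<lambda>n. u n + v n) = (\<lambda>n. neg_part u n + neg_part v n)"
  "pos_part (\<lambda>n. u n - v n) = (\<lambda>n. pos_part u n - pos_part v n)"
  "neg_part (\<lambda>n. u n - v n) = (\<lambda>n. neg_part u n - neg_part v n)"
  "pos_part (\<lambda>n. c * u n) = (\<lambda>n. c * pos_part u n)"
  "neg_part (\<lambda>n. c * u n) = (\<lambda>n. c * neg_part u n)"
  "pos_part (pos_part u) = pos_part u" "neg_part (neg_part u) = neg_part u"
  "pos_part (neg_part u) = (\<lambda>_. 0)" "neg_part (pos_part u) = (\<lambda>_. 0)"
  by (auto simp: pos_part_def neg_part_def)

lemma part_ell: assumes "u \<in> ell r"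
  shows "pos_part u \<in> ell r" "enorm r (pos_part u) \<le> enorm r u"
    "neg_part u \<in> ell r" "enorm r (neg_part u) \<le> enorm r u"
  using ell_mono_norm[OF assms, of "pos_part u"] ell_mono_norm[OF assms, of "neg_part u"]
  by (auto simp: pos_part_def neg_part_def)

lemma ell_parts: "pos_part u \<in> ell r \<Longrightarrow> neg_part u \<in> ell r \<Longrightarrow> u \<in> ell r"
  using ell_add(1)[of "pos_part u" r "neg_part u"] by (simp add: pos_neg_part)

lemma ell_wt_le:
  assumes "v \<in> ell r" "\<And>n. cmod (u n) * wt r' n \<le> cmod (v n) * wt r n"
  shows "u \<in> ell r'" "enorm r' u \<le> enorm r v"
proof -
  show u: "u \<in> ell r'"
    using assms(1) unfolding ell_def mem_Collect_eq
    by (rule summable_on_comparison_test) (auto intro: assms(2))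
  show "enorm r' u \<le> enorm r v"
    unfolding enorm_def using u assms by (intro infsum_mono) (auto simp: ell_def)
qed

text \<open>On n >= 0 the weight grows with r and on n < 0 it shrinks, so each half-line sequence
  passes to all weights on one side. All comparisons of rates below use this.\<close>

lemma pos_part_mono: assumes "pos_part u \<in> ell r" "r' \<le> r"
  shows "pos_part u \<in> ell r'" "enorm r' (pos_part u) \<le> enorm r (pos_part u)"
  by (rule ell_wt_le[OF assms(1)]; use assms(2) in \<open>auto simp: pos_part_def wt_def intro!: mult_left_mono mult_right_mono\<close>)+

lemma neg_part_mono: assumes "neg_part u \<in> ell r" "r \<le> r'"
  shows "neg_part u \<in> ell r'" "enorm r' (neg_part u) \<le> enorm r (neg_part u)"
  by (rule ell_wt_le[OF assms(1)]; use assms(2) in \<open>auto simp: neg_part_def wt_def intro!: mult_left_mono mult_right_mono_neg\<close>)+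

text \<open>The weight e^(-\<xi>|n|) is \<open>wt (- \<xi>)\<close> on the nonnegative half and
  \<open>wt \<xi>\<close> on the negative half, so each half of a sequence in X_\<xi> lies in a
  convolution algebra of its own.\<close>

lemma xspace_iff: "u \<in> xspace \<xi> \<longleftrightarrow> pos_part u \<in> ell (- \<xi>) \<and> neg_part u \<in> ell \<xi>"
  and xnorm_eq: "u \<in> xspace \<xi> \<Longrightarrow> xnorm \<xi> u = enorm (- \<xi>) (pos_part u) + enorm \<xi> (neg_part u)"
proof -
  let ?f = "\<lambda>n. cmod (u n) * exp (- \<xi> * \<bar>real_of_int n\<bar>)"
  let ?p = "\<lambda>n. cmod (pos_part u n) * wt (- \<xi>) n" and ?q = "\<lambda>n. cmod (neg_part u n) * wt \<xi> n"
  have eq: "?f = (\<lambda>n. ?p n + ?q n)"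
    by (auto simp: pos_part_def neg_part_def wt_def)
  have "?p summable_on UNIV \<and> ?q summable_on UNIV" if "?f summable_on UNIV"
  proof
    show "?p summable_on UNIV"
      by (rule summable_on_comparison_test[OF that]) (auto simp: pos_part_def wt_def)
    show "?q summable_on UNIV"
      by (rule summable_on_comparison_test[OF that]) (auto simp: neg_part_def wt_def)
  qed
  thus *: "u \<in> xspace \<xi> \<longleftrightarrow> pos_part u \<in> ell (- \<xi>) \<and> neg_part u \<in> ell \<xi>"
    unfolding xspace_def ell_def mem_Collect_eq using summable_on_add[of ?p UNIV ?q] eq by auto
  assume "u \<in> xspace \<xi>"
  hence "?p summable_on UNIV" "?q summable_on UNIV" using * by (auto simp: ell_def)
  thus "xnorm \<xi> u = enorm (- \<xi>) (pos_part u) + enorm \<xi> (neg_part u)"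
    unfolding xnorm_def enorm_def eq by (rule infsum_add)
qed

lemma complementedD:
  assumes "complemented s t A d e K" "y \<in> ell s" "y \<in> ell t"
  obtains v c where "v \<in> ell s" "v \<in> ell t" "y = (\<lambda>n. A v n + (\<Sum>j<d. c j * e j n))"
    "enorm2 s t v + (\<Sum>j<d. cmod (c j)) \<le> K * enorm2 s t y"
  using assms unfolding complemented_def by blast

lemma complemented_injD:
  assumes "complemented s t A d e K" "v \<in> ell s" "v \<in> ell t"
    and "(\<lambda>n. A v n + (\<Sum>j<d. c j * e j n)) = (\<lambda>_. 0)"
  shows "v = (\<lambda>_. 0)" "j < d \<Longrightarrow> c j = 0"
  using assms unfolding complemented_def by blast+

text \<open>\<open>infsum\<close> is 0 on divergent families, so linearity of the convolution needs
  convergence as a hypothesis. A sequence in X_\<xi> may lie in no \<open>ell r\<close>, but it is a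
  sum of two halves that do, and this domain is closed under sums.\<close>

definition conv_dom :: "(int \<Rightarrow> complex) \<Rightarrow> (int \<Rightarrow> complex) set" where
  "conv_dom a = {u. \<forall>n. (\<lambda>k. a k * u (n - k)) summable_on UNIV}"

lemma conv_dom_ell: "a \<in> ell r \<Longrightarrow> u \<in> ell r \<Longrightarrow> u \<in> conv_dom a"
  using conv_summable by (auto simp: conv_dom_def)

lemma conv_dom_add: assumes "u \<in> conv_dom a" "v \<in> conv_dom a"
  shows "(\<lambda>n. u n + v n) \<in> conv_dom a" "conv a (\<lambda>n. u n + v n) = (\<lambda>n. conv a u n + conv a v n)"
  using assms by (auto simp: conv_dom_def conv_def ring_distribs infsum_add summable_on_add)

lemma conv_dom_scale: assumes "u \<in> conv_dom a"
  shows "(\<lambda>n. c * u n) \<in> conv_dom a" "conv a (\<lambda>n. c * u n) = (\<lambda>n. c * conv a u n)"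
  using assms by (auto simp: conv_dom_def mult.left_commute[of _ c] conv_scale_right intro: summable_on_cmult_right)

definition pconv :: "(int \<Rightarrow> complex) \<Rightarrow> (int \<Rightarrow> complex) \<Rightarrow> (int \<Rightarrow> complex) \<Rightarrow> int \<Rightarrow> complex" where
  "pconv a w u = (\<lambda>n. conv a u n + w n * u n)"

lemma pconv_add: assumes "u \<in> conv_dom a" "v \<in> conv_dom a"
  shows "pconv a w (\<lambda>n. u n + v n) = (\<lambda>n. pconv a w u n + pconv a w v n)"
  unfolding pconv_def conv_dom_add(2)[OF assms] by (simp add: algebra_simps)

lemma pconv_scale: assumes "u \<in> conv_dom a" shows "pconv a w (\<lambda>n. c * u n) = (\<lambda>n. c * pconv a w u n)"
  unfolding pconv_def conv_dom_scale(2)[OF assms] by (simp add: algebra_simps)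

lemma pconv_diff: assumes "u \<in> conv_dom a" "v \<in> conv_dom a"
  shows "pconv a w (\<lambda>n. u n - v n) = (\<lambda>n. pconv a w u n - pconv a w v n)"
  using pconv_add[OF assms(1) conv_dom_scale(1)[OF assms(2), of "-1"], of w] pconv_scale[OF assms(2), of w "-1"] by simp

lemma conv_dom_sum: "finite J \<Longrightarrow> (\<And>j. j \<in> J \<Longrightarrow> u j \<in> conv_dom a) \<Longrightarrow> (\<lambda>n. \<Sum>j\<in>J. c j * u j n) \<in> conv_dom a"
proof (induction J rule: finite_induct)
  case (insert x F)
  have "(\<lambda>n. c x * u x n + (\<Sum>j\<in>F. c j * u j n)) \<in> conv_dom a"
    using insert by (intro conv_dom_add(1) conv_dom_scale(1)) auto
  with insert show ?case by simp
qed (simp add: conv_dom_def)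

lemma pconv_zero: "pconv a w (\<lambda>_. 0) = (\<lambda>_. 0)"
  by (simp add: pconv_def)

lemma pconv_sum: "finite J \<Longrightarrow> (\<And>j. j \<in> J \<Longrightarrow> u j \<in> conv_dom a) \<Longrightarrow>
    pconv a w (\<lambda>n. \<Sum>j\<in>J. c j * u j n) = (\<lambda>n. \<Sum>j\<in>J. c j * pconv a w (u j) n)"
proof (induction J rule: finite_induct)
  case (insert x F)
  have "pconv a w (\<lambda>n. c x * u x n + (\<Sum>j\<in>F. c j * u j n)) =
      (\<lambda>n. pconv a w (\<lambda>n. c x * u x n) n + pconv a w (\<lambda>n. \<Sum>j\<in>F. c j * u j n) n)"
    using insert by (intro pconv_add conv_dom_scale conv_dom_sum) auto
  with insert show ?case by (simp add: pconv_scale)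
qed (simp add: pconv_zero)

section \<open>The three solution spaces and the action of the shift\<close>

definition sol_space where
  "sol_space a w \<xi> = {u \<in> xspace \<xi>. pconv a w u = (\<lambda>_. 0)}"

text \<open>Only the behaviour at +\<infinity> is restricted; at -\<infinity> membership in X_\<xi>
  is enough. The rate 2 \<eta>, against \<eta> in \<open>center_sol\<close>, is what separates the
  stable from the center rates.\<close>

definition stable_sol where
  "stable_sol a w \<xi> \<eta> = {u \<in> sol_space a w \<xi>. pos_part u \<in> ell (2 * \<eta>)}"

definition unstable_sol where
  "unstable_sol a w \<xi> \<eta> = {u \<in> sol_space a w \<xi>. neg_part u \<in> ell (- 2 * \<eta>)}"

definition center_sol where
  "center_sol a w \<xi> \<eta> = {u \<in> sol_space a w \<xi>. pos_part u \<in> ell (- \<eta>) \<and> neg_part u \<in> ell \<eta>}"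

lemma conv_shift: "conv a (shift k u) = shift k (conv a u)"
  by (simp add: conv_def shift_def algebra_simps)

lemma shift_ell: assumes "u \<in> ell r" shows "shift k u \<in> ell r"
proof -
  have "(\<lambda>n. cmod (u n) * wt r n * wt r (- k)) summable_on UNIV"
    using assms by (intro summable_on_cmult_left) (simp add: ell_def)
  hence "(\<lambda>n. cmod (u (n + k)) * wt r (n + k) * wt r (- k)) summable_on UNIV"
    using summable_on_reindex_bij_betw[of "\<lambda>n. n + k" UNIV UNIV "\<lambda>n. cmod (u n) * wt r n * wt r (- k)"]
    by (simp add: bij_betw_def inj_on_def surj_plus_right)
  thus ?thesis by (simp add: ell_def shift_def mult.assoc flip: wt_add)
qed

text \<open>Cutting at the origin and shifting commute up to finitely many coordinates, and a
  finitely supported sequence lies in every weighted space.\<close>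

lemma shift_part_ell:
  shows "pos_part u \<in> ell r \<Longrightarrow> pos_part (shift k u) \<in> ell r"
    and "neg_part u \<in> ell r \<Longrightarrow> neg_part (shift k u) \<in> ell r"
proof -
  have 1: "(\<lambda>n. pos_part (shift k u) n - shift k (pos_part u) n) \<in> ell r"
    by (rule ell_finite_support, rule finite_subset[of _ "{- \<bar>k\<bar>..\<bar>k\<bar>}"])
      (auto simp: pos_part_def shift_def split: if_splits)
  have 2: "(\<lambda>n. neg_part (shift k u) n - shift k (neg_part u) n) \<in> ell r"
    by (rule ell_finite_support, rule finite_subset[of _ "{- \<bar>k\<bar>..\<bar>k\<bar>}"])
      (auto simp: neg_part_def shift_def split: if_splits)
  show "pos_part u \<in> ell r \<Longrightarrow> pos_part (shift k u) \<in> ell r"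
    using ell_add(1)[OF 1 shift_ell[of "pos_part u" r k]] by simp
  show "neg_part u \<in> ell r \<Longrightarrow> neg_part (shift k u) \<in> ell r"
    using ell_add(1)[OF 2 shift_ell[of "neg_part u" r k]] by simp
qed

lemma shift_sol_space: assumes "u \<in> sol_space a w \<xi>" shows "shift k u \<in> sol_space a (shift k w) \<xi>"
proof -
  have "pconv a (shift k w) (shift k u) = shift k (pconv a w u)"
    unfolding pconv_def conv_shift by (simp add: shift_def)
  thus ?thesis using assms by (auto simp: sol_space_def xspace_iff shift_part_ell) (simp add: shift_def)
qed

lemma shift_sols:
  "u \<in> stable_sol a w \<xi> \<eta> \<Longrightarrow> shift k u \<in> stable_sol a (shift k w) \<xi> \<eta>"
  "u \<in> unstable_sol a w \<xi> \<eta> \<Longrightarrow> shift k u \<in> unstable_sol a (shift k w) \<xi> \<eta>"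
  "u \<in> center_sol a w \<xi> \<eta> \<Longrightarrow> shift k u \<in> center_sol a (shift k w) \<xi> \<eta>"
  by (auto simp: stable_sol_def unstable_sol_def center_sol_def shift_sol_space shift_part_ell)

text \<open>The shift moves the peak of the weight e^(-\<xi>|n|) to k. If its exponent stays below a
  line of slope \<rho>1 for j >= 0 and of slope \<rho>2 for j <= 0, both with value -\<kappa> at 0,
  then the decay of the two halves turns into the factor e^(-\<kappa>). A negative \<kappa> gives
  the growth bounds of the center.\<close>

lemma xnorm_shift_le:
  assumes p: "pos_part u \<in> ell \<rho>1" and n: "neg_part u \<in> ell \<rho>2"
    and le1: "\<And>j::real. j \<ge> 0 \<Longrightarrow> - \<xi> * \<bar>j - real_of_int k\<bar> \<le> - \<kappa> + \<rho>1 * j"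
    and le2: "\<And>j::real. j \<le> 0 \<Longrightarrow> - \<xi> * \<bar>j - real_of_int k\<bar> \<le> - \<kappa> + \<rho>2 * j"
  shows "xnorm \<xi> (shift k u) \<le> exp (- \<kappa>) * (enorm \<rho>1 (pos_part u) + enorm \<rho>2 (neg_part u))"
proof -
  let ?G = "\<lambda>j. exp (- \<kappa>) * (cmod (pos_part u j) * wt \<rho>1 j + cmod (neg_part u j) * wt \<rho>2 j)"
  have sG: "?G summable_on UNIV"
    using p n by (intro summable_on_cmult_right summable_on_add) (auto simp: ell_def)
  have le: "cmod (u j) * exp (- \<xi> * \<bar>real_of_int (j - k)\<bar>) \<le> ?G j" for j
  proof (cases "j \<ge> 0")
    case True
    have "cmod (u j) * exp (- \<xi> * \<bar>real_of_int (j - k)\<bar>) \<le> cmod (u j) * (exp (- \<kappa>) * exp (\<rho>1 * real_of_int j))"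
      using le1[of "real_of_int j"] True by (intro mult_left_mono) (auto simp flip: exp_add)
    thus ?thesis using True by (simp add: pos_part_def neg_part_def wt_def mult_ac)
  next
    case False
    have "cmod (u j) * exp (- \<xi> * \<bar>real_of_int (j - k)\<bar>) \<le> cmod (u j) * (exp (- \<kappa>) * exp (\<rho>2 * real_of_int j))"
      using le2[of "real_of_int j"] False by (intro mult_left_mono) (auto simp flip: exp_add)
    thus ?thesis using False by (simp add: pos_part_def neg_part_def wt_def mult_ac)
  qed
  have s: "(\<lambda>j. cmod (u j) * exp (- \<xi> * \<bar>real_of_int (j - k)\<bar>)) summable_on UNIV"
    by (rule summable_on_comparison_test[OF sG le]) auto
  have "xnorm \<xi> (shift k u) = (\<Sum>\<^sub>\<infinity>j. cmod (u j) * exp (- \<xi> * \<bar>real_of_int (j - k)\<bar>))"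
    unfolding xnorm_def shift_def
    by (rule infsum_reindex_bij_witness[of _ "\<lambda>j. j - k" "\<lambda>n. n + k"]) auto
  also have "\<dots> \<le> infsum ?G UNIV" by (rule infsum_mono[OF s sG le])
  also have "\<dots> = exp (- \<kappa>) * (enorm \<rho>1 (pos_part u) + enorm \<rho>2 (neg_part u))"
    unfolding infsum_cmult_right' enorm_def using p n by (subst infsum_add) (auto simp: ell_def)
  finally show ?thesis .
qed

lemma fiber_opnorm_le:
  assumes "(\<lambda>_. 0) \<in> F" "\<And>u. u \<in> F \<Longrightarrow> xnorm \<xi> u \<le> 1 \<Longrightarrow> xnorm \<xi> (\<Phi> u) \<le> B"
  shows "fiber_opnorm \<xi> \<Phi> F \<le> B"
  unfolding fiber_opnorm_def
proof (rule cSUP_least)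
  have "xnorm \<xi> (\<lambda>_. 0) = 0" by (simp add: xnorm_def)
  thus "{u \<in> F. xnorm \<xi> u \<le> 1} \<noteq> {}" using assms(1) by auto
qed (use assms(2) in auto)

text \<open>The situation at one fixed \<theta>. Solvability is required at pairs of weights, so
  that solutions come with two rates; uniqueness is required at \<eta> and at -\<eta> alone, because
  two competing solutions need not both lie in the intersection of a pair.\<close>

locale dichotomy =
  fixes a w :: "int \<Rightarrow> complex" and \<xi> \<eta> K \<delta> :: real and d :: nat and e :: "nat \<Rightarrow> int \<Rightarrow> complex"
  assumes \<eta>: "\<eta> > 0" "2 * \<eta> \<le> \<xi>"
    and a: "\<bar>r\<bar> \<le> \<xi> \<Longrightarrow> a \<in> ell r"
    and w: "cmod (w n) \<le> \<delta>"
    and solve_s: "complemented \<eta> (2 * \<eta>) (pconv a w) 0 e K"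
    and solve_u: "complemented (- 2 * \<eta>) (- \<eta>) (pconv a w) 0 e K"
    and inj_s: "u \<in> ell \<eta> \<Longrightarrow> pconv a w u = (\<lambda>_. 0) \<Longrightarrow> u = (\<lambda>_. 0)"
    and inj_u: "u \<in> ell (- \<eta>) \<Longrightarrow> pconv a w u = (\<lambda>_. 0) \<Longrightarrow> u = (\<lambda>_. 0)"
    and compl: "complemented (- \<eta>) \<eta> (pconv a w) d e K"
begin

abbreviation "sol \<equiv> sol_space a w \<xi>"
abbreviation "sol_s \<equiv> stable_sol a w \<xi> \<eta>"
abbreviation "sol_u \<equiv> unstable_sol a w \<xi> \<eta>"
abbreviation "sol_c \<equiv> center_sol a w \<xi> \<eta>"
lemmas sol_def = sol_space_def[of a w \<xi>]
lemmas sol_s_def = stable_sol_def[of a w \<xi> \<eta>]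
lemmas sol_u_def = unstable_sol_def[of a w \<xi> \<eta>]
lemmas sol_c_def = center_sol_def[of a w \<xi> \<eta>]

lemma ell_dom: "u \<in> ell r \<Longrightarrow> \<bar>r\<bar> \<le> \<xi> \<Longrightarrow> u \<in> conv_dom a"
  using a conv_dom_ell by blast

lemma parts_dom: assumes "u \<in> xspace \<xi>" shows "pos_part u \<in> conv_dom a" "neg_part u \<in> conv_dom a"
  using assms \<eta> unfolding xspace_iff by (auto intro: ell_dom)

lemma xspace_dom: "u \<in> xspace \<xi> \<Longrightarrow> u \<in> conv_dom a"
  using conv_dom_add(1)[OF parts_dom, of u u] by (simp add: pos_neg_part)

lemma xspace_closed:
  assumes "u \<in> xspace \<xi>" "v \<in> xspace \<xi>"
  shows "(\<lambda>n. u n + v n) \<in> xspace \<xi>" "(\<lambda>n. u n - v n) \<in> xspace \<xi>" "(\<lambda>n. c * u n) \<in> xspace \<xi>"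
  using assms unfolding xspace_iff by (auto simp: part_simps intro: ell_add ell_diff ell_scale)

lemma sol_closed:
  assumes "u \<in> sol" "v \<in> sol"
  shows "(\<lambda>n. u n + v n) \<in> sol" "(\<lambda>n. u n - v n) \<in> sol" "(\<lambda>n. c * u n) \<in> sol"
  using assms xspace_closed[of u v] xspace_dom
  by (auto simp: sol_def pconv_add pconv_diff pconv_scale)

lemma zero_sol: "(\<lambda>_. 0) \<in> sol"
  by (simp add: sol_def pconv_zero xspace_def)

lemma zero_parts: "pos_part (\<lambda>_. 0) = (\<lambda>_. 0)" "neg_part (\<lambda>_. 0) = (\<lambda>_. 0)"
  by (auto simp: pos_part_def neg_part_def)

lemma sol_s_closed: assumes "u \<in> sol_s" "v \<in> sol_s"
  shows "(\<lambda>n. u n + v n) \<in> sol_s" "(\<lambda>n. u n - v n) \<in> sol_s" "(\<lambda>n. c * u n) \<in> sol_s"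
  using assms sol_closed[of u v] by (auto simp: sol_s_def part_simps intro: ell_add ell_diff ell_scale)

lemma sol_u_closed: assumes "u \<in> sol_u" "v \<in> sol_u"
  shows "(\<lambda>n. u n + v n) \<in> sol_u" "(\<lambda>n. u n - v n) \<in> sol_u" "(\<lambda>n. c * u n) \<in> sol_u"
  using assms sol_closed[of u v] by (auto simp: sol_u_def part_simps intro: ell_add ell_diff ell_scale)

lemma sol_c_closed: assumes "u \<in> sol_c" "v \<in> sol_c"
  shows "(\<lambda>n. u n + v n) \<in> sol_c" "(\<lambda>n. u n - v n) \<in> sol_c" "(\<lambda>n. c * u n) \<in> sol_c"
  using assms sol_closed[of u v] by (auto simp: sol_c_def part_simps intro: ell_add ell_diff ell_scale)

lemma zero_sols: "(\<lambda>_. 0) \<in> sol_s" "(\<lambda>_. 0) \<in> sol_u" "(\<lambda>_. 0) \<in> sol_c"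
  by (auto simp: sol_s_def sol_u_def sol_c_def zero_sol zero_parts)

text \<open>A bound for the operator at the weights -\<xi> and \<xi> at once. The potential enters
  only through \<delta>, so the resulting constants are the same for all \<theta>.\<close>

definition source_bound :: real where "source_bound = enorm (- \<xi>) a + enorm \<xi> a + \<delta>"

lemma \<delta>_nonneg: "\<delta> \<ge> 0"
  using w[of 0] norm_ge_zero order_trans by blast

lemma source_bound_nonneg: "source_bound \<ge> 0"
  using \<delta>_nonneg by (simp add: source_bound_def)

lemma pconv_ell: assumes "u \<in> ell r" "\<bar>r\<bar> \<le> \<xi>"
  shows "pconv a w u \<in> ell r" "enorm r (pconv a w u) \<le> (enorm r a + \<delta>) * enorm r u"
proof -
  note c = conv_ell[OF a[OF assms(2)] assms(1)] conv_enorm[OF a[OF assms(2)] assms(1)]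
  note m = ell_mult_bounded[OF assms(1) w]
  show "pconv a w u \<in> ell r" unfolding pconv_def by (intro ell_add c m)
  have "enorm r (pconv a w u) \<le> enorm r (conv a u) + enorm r (\<lambda>n. w n * u n)"
    unfolding pconv_def by (rule ell_add(2)[OF c(1) m(1)])
  also have "\<dots> \<le> enorm r a * enorm r u + \<delta> * enorm r u" using c m by (intro add_mono) auto
  finally show "enorm r (pconv a w u) \<le> (enorm r a + \<delta>) * enorm r u" by (simp add: algebra_simps)
qed

text \<open>Cutting a solution at the origin produces the same source, up to sign, from either half;
  the source therefore decays in both directions.\<close>

lemma source:
  assumes u: "u \<in> sol"
  shows "pconv a w (neg_part u) = (\<lambda>n. - pconv a w (pos_part u) n)"
    and "\<bar>r\<bar> \<le> \<xi> \<Longrightarrow> pconv a w (pos_part u) \<in> ell r \<and> enorm r (pconv a w (pos_part u)) \<le> source_bound * xnorm \<xi> u"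
proof -
  have X: "u \<in> xspace \<xi>" and eq: "pconv a w u = (\<lambda>_. 0)" using u by (auto simp: sol_def)
  have p: "pos_part u \<in> ell (- \<xi>)" and n: "neg_part u \<in> ell \<xi>" using X by (auto simp: xspace_iff)
  have \<xi>: "\<bar>- \<xi>\<bar> \<le> \<xi>" "\<bar>\<xi>\<bar> \<le> \<xi>" using \<eta> by auto
  have "(\<lambda>n. pconv a w (pos_part u) n + pconv a w (neg_part u) n) = (\<lambda>_. 0)"
    using pconv_add[OF parts_dom[OF X], of w] eq by (simp add: pos_neg_part)
  thus s: "pconv a w (neg_part u) = (\<lambda>n. - pconv a w (pos_part u) n)"
    by (auto simp: fun_eq_iff eq_neg_iff_add_eq_0 add.commute)
  let ?f = "pconv a w (pos_part u)"
  have f1: "?f \<in> ell (- \<xi>)" "enorm (- \<xi>) ?f \<le> (enorm (- \<xi>) a + \<delta>) * enorm (- \<xi>) (pos_part u)"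
    using pconv_ell[OF p \<xi>(1)] by auto
  have "?f = (\<lambda>n. - pconv a w (neg_part u) n)" by (simp add: s)
  hence f2: "?f \<in> ell \<xi>" "enorm \<xi> ?f \<le> (enorm \<xi> a + \<delta>) * enorm \<xi> (neg_part u)"
    using pconv_ell[OF n \<xi>(2)] ell_minus(1)[of "pconv a w (neg_part u)" \<xi>] ell_minus(2)[of \<xi> "pconv a w (neg_part u)"] by auto
  show "?f \<in> ell r \<and> enorm r ?f \<le> source_bound * xnorm \<xi> u" if "\<bar>r\<bar> \<le> \<xi>"
  proof -
    have "enorm r ?f \<le> enorm (- \<xi>) ?f + enorm \<xi> ?f" "?f \<in> ell r"
      using ell_between[OF f1(1) f2(1), of r] that by auto
    moreover have "enorm (- \<xi>) ?f + enorm \<xi> ?f \<le> source_bound * enorm (- \<xi>) (pos_part u) + source_bound * enorm \<xi> (neg_part u)"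
      using f1(2) f2(2) by (intro add_mono order_trans[OF f1(2)] order_trans[OF f2(2)] mult_right_mono) (auto simp: source_bound_def)
    ultimately show ?thesis by (simp add: xnorm_eq[OF X] algebra_simps)
  qed
qed

text \<open>These p and q are B_s f and B_u f for the source f of u, with norms controlled by the
  norm of u in X_\<xi>.\<close>

lemma solver:
  assumes "u \<in> sol"
  obtains p q where "p \<in> ell \<eta>" "p \<in> ell (2 * \<eta>)" "pconv a w p = pconv a w (pos_part u)"
    "enorm \<eta> p + enorm (2 * \<eta>) p \<le> 2 * K * source_bound * xnorm \<xi> u"
    "q \<in> ell (- \<eta>)" "q \<in> ell (- 2 * \<eta>)" "pconv a w q = pconv a w (pos_part u)"
    "enorm (- \<eta>) q + enorm (- 2 * \<eta>) q \<le> 2 * K * source_bound * xnorm \<xi> u"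
proof -
  let ?f = "pconv a w (pos_part u)"
  have K: "K > 0" using solve_s by (simp add: complemented_def)
  have f: "?f \<in> ell r" "enorm r ?f \<le> source_bound * xnorm \<xi> u" if "r \<in> {\<eta>, 2 * \<eta>, - \<eta>, - 2 * \<eta>}" for r
    using source(2)[OF assms, of r] that \<eta> by auto
  have fs: "?f \<in> ell \<eta>" "?f \<in> ell (2 * \<eta>)" "?f \<in> ell (- 2 * \<eta>)" "?f \<in> ell (- \<eta>)" using f(1) by blast+
  obtain p where p: "p \<in> ell \<eta>" "p \<in> ell (2 * \<eta>)" "pconv a w p = ?f" "enorm2 \<eta> (2 * \<eta>) p \<le> K * enorm2 \<eta> (2 * \<eta>) ?f"
    using complementedD[OF solve_s fs(1,2)] by (metis (no_types, lifting) add.right_neutral lessThan_0 sum.empty ext)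
  obtain q where q: "q \<in> ell (- \<eta>)" "q \<in> ell (- 2 * \<eta>)" "pconv a w q = ?f" "enorm2 (- 2 * \<eta>) (- \<eta>) q \<le> K * enorm2 (- 2 * \<eta>) (- \<eta>) ?f"
    using complementedD[OF solve_u fs(3,4)] by (metis (no_types, lifting) add.right_neutral lessThan_0 sum.empty ext)
  have "K * enorm2 \<eta> (2 * \<eta>) ?f \<le> K * (2 * (source_bound * xnorm \<xi> u))" "K * enorm2 (- 2 * \<eta>) (- \<eta>) ?f \<le> K * (2 * (source_bound * xnorm \<xi> u))"
    using K f(2)[of \<eta>] f(2)[of "2 * \<eta>"] f(2)[of "- \<eta>"] f(2)[of "- 2 * \<eta>"]
    by (auto simp: enorm2_def intro!: mult_left_mono)
  with p q show thesis by (intro that[of p q]) (auto simp: enorm2_def algebra_simps)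
qed

lemma decomposition:
  assumes u: "u \<in> sol"
  shows "\<exists>x\<in>sol_u. \<exists>y\<in>sol_c. \<exists>z\<in>sol_s. u = (\<lambda>n. x n + y n + z n)"
proof -
  obtain p q where p: "p \<in> ell \<eta>" "p \<in> ell (2 * \<eta>)" "pconv a w p = pconv a w (pos_part u)"
    and q: "q \<in> ell (- \<eta>)" "q \<in> ell (- 2 * \<eta>)" "pconv a w q = pconv a w (pos_part u)"
    using solver[OF u] by metis
  have X: "u \<in> xspace \<xi>" using u by (auto simp: sol_def)
  have P: "pos_part u \<in> ell (- \<xi>)" and N: "neg_part u \<in> ell \<xi>" using X by (auto simp: xspace_iff)
  have pd: "p \<in> conv_dom a" and qd: "q \<in> conv_dom a" using ell_dom[OF p(1)] ell_dom[OF q(1)] \<eta> by auto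
  have pp: "pos_part p \<in> ell r" if "r \<le> 2 * \<eta>" for r
    using pos_part_mono(1)[OF part_ell(1)[OF p(2)] that] .
  have np: "neg_part p \<in> ell r" if "r \<ge> \<eta>" for r
    using neg_part_mono(1)[OF part_ell(3)[OF p(1)] that] .
  have pq: "pos_part q \<in> ell r" if "r \<le> - \<eta>" for r
    using pos_part_mono(1)[OF part_ell(1)[OF q(1)] that] .
  have nq: "neg_part q \<in> ell r" if "r \<ge> - 2 * \<eta>" for r
    using neg_part_mono(1)[OF part_ell(3)[OF q(2)] that] .
  note parts = pp np pq nq P N
  \<comment> \<open>Both terms have the same image, so the difference is a solution. Its negative
    half is that of -q, which has the rate 2 \<eta> demanded of an unstable solution.\<close>
  have "(\<lambda>n. pos_part u n - q n) \<in> sol_u"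
    using \<eta> unfolding sol_u_def sol_def xspace_iff mem_Collect_eq pconv_diff[OF parts_dom(1)[OF X] qd]
    by (auto simp: q(3) part_simps intro!: ell_diff ell_minus parts)
  moreover have "(\<lambda>n. neg_part u n + p n) \<in> sol_s"
    using \<eta> unfolding sol_s_def sol_def xspace_iff mem_Collect_eq pconv_add[OF parts_dom(2)[OF X] pd]
    by (auto simp: p(3) part_simps source(1)[OF u] intro!: ell_add parts)
  moreover have "(\<lambda>n. q n - p n) \<in> sol_c"
    using \<eta> unfolding sol_c_def sol_def xspace_iff mem_Collect_eq pconv_diff[OF qd pd]
    by (auto simp: p(3) q(3) part_simps intro!: ell_diff parts)
  moreover have "u = (\<lambda>n. (pos_part u n - q n) + (q n - p n) + (neg_part u n + p n))"
    using pos_neg_part[of u] by (auto simp: fun_eq_iff)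
  ultimately show ?thesis by (intro bexI)
qed

text \<open>At -\<infinity> the stable summand equals minus the other two and hence lies in
  \<open>ell \<eta>\<close> there; it does so at +\<infinity> by definition, and injectivity makes
  it zero. The same argument at weight -\<eta> then removes the unstable summand.\<close>

lemma independent:
  assumes x: "x \<in> sol_u" and y: "y \<in> sol_c" and z: "z \<in> sol_s"
    and sum: "(\<lambda>n. x n + y n + z n) = (\<lambda>_. 0)"
  shows "x = (\<lambda>_. 0)" "y = (\<lambda>_. 0)" "z = (\<lambda>_. 0)"
proof -
  have s: "x n + y n + z n = 0" for n using fun_cong[OF sum, of n] by simp
  have np: "neg_part z = (\<lambda>n. - 1 * (neg_part x n + neg_part y n))"
    using s by (auto simp: neg_part_def fun_eq_iff algebra_simps eq_neg_iff_add_eq_0)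
  have "neg_part x \<in> ell \<eta>" "neg_part y \<in> ell \<eta>"
    using x y neg_part_mono(1)[of x "- 2 * \<eta>" \<eta>] \<eta> by (auto simp: sol_u_def sol_c_def)
  hence "neg_part z \<in> ell \<eta>" unfolding np by (intro ell_scale ell_add)
  moreover have "pos_part z \<in> ell \<eta>"
    using z pos_part_mono(1)[of z "2 * \<eta>" \<eta>] \<eta> by (auto simp: sol_s_def)
  ultimately have "z \<in> ell \<eta>" by (rule ell_parts[rotated])
  thus z0: "z = (\<lambda>_. 0)" by (rule inj_s) (use z in \<open>auto simp: sol_s_def sol_def\<close>)
  have s': "x n = - 1 * y n" for n using s[of n] z0 by (simp add: eq_neg_iff_add_eq_0)
  have pp: "pos_part x = (\<lambda>n. - 1 * pos_part y n)"
    using s' by (auto simp: pos_part_def fun_eq_iff)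
  have "pos_part y \<in> ell (- \<eta>)" using y by (auto simp: sol_c_def)
  hence "pos_part x \<in> ell (- \<eta>)" unfolding pp by (intro ell_scale)
  moreover have "neg_part x \<in> ell (- \<eta>)"
    using x neg_part_mono(1)[of x "- 2 * \<eta>" "- \<eta>"] \<eta> by (auto simp: sol_u_def)
  ultimately have "x \<in> ell (- \<eta>)" by (rule ell_parts)
  thus x0: "x = (\<lambda>_. 0)" by (rule inj_u) (use x in \<open>auto simp: sol_u_def sol_def\<close>)
  show "y = (\<lambda>_. 0)" using s' x0 by (auto simp: fun_eq_iff)
qed

lemma unique_s: assumes "u \<in> ell \<eta>" "v \<in> ell \<eta>" "pconv a w u = pconv a w v" shows "u = v"
proof -
  have "u \<in> conv_dom a" "v \<in> conv_dom a" using ell_dom[of _ \<eta>] assms \<eta> by auto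
  hence "pconv a w (\<lambda>n. u n - v n) = (\<lambda>_. 0)"
    using assms(3) by (simp add: pconv_diff)
  hence "(\<lambda>n. u n - v n) = (\<lambda>_. 0)"
    by (rule inj_s[OF ell_diff(1)[OF assms(1,2)]])
  thus ?thesis by (auto simp: fun_eq_iff)
qed

lemma unique_u: assumes "u \<in> ell (- \<eta>)" "v \<in> ell (- \<eta>)" "pconv a w u = pconv a w v" shows "u = v"
proof -
  have "u \<in> conv_dom a" "v \<in> conv_dom a" using ell_dom[of _ "- \<eta>"] assms \<eta> by auto
  hence "pconv a w (\<lambda>n. u n - v n) = (\<lambda>_. 0)"
    using assms(3) by (simp add: pconv_diff)
  hence "(\<lambda>n. u n - v n) = (\<lambda>_. 0)"
    by (rule inj_u[OF ell_diff(1)[OF assms(1,2)]])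
  thus ?thesis by (auto simp: fun_eq_iff)
qed

lemma pconv_minus: "pconv a w (\<lambda>n. - u n) = (\<lambda>n. - pconv a w u n)"
  by (simp add: pconv_def conv_minus_right)

lemma neg_part_source: assumes "u \<in> sol" "pconv a w v = pconv a w (pos_part u)"
  shows "pconv a w (\<lambda>n. - neg_part u n) = pconv a w v"
  using assms source(1)[OF assms(1)] by (simp add: pconv_minus)

text \<open>Membership in a space turns into a uniform estimate: the positive half lies in
  \<open>ell \<eta>\<close> and solves the equation for B_s f, so by uniqueness it is B_s f and
  inherits its bound.\<close>

lemma sol_s_bound: assumes u: "u \<in> sol_s" shows "enorm (2 * \<eta>) (pos_part u) \<le> 2 * K * source_bound * xnorm \<xi> u"
proof -
  have us: "u \<in> sol" using u by (simp add: sol_s_def)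
  obtain p where p: "p \<in> ell \<eta>" "pconv a w p = pconv a w (pos_part u)" "enorm \<eta> p + enorm (2 * \<eta>) p \<le> 2 * K * source_bound * xnorm \<xi> u"
    using solver[OF us] by metis
  have "pos_part u \<in> ell \<eta>" using u pos_part_mono(1)[of u "2 * \<eta>" \<eta>] \<eta> by (auto simp: sol_s_def)
  hence "pos_part u = p" by (rule unique_s[OF _ p(1) p(2)[symmetric]])
  with p(3) show ?thesis using order_trans[of "enorm (2 * \<eta>) p" "enorm \<eta> p + enorm (2 * \<eta>) p"] by simp
qed

lemma sol_u_bound: assumes u: "u \<in> sol_u" shows "enorm (- 2 * \<eta>) (neg_part u) \<le> 2 * K * source_bound * xnorm \<xi> u"
proof -
  have us: "u \<in> sol" using u by (simp add: sol_u_def)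
  obtain q where q: "q \<in> ell (- \<eta>)" "pconv a w q = pconv a w (pos_part u)" "enorm (- \<eta>) q + enorm (- 2 * \<eta>) q \<le> 2 * K * source_bound * xnorm \<xi> u"
    using solver[OF us] by metis
  have "neg_part u \<in> ell (- \<eta>)" using u neg_part_mono(1)[of u "- 2 * \<eta>" "- \<eta>"] \<eta> by (auto simp: sol_u_def)
  hence "(\<lambda>n. - neg_part u n) = q" by (rule unique_u[OF ell_minus(1) q(1) neg_part_source[OF us q(2)]])
  with q(3) show ?thesis
    using order_trans[of "enorm (- 2 * \<eta>) q" "enorm (- \<eta>) q + enorm (- 2 * \<eta>) q"] ell_minus(2)[of "- 2 * \<eta>" "neg_part u"] by simp
qed

text \<open>For a center solution the positive half is B_u f and the negative half is -B_s f, by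
  uniqueness at the weights -\<eta> and \<eta>.\<close>

lemma sol_c_bound: assumes u: "u \<in> sol_c"
  shows "enorm (- \<eta>) (pos_part u) \<le> 2 * K * source_bound * xnorm \<xi> u" "enorm \<eta> (neg_part u) \<le> 2 * K * source_bound * xnorm \<xi> u"
proof -
  have us: "u \<in> sol" and uc: "pos_part u \<in> ell (- \<eta>)" "neg_part u \<in> ell \<eta>" using u by (auto simp: sol_c_def)
  obtain p q where p: "p \<in> ell \<eta>" "pconv a w p = pconv a w (pos_part u)" "enorm \<eta> p + enorm (2 * \<eta>) p \<le> 2 * K * source_bound * xnorm \<xi> u"
    and q: "q \<in> ell (- \<eta>)" "pconv a w q = pconv a w (pos_part u)" "enorm (- \<eta>) q + enorm (- 2 * \<eta>) q \<le> 2 * K * source_bound * xnorm \<xi> u"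
    using solver[OF us] by metis
  have "pos_part u = q" by (rule unique_u[OF uc(1) q(1) q(2)[symmetric]])
  with q(3) show "enorm (- \<eta>) (pos_part u) \<le> 2 * K * source_bound * xnorm \<xi> u"
    using order_trans[of "enorm (- \<eta>) q" "enorm (- \<eta>) q + enorm (- 2 * \<eta>) q"] by simp
  have "(\<lambda>n. - neg_part u n) = p" by (rule unique_s[OF ell_minus(1)[OF uc(2)] p(1) neg_part_source[OF us p(2)]])
  with p(3) show "enorm \<eta> (neg_part u) \<le> 2 * K * source_bound * xnorm \<xi> u"
    using order_trans[of "enorm \<eta> p" "enorm \<eta> p + enorm (2 * \<eta>) p"] ell_minus(2)[of \<eta> "neg_part u"] by simp
qed

lemma K_pos: "K > 0"
  using compl by (simp add: complemented_def)

lemma opnorm_bounds: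
  fixes n :: nat
  shows "fiber_opnorm \<xi> (shift (int n)) sol_s \<le> (4 * K * source_bound + 1) * exp (- 2 * \<eta>) ^ n"
    and "fiber_opnorm \<xi> (shift (- int n)) sol_u \<le> (4 * K * source_bound + 1) * exp (2 * \<eta>) powi (- int n)"
    and "fiber_opnorm \<xi> (shift (int n)) sol_c \<le> (4 * K * source_bound + 1) * exp \<eta> ^ n"
    and "fiber_opnorm \<xi> (shift (- int n)) sol_c \<le> (4 * K * source_bound + 1) * exp (- \<eta>) powi (- int n)"
proof -
  define M where "M = 2 * K * source_bound"
  have M: "M \<ge> 0" using K_pos source_bound_nonneg by (simp add: M_def)
  have MC: "4 * K * source_bound + 1 = 2 * M + 1" by (simp add: M_def)
  have M1: "M * x \<le> M" if "x \<le> 1" for x using mult_left_mono[OF that M] by simp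
  have parts: "pos_part u \<in> ell (- \<xi>)" "neg_part u \<in> ell \<xi>" "enorm (- \<xi>) (pos_part u) \<le> 1" "enorm \<xi> (neg_part u) \<le> 1"
    if "u \<in> sol" "xnorm \<xi> u \<le> 1" for u
  proof -
    have X: "u \<in> xspace \<xi>" using that by (simp add: sol_def)
    thus "pos_part u \<in> ell (- \<xi>)" "neg_part u \<in> ell \<xi>" by (auto simp: xspace_iff)
    have "A \<le> 1" "B \<le> 1" if "A + B \<le> 1" "A \<ge> 0" "B \<ge> 0" for A B :: real using that by auto
    from this[OF that(2)[unfolded xnorm_eq[OF X]] enorm_nonneg enorm_nonneg]
    show "enorm (- \<xi>) (pos_part u) \<le> 1" "enorm \<xi> (neg_part u) \<le> 1" by auto
  qed
  \<comment> \<open>All four rates are brought to the form e^(-\<kappa>) of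
    \<open>xnorm_shift_le\<close>; the double minus in the center rates is \<kappa> = -\<eta>
    n.\<close>
  have exps: "exp (- 2 * \<eta>) ^ n = exp (- (2 * \<eta> * n))" "exp (2 * \<eta>) powi (- int n) = exp (- (2 * \<eta> * n))"
    "exp \<eta> ^ n = exp (- (- (\<eta> * n)))" "exp (- \<eta>) powi (- int n) = exp (- (- (\<eta> * n)))"
    by (simp_all add: exp_power_int mult_ac flip: exp_of_nat_mult)
  show "fiber_opnorm \<xi> (shift (int n)) sol_s \<le> (4 * K * source_bound + 1) * exp (- 2 * \<eta>) ^ n"
    unfolding MC exps
  proof (rule fiber_opnorm_le[OF zero_sols(1)])
    fix u assume u: "u \<in> sol_s" "xnorm \<xi> u \<le> 1"
    hence us: "u \<in> sol" and up: "pos_part u \<in> ell (2 * \<eta>)" by (auto simp: sol_s_def)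
    note P = parts[OF us u(2)]
    have "xnorm \<xi> (shift (int n) u) \<le> exp (- (2 * \<eta> * n)) * (enorm (2 * \<eta>) (pos_part u) + enorm \<xi> (neg_part u))"
    proof (rule xnorm_shift_le[OF up P(2)])
      fix j :: real assume "j \<ge> 0"
      \<comment> \<open>Since \<xi> >= 2 \<eta>, the tent with peak at n lies below the line of
        slope 2 \<eta> through that peak; the value of this line at 0 is the gain -2 \<eta>
        n.\<close>
      have "- \<xi> * \<bar>j - n\<bar> \<le> - (2 * \<eta>) * \<bar>j - n\<bar>" using \<eta> by (intro mult_right_mono) auto
      also have "\<dots> \<le> 2 * \<eta> * (j - n)"
        using mult_left_mono[of "- \<bar>j - n\<bar>" "j - n" "2 * \<eta>"] \<eta> by simp
      finally show "- \<xi> * \<bar>j - real_of_int (int n)\<bar> \<le> - (2 * \<eta> * n) + 2 * \<eta> * j" by (simp add: algebra_simps)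
    next
      fix j :: real assume j: "j \<le> 0"
      have "2 * \<eta> * n \<le> \<xi> * n" using \<eta> by (intro mult_right_mono) auto
      moreover have "\<bar>j - real_of_int (int n)\<bar> = n - j" using j by simp
      ultimately show "- \<xi> * \<bar>j - real_of_int (int n)\<bar> \<le> - (2 * \<eta> * n) + \<xi> * j"
        by (simp only:) (simp add: algebra_simps)
    qed
    also have "\<dots> \<le> exp (- (2 * \<eta> * n)) * (2 * M + 1)"
      using order_trans[OF sol_s_bound[OF u(1), folded M_def] M1[OF u(2)]] P(4) M by (intro mult_left_mono) auto
    finally show "xnorm \<xi> (shift (int n) u) \<le> (2 * M + 1) * exp (- (2 * \<eta> * n))" by (simp add: mult.commute)
  qed
  show "fiber_opnorm \<xi> (shift (- int n)) sol_u \<le> (4 * K * source_bound + 1) * exp (2 * \<eta>) powi (- int n)"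
    unfolding MC exps
  proof (rule fiber_opnorm_le[OF zero_sols(2)])
    fix u assume u: "u \<in> sol_u" "xnorm \<xi> u \<le> 1"
    hence us: "u \<in> sol" and up: "neg_part u \<in> ell (- 2 * \<eta>)" by (auto simp: sol_u_def)
    note P = parts[OF us u(2)]
    have "xnorm \<xi> (shift (- int n) u) \<le> exp (- (2 * \<eta> * n)) * (enorm (- \<xi>) (pos_part u) + enorm (- 2 * \<eta>) (neg_part u))"
    proof (rule xnorm_shift_le[OF P(1) up])
      fix j :: real assume j: "j \<ge> 0"
      have "2 * \<eta> * n \<le> \<xi> * n" using \<eta> by (intro mult_right_mono) auto
      moreover have "\<bar>j - real_of_int (- int n)\<bar> = j + n" using j by simp
      ultimately show "- \<xi> * \<bar>j - real_of_int (- int n)\<bar> \<le> - (2 * \<eta> * n) + - \<xi> * j"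
        by (simp only:) (simp add: algebra_simps)
    next
      fix j :: real assume "j \<le> 0"
      have "- \<xi> * \<bar>j + n\<bar> \<le> - (2 * \<eta>) * \<bar>j + n\<bar>" using \<eta> by (intro mult_right_mono) auto
      also have "\<dots> \<le> 2 * \<eta> * (- (j + n))"
        using mult_left_mono[of "- \<bar>j + n\<bar>" "- (j + n)" "2 * \<eta>"] \<eta> by simp
      finally show "- \<xi> * \<bar>j - real_of_int (- int n)\<bar> \<le> - (2 * \<eta> * n) + - 2 * \<eta> * j" by (simp add: algebra_simps)
    qed
    also have "\<dots> \<le> exp (- (2 * \<eta> * n)) * (2 * M + 1)"
      using order_trans[OF sol_u_bound[OF u(1), folded M_def] M1[OF u(2)]] P(3) M by (intro mult_left_mono) auto
    finally show "xnorm \<xi> (shift (- int n) u) \<le> (2 * M + 1) * exp (- (2 * \<eta> * n))" by (simp add: mult.commute)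
  qed
  have center: "xnorm \<xi> (shift k u) \<le> (2 * M + 1) * exp (- (- (\<eta> * n)))"
    if u: "u \<in> sol_c" "xnorm \<xi> u \<le> 1" and k: "\<bar>k\<bar> = int n" for u k
  proof -
    have up: "pos_part u \<in> ell (- \<eta>)" "neg_part u \<in> ell \<eta>" using u by (auto simp: sol_c_def)
    \<comment> \<open>By the triangle inequality a shift by n in either direction costs at most
      e^(\<eta> n) against the weight e^(-\<eta>|j|).\<close>
    have *: "- \<xi> * \<bar>j - real_of_int k\<bar> \<le> \<eta> * n - \<eta> * \<bar>j\<bar>" for j
    proof -
      have "- \<xi> * \<bar>j - real_of_int k\<bar> \<le> - \<eta> * \<bar>j - real_of_int k\<bar>" using \<eta> by (intro mult_right_mono) auto
      also have "\<dots> \<le> - \<eta> * (\<bar>j\<bar> - n)" using \<eta> k by (intro mult_left_mono_neg) auto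
      finally show ?thesis by (simp add: algebra_simps)
    qed
    have "xnorm \<xi> (shift k u) \<le> exp (- (- (\<eta> * n))) * (enorm (- \<eta>) (pos_part u) + enorm \<eta> (neg_part u))"
    proof (rule xnorm_shift_le[OF up])
      fix j :: real
      show "- \<xi> * \<bar>j - real_of_int k\<bar> \<le> - (- (\<eta> * n)) + - \<eta> * j" if "j \<ge> 0"
        using *[of j] that by simp
      show "- \<xi> * \<bar>j - real_of_int k\<bar> \<le> - (- (\<eta> * n)) + \<eta> * j" if "j \<le> 0"
        using *[of j] that by simp
    qed
    also have "\<dots> \<le> exp (- (- (\<eta> * n))) * (2 * M + 1)"
      using order_trans[OF sol_c_bound(1)[OF u(1), folded M_def] M1[OF u(2)]]
        order_trans[OF sol_c_bound(2)[OF u(1), folded M_def] M1[OF u(2)]] by (intro mult_left_mono) auto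
    finally show ?thesis by (simp add: mult.commute)
  qed
  show "fiber_opnorm \<xi> (shift (int n)) sol_c \<le> (4 * K * source_bound + 1) * exp \<eta> ^ n"
    unfolding MC exps by (rule fiber_opnorm_le[OF zero_sols(3) center]) auto
  show "fiber_opnorm \<xi> (shift (- int n)) sol_c \<le> (4 * K * source_bound + 1) * exp (- \<eta>) powi (- int n)"
    unfolding MC exps by (rule fiber_opnorm_le[OF zero_sols(3) center]) auto
qed

section \<open>A frame of the center space from a complement of the range\<close>

context
  fixes p q :: "nat \<Rightarrow> int \<Rightarrow> complex"
  assumes p: "\<And>j. j < d \<Longrightarrow> p j \<in> ell \<eta>" "\<And>j. j < d \<Longrightarrow> pconv a w (p j) = e j"
    and q: "\<And>j. j < d \<Longrightarrow> q j \<in> ell (- \<eta>)" "\<And>j. j < d \<Longrightarrow> pconv a w (q j) = e j"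
begin

private lemma doms: "j < d \<Longrightarrow> p j \<in> conv_dom a" "j < d \<Longrightarrow> q j \<in> conv_dom a"
  using ell_dom[OF p(1), of j] ell_dom[OF q(1), of j] \<eta> by auto

text \<open>B_u e_j and B_s e_j have the same image. They enter as arbitrary solutions p and q at
  the two weights, so that solutions with coordinates in the function algebra can be
  inserted.\<close>

lemma center_frame_in: assumes j: "j < d" shows "(\<lambda>n. q j n - p j n) \<in> sol_c"
proof -
  have "pos_part (p j) \<in> ell r" if "r \<le> \<eta>" for r
    using pos_part_mono(1)[OF part_ell(1)[OF p(1)[OF j]] that] .
  moreover have "neg_part (p j) \<in> ell r" if "r \<ge> \<eta>" for r
    using neg_part_mono(1)[OF part_ell(3)[OF p(1)[OF j]] that] .
  moreover have "pos_part (q j) \<in> ell r" if "r \<le> - \<eta>" for r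
    using pos_part_mono(1)[OF part_ell(1)[OF q(1)[OF j]] that] .
  moreover have "neg_part (q j) \<in> ell r" if "r \<ge> - \<eta>" for r
    using neg_part_mono(1)[OF part_ell(3)[OF q(1)[OF j]] that] .
  ultimately show ?thesis
    using \<eta> unfolding sol_c_def sol_def xspace_iff mem_Collect_eq pconv_diff[OF doms(2)[OF j] doms(1)[OF j]]
    by (auto simp: p(2)[OF j] q(2)[OF j] part_simps intro!: ell_diff)
qed

text \<open>Split the source as f = A v + sum c_j e_j. Since v lies in both weighted spaces, B_u and
  B_s both return v on A v, and it cancels in B_u f - B_s f = u.\<close>

lemma center_frame_span: assumes u: "u \<in> sol_c"
  shows "\<exists>c. u = (\<lambda>n. \<Sum>j<d. c j * (q j n - p j n))"
proof -
  have us: "u \<in> sol" and uc: "pos_part u \<in> ell (- \<eta>)" "neg_part u \<in> ell \<eta>" using u by (auto simp: sol_c_def)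
  let ?f = "pconv a w (pos_part u)"
  have "?f \<in> ell (- \<eta>) \<inter> ell \<eta>" using source(2)[OF us, of \<eta>] source(2)[OF us, of "- \<eta>"] \<eta> by auto
  then obtain v c where v: "v \<in> ell (- \<eta>)" "v \<in> ell \<eta>" and f: "?f = (\<lambda>n. pconv a w v n + (\<Sum>j<d. c j * e j n))"
    using complementedD[OF compl] by blast
  have vd: "v \<in> conv_dom a" using ell_dom[OF v(2)] \<eta> by auto
  have "pos_part u = (\<lambda>n. v n + (\<Sum>j<d. c j * q j n))"
  proof (rule unique_u[OF uc(1)])
    show "(\<lambda>n. v n + (\<Sum>j<d. c j * q j n)) \<in> ell (- \<eta>)"
      by (intro ell_add v ell_sum ell_scale q) auto
    have "pconv a w (\<lambda>n. v n + (\<Sum>j<d. c j * q j n)) = (\<lambda>n. pconv a w v n + pconv a w (\<lambda>n. \<Sum>j<d. c j * q j n) n)"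
      by (intro pconv_add vd conv_dom_sum) (auto intro: doms)
    also have "pconv a w (\<lambda>n. \<Sum>j<d. c j * q j n) = (\<lambda>n. \<Sum>j<d. c j * e j n)"
      by (subst pconv_sum) (auto intro: doms simp: q)
    finally show "?f = pconv a w (\<lambda>n. v n + (\<Sum>j<d. c j * q j n))" by (simp add: f)
  qed
  moreover have "(\<lambda>n. - neg_part u n) = (\<lambda>n. v n + (\<Sum>j<d. c j * p j n))"
  proof (rule unique_s[OF ell_minus(1)[OF uc(2)]])
    show "(\<lambda>n. v n + (\<Sum>j<d. c j * p j n)) \<in> ell \<eta>"
      by (intro ell_add v ell_sum ell_scale p) auto
    have "pconv a w (\<lambda>n. v n + (\<Sum>j<d. c j * p j n)) = (\<lambda>n. pconv a w v n + pconv a w (\<lambda>n. \<Sum>j<d. c j * p j n) n)"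
      by (intro pconv_add vd conv_dom_sum) (auto intro: doms)
    also have "pconv a w (\<lambda>n. \<Sum>j<d. c j * p j n) = (\<lambda>n. \<Sum>j<d. c j * e j n)"
      by (subst pconv_sum) (auto intro: doms simp: p)
    finally show "pconv a w (\<lambda>n. - neg_part u n) = pconv a w (\<lambda>n. v n + (\<Sum>j<d. c j * p j n))"
      by (simp add: f[symmetric] neg_part_source[OF us])
  qed
  ultimately have "u = (\<lambda>n. (v n + (\<Sum>j<d. c j * q j n)) - (v n + (\<Sum>j<d. c j * p j n)))"
    using pos_neg_part[of u] by (metis (no_types, lifting) ext diff_minus_eq_add)
  also have "\<dots> = (\<lambda>n. \<Sum>j<d. c j * (q j n - p j n))"
    by (simp add: right_diff_distrib sum_subtractf)
  finally show ?thesis by blast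
qed

text \<open>A vanishing combination means that the sums of c_j q_j and of c_j p_j are one sequence
  v, which then decays in both directions. So sum c_j e_j = A v is in the range, against the choice
  of the \<open>e j\<close>.\<close>

lemma center_frame_independent:
  assumes eq: "(\<lambda>n. \<Sum>j<d. c j * (q j n - p j n)) = (\<lambda>_. 0)" and j: "j < d"
  shows "c j = 0"
proof -
  define v where "v = (\<lambda>n. \<Sum>j<d. c j * q j n)"
  have v2: "v = (\<lambda>n. \<Sum>j<d. c j * p j n)"
    using eq by (simp add: v_def right_diff_distrib sum_subtractf fun_eq_iff)
  have vu: "v \<in> ell (- \<eta>)" unfolding v_def by (intro ell_sum ell_scale q) auto
  have vs: "v \<in> ell \<eta>" unfolding v2 by (intro ell_sum ell_scale p) auto
  have "pconv a w v = (\<lambda>n. \<Sum>j<d. c j * e j n)"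
    unfolding v_def by (subst pconv_sum) (auto intro: doms simp: q)
  hence "(\<lambda>n. pconv a w v n + (\<Sum>j<d. (- c j) * e j n)) = (\<lambda>_. 0)" by (simp add: sum_negf)
  from complemented_injD(2)[OF compl vu vs this j] have "- c j = 0" .
  thus ?thesis by simp
qed

end

end

subsection \<open>The kernel of an analytic symbol\<close>


lemma complemented_mono:
  assumes "complemented s t A d e K" "K \<le> K'" shows "complemented s t A d e K'"
proof -
  have "K * enorm2 s t y \<le> K' * enorm2 s t y" for y using assms(2) by (intro mult_right_mono) auto
  with assms show ?thesis unfolding complemented_def by (meson less_le_trans order_trans)
qed

text \<open>The long-range operator sums \<open>v k * u (n + k)\<close>, so it is convolution with the reflected Fourier coefficients.\<close>

definition refl_seq :: "(int \<Rightarrow> complex) \<Rightarrow> int \<Rightarrow> complex" where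
  "refl_seq u = (\<lambda>n. u (- n))"

lemma refl_seq_refl_seq [simp]: "refl_seq (refl_seq u) = u"
  by (simp add: refl_seq_def)

lemma refl_seq_ell: "refl_seq u \<in> ell r \<longleftrightarrow> u \<in> ell (- r)"
  and enorm_refl_seq: "enorm r (refl_seq u) = enorm (- r) u"
proof -
  have eq: "(\<lambda>n. cmod (refl_seq u n) * wt r n) = (\<lambda>n. (\<lambda>m. cmod (u m) * wt (- r) m) (- n))"
    by (simp add: refl_seq_def wt_def)
  have b: "bij_betw uminus UNIV (UNIV :: int set)" by (rule bij_uminus)
  show "refl_seq u \<in> ell r \<longleftrightarrow> u \<in> ell (- r)"
    unfolding ell_def mem_Collect_eq eq by (rule summable_on_reindex_bij_betw[OF b])
  show "enorm r (refl_seq u) = enorm (- r) u"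
    unfolding enorm_def eq by (rule infsum_reindex_bij_betw[OF b])
qed

lemma conv_refl_seq: "conv (refl_seq a) (refl_seq b) = refl_seq (conv a b)"
proof
  fix n
  show "conv (refl_seq a) (refl_seq b) n = refl_seq (conv a b) n"
    unfolding conv_def refl_seq_def
    by (rule infsum_reindex_bij_witness[of _ uminus uminus]) auto
qed

text \<open>Reflection reverses the weights and commutes with convolution. The analysis can thus be
  done for V - E itself, where the zeros are counted, and transferred to the reflected kernel of the
  operator.\<close>

lemma complemented_refl:
  assumes C: "complemented s t (conv a) d e K"
  shows "complemented (- t) (- s) (conv (refl_seq a)) d (\<lambda>j. refl_seq (e j)) K"
proof -
  have mem: "refl_seq v \<in> ell (- t) \<inter> ell (- s) \<longleftrightarrow> v \<in> ell s \<inter> ell t" for v by (auto simp: refl_seq_ell)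
  have nrm: "enorm2 (- t) (- s) (refl_seq v) = enorm2 s t v" for v by (simp add: enorm2_def enorm_refl_seq)
  have R: "(\<lambda>n. conv (refl_seq a) (refl_seq v) n + (\<Sum>j<d. c j * refl_seq (e j) n))
     = refl_seq (\<lambda>n. conv a v n + (\<Sum>j<d. c j * e j n))" for v c
    unfolding conv_refl_seq by (simp add: refl_seq_def)
  show ?thesis
    unfolding complemented_def
  proof (intro conjI allI ballI impI)
    show "K > 0" using C by (simp add: complemented_def)
    show "refl_seq (e j) \<in> ell (- t) \<inter> ell (- s)" if "j < d" for j
      using C that unfolding mem by (simp add: complemented_def)
  next
    fix y assume y: "y \<in> ell (- t) \<inter> ell (- s)"
    hence "refl_seq y \<in> ell s" "refl_seq y \<in> ell t" by (auto simp: refl_seq_ell)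
    from complementedD[OF C this] obtain v c where v: "v \<in> ell s" "v \<in> ell t"
      "refl_seq y = (\<lambda>n. conv a v n + (\<Sum>j<d. c j * e j n))"
      "enorm2 s t v + (\<Sum>j<d. cmod (c j)) \<le> K * enorm2 s t (refl_seq y)" by blast
    have "y = (\<lambda>n. conv (refl_seq a) (refl_seq v) n + (\<Sum>j<d. c j * refl_seq (e j) n))"
      unfolding R v(3)[symmetric] by simp
    moreover have "refl_seq v \<in> ell (- t) \<inter> ell (- s)" unfolding mem using v by auto
    moreover have "enorm2 s t (refl_seq y) = enorm2 (- t) (- s) y" using nrm[of "refl_seq y"] by simp
    ultimately show "\<exists>v\<in>ell (- t) \<inter> ell (- s). \<exists>c. y = (\<lambda>n. conv (refl_seq a) v n + (\<Sum>j<d. c j * refl_seq (e j) n)) \<and>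
       enorm2 (- t) (- s) v + (\<Sum>j<d. cmod (c j)) \<le> K * enorm2 (- t) (- s) y"
      using v(4) nrm[of v] by (intro bexI[of _ "refl_seq v"] exI[of _ c]) auto
  next
    fix v c assume v: "v \<in> ell (- t) \<inter> ell (- s)"
      and eq: "(\<lambda>n. conv (refl_seq a) v n + (\<Sum>j<d. c j * refl_seq (e j) n)) = (\<lambda>_. 0)"
    have "refl_seq (\<lambda>n. conv a (refl_seq v) n + (\<Sum>j<d. c j * e j n)) = (\<lambda>_. 0)"
      using eq R[of "refl_seq v" c] by simp
    hence "(\<lambda>n. conv a (refl_seq v) n + (\<Sum>j<d. c j * e j n)) = refl_seq (\<lambda>_. 0)"
      by (metis refl_seq_refl_seq)
    hence eq': "(\<lambda>n. conv a (refl_seq v) n + (\<Sum>j<d. c j * e j n)) = (\<lambda>_. 0)"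
      by (simp add: refl_seq_def)
    have "refl_seq v \<in> ell s \<inter> ell t" using v by (auto simp: refl_seq_ell)
    with C eq' have *: "refl_seq v = (\<lambda>_. 0) \<and> (\<forall>j<d. c j = 0)" unfolding complemented_def by blast
    show "c j = 0" if "j < d" for j using * that by blast
    have "refl_seq (refl_seq v) = refl_seq (\<lambda>_. 0)" using * by simp
    thus "v = (\<lambda>_. 0)" by (simp add: refl_seq_def)
  qed
qed

text \<open>A nonzero holomorphic function has finitely many zeros in the compact annulus |ln |z||
  <= \<xi>, so those off the unit circle keep a positive distance from it.\<close>

lemma exists_zero_gap:
  assumes "0 < \<xi>" "\<xi> < h" and hol: "f holomorphic_on ann (- h) h" and nz: "\<exists>z\<in>ann (- h) h. f z \<noteq> 0"
  shows "\<exists>\<eta>>0. 3 * \<eta> \<le> \<xi> \<and> (\<forall>z\<in>ann (- 3 * \<eta>) (3 * \<eta>). f z = 0 \<longrightarrow> cmod z = 1)"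
proof -
  define K where "K = {z. exp (- \<xi>) \<le> cmod z \<and> cmod z \<le> exp \<xi>}"
  have K: "compact K" "K \<subseteq> ann (- h) h"
  proof -
    have "K = cball 0 (exp \<xi>) - ball 0 (exp (- \<xi>))" by (auto simp: K_def)
    thus "compact K" by (simp add: compact_diff)
    have "exp (- h) < exp (- \<xi>)" "exp \<xi> < exp h" using assms(2) by auto
    note * = less_le_trans[OF this(1)] le_less_trans[OF _ this(2)]
    show "K \<subseteq> ann (- h) h" unfolding K_def ann_def by (auto intro: *)
  qed
  have "finite {z\<in>K. f z = 0}"
  proof (cases "f constant_on ann (- h) h")
    case True
    then obtain c where "\<And>z. z \<in> ann (- h) h \<Longrightarrow> f z = c" by (auto simp: constant_on_def)
    with nz K(2) have E: "{z\<in>K. f z = 0} = {}" by auto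
    show ?thesis unfolding E by simp
  next
    case False
    thus ?thesis by (intro holomorphic_compact_finite_zeros[OF hol open_ann connected_ann K])
  qed
  \<comment> \<open>Including \<xi> keeps the set nonempty when there are no zeros off the circle
    and forces 3 \<eta> <= \<xi>.\<close>
  define S where "S = insert \<xi> ((\<lambda>z. \<bar>ln (cmod z)\<bar>) ` {z\<in>K. f z = 0 \<and> cmod z \<noteq> 1})"
  have S: "finite S" "S \<noteq> {}"
    unfolding S_def using \<open>finite {z\<in>K. f z = 0}\<close> by (auto intro: finite_subset[rotated])
  have cpos: "cmod z > 0" if "z \<in> K" for z using annD(1) K(2) that by auto
  have "\<And>s. s \<in> S \<Longrightarrow> s > 0" using assms(1) cpos by (auto simp: S_def)
  hence m: "Min S > 0" using S by simp
  \<comment> \<open>Division by 3 places both rates \<eta> and 2 \<eta> strictly inside the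
    zero-free ranges of ln |z|.\<close>
  define \<eta> where "\<eta> = Min S / 3"
  have \<eta>: "3 * \<eta> = Min S" by (simp add: \<eta>_def)
  show ?thesis
  proof (intro exI[of _ \<eta>] conjI ballI impI)
    show "\<eta> > 0" using m by (simp add: \<eta>_def)
    show "3 * \<eta> \<le> \<xi>" unfolding \<eta> using S by (intro Min_le) (auto simp: S_def)
    fix z assume z: "z \<in> ann (- 3 * \<eta>) (3 * \<eta>)" "f z = 0"
    have l: "\<bar>ln (cmod z)\<bar> < Min S" using annD(2,3)[OF z(1)] \<eta> by auto
    also have "Min S \<le> \<xi>" using S by (intro Min_le) (auto simp: S_def)
    finally have "- \<xi> \<le> ln (cmod z)" "ln (cmod z) \<le> \<xi>" by auto
    hence "z \<in> K" unfolding K_def using annD(4)[OF z(1)] by (metis (mono_tags, lifting) exp_le_cancel_iff mem_Collect_eq)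
    show "cmod z = 1"
    proof (rule ccontr)
      assume "cmod z \<noteq> 1"
      hence "\<bar>ln (cmod z)\<bar> \<in> S" using \<open>z \<in> K\<close> z(2) by (auto simp: S_def)
      thus False using l S Min_le by fastforce
    qed
  qed
qed

text \<open>Three inversions: of a outside the circle, of a inside it, and of the factor that
  remains on the whole annulus once the circle zeros are split off. The pairs with equal weights
  carry the uniqueness at a single weight.\<close>

theorem kernel_dichotomy:
  assumes \<xi>: "0 < \<xi>" "\<xi> < h" and a: "\<And>r. - h < r \<Longrightarrow> r < h \<Longrightarrow> a \<in> ell r"
    and nz: "\<exists>z\<in>ann (- h) h. symb a z \<noteq> 0"
  shows "\<exists>\<eta> K e gs gu. \<eta> > 0 \<and> 2 * \<eta> < \<xi> \<and>
     complemented \<eta> (2 * \<eta>) (conv a) 0 e K \<and> complemented (- 2 * \<eta>) (- \<eta>) (conv a) 0 e K \<and>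
     complemented \<eta> \<eta> (conv a) 0 e K \<and> complemented (- \<eta>) (- \<eta>) (conv a) 0 e K \<and>
     complemented (- \<eta>) \<eta> (conv a) (circle_order (symb a)) e K \<and>
     gs \<in> ell \<eta> \<and> conv a gs = kdelta \<and> gu \<in> ell (- \<eta>) \<and> conv a gu = kdelta"
proof -
  have hol: "symb a holomorphic_on ann (- h) h" by (rule symb_holomorphic[OF a])
  obtain \<eta> where \<eta>: "\<eta> > 0" "3 * \<eta> \<le> \<xi>" and zeros: "\<And>z. z \<in> ann (- 3 * \<eta>) (3 * \<eta>) \<Longrightarrow> symb a z = 0 \<Longrightarrow> cmod z = 1"
    using exists_zero_gap[OF \<xi> hol nz] by auto
  have aR: "a \<in> ell r" if "- 3 * \<eta> \<le> r" "r \<le> 3 * \<eta>" for r using a[of r] that \<eta> \<xi> by auto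
  have in_ann: "z \<in> ann (- 3 * \<eta>) (3 * \<eta>)" if "z \<in> ann s t" "- 3 * \<eta> \<le> s" "t \<le> 3 * \<eta>" for z s t
    using annI[OF annD(4)[OF that(1)], of "- 3 * \<eta>" "3 * \<eta>"] annD(2,3)[OF that(1)] that(2,3) by linarith
  have nz_s: "symb a z \<noteq> 0" if "z \<in> ann 0 (3 * \<eta>)" for z
    using zeros[OF in_ann[OF that]] annD(2)[OF that] \<eta>(1) by auto
  have nz_u: "symb a z \<noteq> 0" if "z \<in> ann (- 3 * \<eta>) 0" for z
    using zeros[OF in_ann[OF that]] annD(3)[OF that] \<eta>(1) by auto
  have as: "a \<in> ell r" if "0 < r" "r < 3 * \<eta>" for r using aR[of r] that \<eta>(1) by simp
  have au: "a \<in> ell r" if "- 3 * \<eta> < r" "r < 0" for r using aR[of r] that \<eta>(1) by simp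
  have lt: "0 < 3 * \<eta>" "- 3 * \<eta> < 0" "- (3 * \<eta>) < 3 * \<eta>" using \<eta>(1) by auto
  obtain gs where gs: "\<And>r. 0 < r \<Longrightarrow> r < 3 * \<eta> \<Longrightarrow> gs \<in> ell r" "conv a gs = kdelta"
    using inverse_kernel[OF lt(1) as nz_s] by blast
  obtain gu where gu: "\<And>r. - 3 * \<eta> < r \<Longrightarrow> r < 0 \<Longrightarrow> gu \<in> ell r" "conv a gu = kdelta"
    using inverse_kernel[OF lt(2) au nz_u] by blast
  have nz': "\<exists>z\<in>ann (- (3 * \<eta>)) (3 * \<eta>). symb a z \<noteq> 0"
  proof -
    have "complex_of_real (exp \<eta>) \<in> ann (- (3 * \<eta>)) (3 * \<eta>)" using \<eta> by (auto simp: ann_def)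
    moreover have "symb a (complex_of_real (exp \<eta>)) \<noteq> 0"
      using zeros[of "complex_of_real (exp \<eta>)"] calculation \<eta> by auto
    ultimately show ?thesis by blast
  qed
  have aR': "a \<in> ell r" if "- (3 * \<eta>) < r" "r < 3 * \<eta>" for r using aR[of r] that by simp
  obtain zs q where zs: "a = mult_lins zs q" "length zs = circle_order (symb a)" "\<forall>z\<in>set zs. cmod z = 1"
    and q': "\<forall>r. - (3 * \<eta>) < r \<longrightarrow> r < 3 * \<eta> \<longrightarrow> q \<in> ell r" "\<forall>z. cmod z = 1 \<longrightarrow> symb q z \<noteq> 0"
    using circle_factorization[OF lt(1) aR' nz'] by blast
  have q: "\<And>r. - (3 * \<eta>) < r \<Longrightarrow> r < 3 * \<eta> \<Longrightarrow> q \<in> ell r" using q'(1) by blast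
  have nz_q: "symb q z \<noteq> 0" if z: "z \<in> ann (- (3 * \<eta>)) (3 * \<eta>)" for z
  proof
    assume 0: "symb q z = 0"
    have "symb a z = (\<Prod>z'\<leftarrow>zs. z - z') * symb q z"
      unfolding zs(1) using annD(2,3,4)[OF z] by (intro symb_mult_lins q) auto
    hence "cmod z = 1" using zeros[of z] z 0 by simp
    thus False using q'(2) 0 by blast
  qed
  obtain g where g: "\<And>r. - (3 * \<eta>) < r \<Longrightarrow> r < 3 * \<eta> \<Longrightarrow> g \<in> ell r" "conv q g = kdelta"
    using inverse_kernel[OF lt(3) q nz_q] by blast
  obtain e Kc where C: "complemented (- \<eta>) \<eta> (conv a) (circle_order (symb a)) e Kc"
    using complemented_mult_lins[of "- \<eta>" \<eta> zs q g] zs \<eta> q[of \<eta>] q[of "- \<eta>"] g(1)[of \<eta>] g(1)[of "- \<eta>"] g(2)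
    by auto
  \<comment> \<open>A sum of positive terms, so that one constant dominates those of all five
    statements.\<close>
  define K where "K = Kc + (1 + enorm2 \<eta> (2 * \<eta>) gs) + (1 + enorm2 (- 2 * \<eta>) (- \<eta>) gu) + (1 + enorm2 \<eta> \<eta> gs)
      + (1 + enorm2 (- \<eta>) (- \<eta>) gu)"
  have Kc: "Kc > 0" using C by (simp add: complemented_def)
  have s: "complemented s t (conv a) 0 e (1 + enorm2 s t gs)" if "s \<in> {\<eta>, 2 * \<eta>}" "t \<in> {\<eta>, 2 * \<eta>}" for s t
    by (rule complemented_inverse) (use that \<eta> aR gs in auto)
  have u: "complemented s t (conv a) 0 e (1 + enorm2 s t gu)" if "s \<in> {- \<eta>, - 2 * \<eta>}" "t \<in> {- \<eta>, - 2 * \<eta>}" for s t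
    by (rule complemented_inverse) (use that \<eta> aR gu in auto)
  have le: "Kc \<le> K" "1 + enorm2 \<eta> (2 * \<eta>) gs \<le> K" "1 + enorm2 (- 2 * \<eta>) (- \<eta>) gu \<le> K"
    "1 + enorm2 \<eta> \<eta> gs \<le> K" "1 + enorm2 (- \<eta>) (- \<eta>) gu \<le> K"
    using Kc by (auto simp: K_def intro!: add_increasing add_increasing2)
  have "gs \<in> ell \<eta>" "gu \<in> ell (- \<eta>)" using gs(1)[of \<eta>] gu(1)[of "- \<eta>"] \<eta> by auto
  with gs(2) gu(2) \<eta> show ?thesis
    by (intro exI[of _ \<eta>] exI[of _ K] exI[of _ e] exI[of _ gs] exI[of _ gu] conjI
        complemented_mono[OF s le(2)] complemented_mono[OF u le(3)] complemented_mono[OF s le(4)] complemented_mono[OF u le(5)]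
        complemented_mono[OF C le(1)]) auto
qed

section \<open>Parity of the number of zeros on the circle\<close>

lemma no_circle_sqrt:
  fixes s :: "complex \<Rightarrow> complex"
  assumes cont: "continuous_on (sphere 0 1) s" and sq: "\<And>z. cmod z = 1 \<Longrightarrow> (s z)\<^sup>2 * z = \<kappa>" and \<kappa>: "\<kappa> \<noteq> 0"
  shows False
proof -
  \<comment> \<open>Along the circle the half-angle factor makes the square constant. By
    connectedness \<phi> is then constant, yet \<open>cis (t / 2)\<close> changes sign over one full
    turn.\<close>
  define \<phi> where "\<phi> t = s (cis t) * cis (t / 2)" for t :: real
  have c: "continuous_on {0..2*pi} \<phi>"
    unfolding \<phi>_def by (intro continuous_intros continuous_on_compose2[OF cont]) auto
  have \<phi>2: "(\<phi> t)\<^sup>2 = \<kappa>" for t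
  proof -
    have "(cis (t / 2))\<^sup>2 = cis t" by (simp add: power2_eq_square cis_mult)
    thus ?thesis using sq[of "cis t"] by (simp only: \<phi>_def power_mult_distrib) simp
  qed
  have "\<phi> t = csqrt \<kappa> \<or> \<phi> t = - csqrt \<kappa>" for t
    using \<phi>2[of t] power2_csqrt[of \<kappa>] power2_eq_iff by metis
  hence "\<phi> ` {0..2*pi} \<subseteq> {csqrt \<kappa>, - csqrt \<kappa>}" by auto
  hence "finite (\<phi> ` {0..2*pi})" by (rule finite_subset) simp
  moreover have "connected (\<phi> ` {0..2*pi})" using c by (intro connected_continuous_image) auto
  ultimately obtain y where y: "\<phi> ` {0..2*pi} \<subseteq> {y}"
    using connected_finite_iff_sing[of "\<phi> ` {0..2*pi}"] by auto
  have "\<phi> 0 \<in> \<phi> ` {0..2*pi}" "\<phi> (2 * pi) \<in> \<phi> ` {0..2*pi}" by auto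
  hence "\<phi> 0 = \<phi> (2 * pi)" using y by (metis singletonD subsetD)
  moreover have "\<phi> (2 * pi) = - \<phi> 0" by (simp add: \<phi>_def)
  ultimately have "\<phi> 0 = 0" by simp
  thus False using \<phi>2[of 0] \<kappa> by simp
qed

text \<open>Write the symbol as P Q with P the product of the n linear factors. Comparing it with
  its conjugate on the circle gives Q z^n = c cnj Q with c nonzero; for odd n this would produce a
  continuous square root of c / z there.\<close>

lemma even_circle_order:
  assumes R: "R > 0" and a: "\<And>r. - R < r \<Longrightarrow> r < R \<Longrightarrow> a \<in> ell r"
    and nz: "\<exists>z\<in>ann (-R) R. symb a z \<noteq> 0" and real: "\<And>z. cmod z = 1 \<Longrightarrow> symb a z \<in> \<real>"
  shows "even (circle_order (symb a))"
proof (rule ccontr)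
  assume odd: "odd (circle_order (symb a))"
  obtain zs q where zs: "a = mult_lins zs q" "length zs = circle_order (symb a)" "\<And>z. z \<in> set zs \<Longrightarrow> cmod z = 1"
    and q: "\<And>r. - R < r \<Longrightarrow> r < R \<Longrightarrow> q \<in> ell r" "\<And>z. cmod z = 1 \<Longrightarrow> symb q z \<noteq> 0"
    using circle_factorization[OF R a nz] by blast
  define Q where "Q = symb q"
  define P where "P z = (\<Prod>z'\<leftarrow>zs. z - z')" for z
  define c where "c = (\<Prod>z'\<leftarrow>zs. - (1 / z'))"
  define n where "n = length zs"
  have sub: "sphere 0 1 \<subseteq> ann (- R) R" using R by (auto simp: ann_def)
  have Qc: "continuous_on (sphere 0 1) Q"
    unfolding Q_def by (rule holomorphic_on_imp_continuous_on, rule holomorphic_on_subset[OF symb_holomorphic[OF q(1)] sub]) auto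
  have sa: "symb a z = P z * Q z" if "cmod z = 1" for z
    unfolding zs(1) P_def Q_def using that R by (intro symb_mult_lins[of _ 0] q(1)) auto
  \<comment> \<open>For unimodular z and w, cnj (z - w) z = -(1 / w) (z - w); the constant c
    collects the factors -(1 / w).\<close>
  have cnjP: "cnj (P z) * z ^ n = c * P z" if z: "cmod z = 1" for z
  proof -
    have "cnj (\<Prod>z'\<leftarrow>ws. z - z') * z ^ length ws = (\<Prod>z'\<leftarrow>ws. - (1 / z')) * (\<Prod>z'\<leftarrow>ws. z - z')"
      if "\<And>z'. z' \<in> set ws \<Longrightarrow> cmod z' = 1" for ws
      using that
    proof (induction ws)
      case (Cons w ws)
      have w: "cmod w = 1" using Cons.prems by simp
      have "cnj (z - w) * z = - (1 / w) * (z - w)"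
      proof -
        have 1: "cnj z * z = 1" "cnj w * w = 1" using z w by (metis complex_norm_square mult.commute of_real_1 power_one)+
        moreover have w0: "w \<noteq> 0" using w by auto
        ultimately have "cnj w = 1 / w" by (simp add: field_simps)
        thus ?thesis using 1 w0 by (simp add: algebra_simps diff_divide_distrib)
      qed
      moreover have "cnj (\<Prod>z'\<leftarrow>ws. z - z') * z ^ length ws = (\<Prod>z'\<leftarrow>ws. - (1 / z')) * (\<Prod>z'\<leftarrow>ws. z - z')"
        using Cons by auto
      moreover have "cnj (\<Prod>z'\<leftarrow>w # ws. z - z') * z ^ length (w # ws) = (cnj (z - w) * z) * (cnj (\<Prod>z'\<leftarrow>ws. z - z') * z ^ length ws)"
        by simp
      ultimately show ?case by (simp only:) simp
    qed simp
    from this[of zs] zs(3) show ?thesis by (simp add: P_def c_def n_def)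
  qed
  have c0: "c \<noteq> 0"
    unfolding c_def using zs(3) by (auto simp: prod_list_zero_iff) (metis norm_zero zero_neq_one)
  have eq: "Q z * z ^ n = c * cnj (Q z)" if z: "cmod z = 1" "z \<notin> set zs" for z
  proof -
    have "P z \<noteq> 0" using z(2) by (auto simp: P_def prod_list_zero_iff)
    have "cnj (P z * Q z) = P z * Q z"
      using real[OF z(1)] sa[OF z(1)] by (simp add: Reals_cnj_iff)
    hence "P z * Q z * z ^ n = (cnj (P z) * z ^ n) * cnj (Q z)" by (simp add: mult_ac)
    also have "\<dots> = P z * (c * cnj (Q z))" by (simp add: cnjP[OF z(1)] mult_ac)
    finally show ?thesis using \<open>P z \<noteq> 0\<close> by (simp add: mult.assoc)
  qed
  \<comment> \<open>The identity was obtained by dividing by P and so holds off its finitely many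
    zeros. The circle has no isolated points, and both sides are continuous.\<close>
  have eq': "Q z * z ^ n = c * cnj (Q z)" if z: "cmod z = 1" for z
  proof -
    define S where "S = sphere (0::complex) 1"
    define D where "D z = Q z * z ^ n - c * cnj (Q z)" for z
    have Dc: "continuous_on S D" unfolding D_def S_def by (intro continuous_intros Qc)
    have "z islimpt S"
    proof (rule connected_imp_perfect)
      show "connected S" unfolding S_def by (rule connected_sphere) simp
      show "z \<in> S" using z by (simp add: S_def)
      show "S \<noteq> {x}" for x
      proof
        assume "S = {x}"
        moreover have "1 \<in> S" "-1 \<in> S" by (auto simp: S_def)
        ultimately show False by auto
      qed
    qed
    hence "z islimpt (set zs \<union> (S - set zs))" by (rule islimpt_subset) auto
    hence l: "z islimpt (S - set zs)" by (rule iffD1[OF islimpt_Un_finite[OF finite_set]])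
    have "(D \<longlongrightarrow> D z) (at z within S)" using Dc z by (auto simp: continuous_on_def S_def)
    hence "(D \<longlongrightarrow> D z) (at z within (S - set zs))" by (rule tendsto_within_subset) auto
    moreover have "\<forall>\<^sub>F x in at z within (S - set zs). D x = 0"
      using eq by (auto simp: eventually_at_filter D_def S_def)
    hence "(D \<longlongrightarrow> 0) (at z within (S - set zs))" by (rule tendsto_eventually)
    ultimately have "D z = 0" using l by (metis tendsto_unique trivial_limit_within)
    thus ?thesis by (simp add: D_def)
  qed
  obtain k where k: "n = 2 * k + 1" using odd zs(2) by (auto simp: n_def elim: oddE)
  have Q0: "Q z \<noteq> 0" if "cmod z = 1" for z using q(2)[OF that] by (simp add: Q_def)
  \<comment> \<open>Multiplying the identity by Q gives Q^2 z^n = c |Q|^2. With n = 2 k + 1, the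
    function z^k Q / |Q| is a square root of c / z on the circle.\<close>
  show False
  proof (rule no_circle_sqrt[of "\<lambda>z. z ^ k * Q z / complex_of_real (cmod (Q z))" c])
    show "continuous_on (sphere 0 1) (\<lambda>z. z ^ k * Q z / complex_of_real (cmod (Q z)))"
      by (intro continuous_intros Qc) (use Q0 in auto)
    show "c \<noteq> 0" by (rule c0)
    fix z :: complex assume z: "cmod z = 1"
    have "z ^ n = z ^ k * z ^ k * z" by (simp add: k mult_2 power_add)
    hence "(z ^ k * Q z)\<^sup>2 * z = (Q z * z ^ n) * Q z"
      by (simp add: power2_eq_square mult_ac)
    also have "\<dots> = c * (Q z * cnj (Q z))" by (simp add: eq'[OF z] mult_ac)
    also have "Q z * cnj (Q z) = (complex_of_real (cmod (Q z)))\<^sup>2" by (metis complex_norm_square of_real_power)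
    finally show "(z ^ k * Q z / complex_of_real (cmod (Q z)))\<^sup>2 * z = c"
      using Q0[OF z] by (simp add: power_divide)
  qed
qed

subsection \<open>Fourier coefficients\<close>


definition fexp :: "int \<Rightarrow> real \<Rightarrow> complex" where
  "fexp n x = exp (2 * pi * \<i> * of_int n * of_real x)"

lemma fexp_add: "fexp (m + n) x = fexp m x * fexp n x"
  by (simp add: fexp_def algebra_simps flip: exp_add)

lemma fexp_0 [simp]: "fexp 0 x = 1"
  by (simp add: fexp_def)

lemma norm_fexp [simp]: "cmod (fexp n x) = 1"
  by (simp add: fexp_def)

lemma cnj_fexp: "cnj (fexp n x) = fexp (- n) x"
  by (simp add: fexp_def exp_cnj)

lemma continuous_on_fexp [continuous_intros]: "continuous_on S (fexp n)"
  unfolding fexp_def by (intro continuous_intros)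

lemma fourier_coeff_fexp: "fourier_coeff V n = integral {0..1} (\<lambda>x. complex_of_real (V x) * fexp (- n) x)"
  by (simp add: fourier_coeff_def fexp_def)

lemma integral_fexp: assumes "n \<noteq> 0" shows "integral {0..1} (fexp n) = 0"
proof -
  define c where "c = 2 * pi * \<i> * of_int n"
  have c: "c \<noteq> 0" using assms by (simp add: c_def)
  have "(fexp n has_integral (exp (c * of_real 1) / c - exp (c * of_real 0) / c)) {0..1}"
  proof (rule fundamental_theorem_of_calculus)
    fix x :: real
    have "((\<lambda>z. exp (c * z) / c) has_field_derivative exp (c * of_real x)) (at (of_real x))"
      using c by (auto intro!: derivative_eq_intros)
    from has_vector_derivative_real_field[OF this]
    show "((\<lambda>x. exp (c * of_real x) / c) has_vector_derivative fexp n x) (at x within {0..1})"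
      by (simp add: fexp_def c_def)
  qed simp
  moreover have "exp c = 1"
    using exp_integer_2pi[of "of_int n"] by (simp add: c_def mult_ac)
  ultimately show ?thesis by (simp add: integral_unique)
qed

text \<open>Generating the trigonometric polynomials inductively lets the proofs follow the
  induction over \<open>real_polynomial_function\<close>, which the Stone-Weierstrass theorem
  delivers.\<close>

inductive trig_poly :: "(real \<Rightarrow> complex) \<Rightarrow> bool" where
  monom: "trig_poly (\<lambda>x. c * fexp n x)"
| add: "trig_poly f \<Longrightarrow> trig_poly g \<Longrightarrow> trig_poly (\<lambda>x. f x + g x)"

lemma trig_poly_mult:
  assumes "trig_poly f" "trig_poly g" shows "trig_poly (\<lambda>x. f x * g x)"
  using assms(1)
proof (induction f rule: trig_poly.induct)
  case (monom c n)
  from assms(2) show ?case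
  proof (induction g rule: trig_poly.induct)
    case (monom d m)
    have "(\<lambda>x. c * fexp n x * (d * fexp m x)) = (\<lambda>x. (c * d) * fexp (n + m) x)"
      by (simp add: fexp_add mult_ac)
    thus ?case using trig_poly.monom by metis
  next
    case (add f g)
    thus ?case using trig_poly.add[OF add.IH] by (simp add: ring_distribs)
  qed
next
  case (add f g)
  thus ?case using trig_poly.add[OF add.IH] by (simp add: ring_distribs)
qed

text \<open>A real linear functional on the plane is a combination of z and cnj z, and on the circle
  cnj z is the exponential of index -1.\<close>

lemma trig_poly_real_polynomial:
  assumes "real_polynomial_function p" shows "trig_poly (\<lambda>x. complex_of_real (p (fexp 1 x)))"
  using assms
proof (induction p rule: real_polynomial_function.induct)
  case (linear f)
  interpret bounded_linear f by (rule linear)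
  have "complex_of_real (f (fexp 1 x)) =
      ((of_real (f 1) - \<i> * of_real (f \<i>)) / 2) * fexp 1 x + ((of_real (f 1) + \<i> * of_real (f \<i>)) / 2) * fexp (- 1) x" for x
  proof -
    have fz: "f z = Re z * f 1 + Im z * f \<i>" for z
    proof -
      have "z = Re z *\<^sub>R 1 + Im z *\<^sub>R \<i>" by (simp add: complex_eq_iff)
      hence "f z = f (Re z *\<^sub>R 1 + Im z *\<^sub>R \<i>)" by simp
      thus ?thesis by (simp add: add scaleR)
    qed
    show ?thesis
      unfolding cnj_fexp[of 1 x, symmetric] fz[of "fexp 1 x"] by (simp add: complex_eq_iff algebra_simps diff_divide_distrib add_divide_distrib)
  qed
  thus ?case by (simp only:) (intro trig_poly.intros)
next
  case (const c)
  show ?case using trig_poly.monom[of "complex_of_real c" 0] by simp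
next
  case (add f g)
  thus ?case using trig_poly.add[OF add.IH] by simp
next
  case (mult f g)
  thus ?case using trig_poly_mult[OF mult.IH] by simp
qed

text \<open>The interval is compact, so the exponential is a quotient map onto the circle: the
  preimage of a closed set under G is the image of a compact part of the interval.\<close>

lemma continuous_on_circle_lift:
  fixes D :: "real \<Rightarrow> real"
  assumes D: "continuous_on {0..1} D" and per: "D 0 = D 1"
  obtains G where "continuous_on (sphere 0 1) G" "\<And>x. x \<in> {0..1} \<Longrightarrow> G (fexp 1 x) = D x"
proof -
  define G where "G z = D (Arg2pi z / (2 * pi))" for z
  have G: "G (fexp 1 x) = D x" if x: "x \<in> {0..1}" for x
  proof (cases "x = 1")
    case True
    have "fexp 1 1 = 1" using exp_two_pi_i by (simp add: fexp_def)
    moreover have "Arg2pi 1 = 0" by (rule Arg2pi_unique[of 1]) auto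
    ultimately show ?thesis using True per by (simp add: G_def)
  next
    case False
    have "Arg2pi (fexp 1 x) = 2 * pi * x"
      by (rule Arg2pi_unique[of 1]) (use x False in \<open>auto simp: fexp_def mult_ac\<close>)
    thus ?thesis by (simp add: G_def)
  qed
  have surj: "z \<in> fexp 1 ` {0..1}" if "cmod z = 1" for z
  proof
    show "z = fexp 1 (Arg2pi z / (2 * pi))"
      using complex_norm_eq_1_exp[of z] that by (simp add: fexp_def mult_ac)
    show "Arg2pi z / (2 * pi) \<in> {0..1}" using Arg2pi_ge_0[of z] Arg2pi_lt_2pi[of z] by (auto simp: field_simps)
  qed
  have "closed (G -` B \<inter> sphere 0 1)" if B: "closed B" for B
  proof -
    have "G -` B \<inter> sphere 0 1 = fexp 1 ` (D -` B \<inter> {0..1})"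
      using G surj by force
    moreover have "closed (D -` B \<inter> {0..1})"
      using D B by (simp add: continuous_on_closed_vimage)
    hence "compact (D -` B \<inter> {0..1})"
      by (metis compact_Icc compact_Int_closed inf.idem inf_commute inf_assoc)
    ultimately show ?thesis
      by (simp add: compact_imp_closed compact_continuous_image continuous_on_fexp)
  qed
  hence "continuous_on (sphere 0 1) G" by (simp add: continuous_on_closed_vimage)
  thus thesis using G that by blast
qed

text \<open>D is orthogonal to every trigonometric polynomial P, so the integral of D^2 equals that
  of D (D - P), and this is small when P approximates D uniformly.\<close>

lemma fourier_uniqueness:
  fixes D :: "real \<Rightarrow> real"
  assumes D: "continuous_on {0..1} D" and per: "D 0 = D 1"
    and F: "\<And>n. integral {0..1} (\<lambda>x. complex_of_real (D x) * fexp n x) = 0" and x: "x \<in> {0..1}"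
  shows "D x = 0"
proof -
  obtain G where G: "continuous_on (sphere 0 1) G" "\<And>x. x \<in> {0..1} \<Longrightarrow> G (fexp 1 x) = D x"
    using continuous_on_circle_lift[OF D per] by blast
  have trig0: "continuous_on {0..1} f \<and> integral {0..1} (\<lambda>x. complex_of_real (D x) * f x) = 0" if "trig_poly f" for f
    using that
  proof (induction f rule: trig_poly.induct)
    case (monom c n)
    have "integral {0..1} (\<lambda>x. complex_of_real (D x) * (c * fexp n x)) = c * integral {0..1} (\<lambda>x. complex_of_real (D x) * fexp n x)"
      by (subst integral_mult_right[symmetric]) (simp add: mult_ac)
    thus ?case by (auto simp: F intro!: continuous_intros)
  next
    case (add f g)
    have "integral {0..1} (\<lambda>x. complex_of_real (D x) * f x + complex_of_real (D x) * g x) = 0"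
      using add by (subst Henstock_Kurzweil_Integration.integral_add)
        (auto intro!: integrable_continuous_interval continuous_intros D)
    with add show ?case by (auto simp: ring_distribs intro!: continuous_intros)
  qed
  obtain M where M: "M > 0" "\<And>x. x \<in> {0..1} \<Longrightarrow> \<bar>D x\<bar> \<le> M"
  proof -
    have "bounded (D ` {0..1})" by (intro compact_imp_bounded compact_continuous_image D compact_Icc)
    then obtain b where "b > 0" "\<forall>y\<in>D ` {0..1}. norm y \<le> b" unfolding bounded_pos by blast
    thus ?thesis using that by auto
  qed
  have int2: "(\<lambda>x. (D x)\<^sup>2) integrable_on {0..1}"
    by (intro integrable_continuous_interval continuous_intros D)
  have small: "integral {0..1} (\<lambda>x. (D x)\<^sup>2) \<le> M * \<epsilon>" if \<epsilon>: "\<epsilon> > 0" for \<epsilon>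
  proof -
    obtain p where p: "real_polynomial_function p" "\<And>z. z \<in> sphere 0 1 \<Longrightarrow> \<bar>G z - p z\<bar> < \<epsilon>"
      using Stone_Weierstrass_real_polynomial_function[OF compact_sphere G(1) \<epsilon>] by blast
    define P where "P x = p (fexp 1 x)" for x
    have Pt: "trig_poly (\<lambda>x. complex_of_real (P x))"
      unfolding P_def by (rule trig_poly_real_polynomial[OF p(1)])
    have "continuous_on {0..1} (\<lambda>x. Re (complex_of_real (P x)))"
      using trig0[OF Pt] by (intro continuous_intros) auto
    hence Pc: "continuous_on {0..1} P" by simp
    have Pint: "(\<lambda>x. D x * P x) integrable_on {0..1}"
      by (intro integrable_continuous_interval continuous_intros D Pc)
    have "complex_of_real (integral {0..1} (\<lambda>x. D x * P x)) = integral {0..1} (complex_of_real \<circ> (\<lambda>x. D x * P x))"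
      by (rule integral_linear[OF Pint bounded_linear_of_real, symmetric])
    also have "\<dots> = 0" using trig0[OF Pt] by (simp add: o_def)
    finally have DP: "integral {0..1} (\<lambda>x. D x * P x) = 0" by simp
    have "integral {0..1} (\<lambda>x. (D x)\<^sup>2) = integral {0..1} (\<lambda>x. (D x)\<^sup>2 - D x * P x)"
      using DP by (subst Henstock_Kurzweil_Integration.integral_diff[OF int2 Pint]) simp
    also have "\<dots> \<le> integral {0..1} (\<lambda>x::real. M * \<epsilon>)"
    proof (rule integral_le)
      show "(\<lambda>x. (D x)\<^sup>2 - D x * P x) integrable_on {0..1}" by (intro integrable_diff int2 Pint)
      fix x :: real assume x: "x \<in> {0..1}"
      have "(D x)\<^sup>2 - D x * P x = D x * (D x - P x)" by (simp add: power2_eq_square algebra_simps)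
      also have "\<dots> \<le> \<bar>D x\<bar> * \<bar>D x - P x\<bar>" by (metis abs_ge_self abs_mult)
      also have "\<dots> \<le> M * \<epsilon>"
        using M(2)[OF x] M(1) p(2)[of "fexp 1 x"] G(2)[OF x] by (intro mult_mono) (auto simp: P_def)
      finally show "(D x)\<^sup>2 - D x * P x \<le> M * \<epsilon>" .
    qed auto
    finally show ?thesis by simp
  qed
  have "integral {0..1} (\<lambda>x. (D x)\<^sup>2) \<le> 0"
  proof (rule field_le_epsilon)
    fix e :: real assume "e > 0"
    thus "integral {0..1} (\<lambda>x. (D x)\<^sup>2) \<le> 0 + e" using small[of "e / M"] M(1) by simp
  qed
  moreover have "0 \<le> integral {0..1} (\<lambda>x. (D x)\<^sup>2)" by (intro integral_nonneg int2) auto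
  ultimately have "((\<lambda>x. (D x)\<^sup>2) has_integral 0) (cbox 0 1)"
    using integrable_integral[OF int2] by simp
  hence "(D x)\<^sup>2 = 0"
    by (rule has_integral_0_cbox_imp_0[rotated 2]) (use x D in \<open>auto intro!: continuous_intros\<close>)
  thus ?thesis by simp
qed

lemma circle_analytic_continuous:
  assumes "circle_analytic V" shows "continuous_on S V"
proof (rule continuous_at_imp_continuous_on, rule ballI)
  fix x0
  obtain a r where r: "r > 0" and a: "\<And>x. \<bar>x - x0\<bar> < r \<Longrightarrow> (\<lambda>n. a n * (x - x0) ^ n) sums V x"
    using assms unfolding circle_analytic_def by meson
  have "summable (\<lambda>n. a n * (r / 2) ^ n)"
    using a[of "x0 + r / 2"] r by (auto simp: sums_iff)
  hence "isCont (\<lambda>y. \<Sum>n. a n * y ^ n) (x0 - x0)" by (rule isCont_powser) (use r in auto)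
  moreover have "isCont (\<lambda>x. x - x0) x0" by (intro continuous_intros)
  ultimately have c: "isCont (\<lambda>x. \<Sum>n. a n * (x - x0) ^ n) x0" by (rule isCont_o2[rotated])
  have "\<forall>\<^sub>F x in nhds x0. V x = (\<Sum>n. a n * (x - x0) ^ n)"
    unfolding eventually_nhds_metric using r a by (auto simp: dist_real_def sums_iff)
  from isCont_cong[OF this] c show "isCont V x0" by simp
qed

text \<open>Otherwise V minus its mean has only vanishing Fourier coefficients and is zero by
  uniqueness. This is how non-constancy of V excludes that V - E vanishes identically.\<close>

lemma nonconstant_fourier_coeff:
  assumes V: "circle_analytic V" and nc: "\<not> V constant_on UNIV"
  shows "\<exists>n. n \<noteq> 0 \<and> fourier_coeff V n \<noteq> 0"
proof (rule ccontr)
  assume neg: "\<not> (\<exists>n. n \<noteq> 0 \<and> fourier_coeff V n \<noteq> 0)"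
  define c where "c = integral {0..1} V"
  define D where "D x = V x - c" for x
  have per: "V (x + 1) = V x" for x using V by (auto simp: circle_analytic_def)
  have Vc: "continuous_on {0..1} V" by (rule circle_analytic_continuous[OF V])
  have c: "complex_of_real c = fourier_coeff V 0"
    using integral_linear[OF integrable_continuous_interval[OF Vc] bounded_linear_of_real[where 'a=complex]]
    by (simp add: fourier_coeff_fexp c_def o_def)
  have "D x = 0" if "x \<in> {0..1}" for x
  proof (rule fourier_uniqueness[OF _ _ _ that])
    show "continuous_on {0..1} D" unfolding D_def by (intro continuous_intros Vc)
    show "D 0 = D 1" using per[of 0] by (simp add: D_def)
    fix n
    have "integral {0..1} (\<lambda>x. complex_of_real (D x) * fexp n x) =
       integral {0..1} (\<lambda>x. complex_of_real (V x) * fexp n x - complex_of_real c * fexp n x)"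
      by (simp add: D_def ring_distribs)
    also have "\<dots> = fourier_coeff V (- n) - complex_of_real c * integral {0..1} (fexp n)"
      by (subst Henstock_Kurzweil_Integration.integral_diff)
        (auto intro!: integrable_continuous_interval continuous_intros Vc simp: fourier_coeff_fexp)
    also have "\<dots> = 0"
    proof (cases "n = 0")
      case True
      have "fexp 0 = (\<lambda>_. 1)" by (simp add: fun_eq_iff)
      hence "integral {0..1} (fexp 0) = 1" by simp
      with True c show ?thesis by simp
    next
      case False
      hence "fourier_coeff V (- n) = 0" using neg by (metis neg_equal_0_iff_equal)
      with False show ?thesis by (simp add: integral_fexp)
    qed
    finally show "integral {0..1} (\<lambda>x. complex_of_real (D x) * fexp n x) = 0" .
  qed
  hence Vc: "V x = c" if "x \<in> {0..1}" for x using that by (simp add: D_def)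
  have perZ: "V (x + of_int k) = V x" for x k
  proof (induction k rule: int_induct[of _ 0])
    case (step1 i)
    thus ?case using per[of "x + of_int i"] by (simp add: add_ac)
  next
    case (step2 i)
    thus ?case using per[of "x + of_int (i - 1)"] by (simp add: add_ac)
  qed simp
  have "V x = c" for x
  proof -
    have "V x = V (frac x)" using perZ[of "frac x" "\<lfloor>x\<rfloor>"] by (simp add: frac_def)
    also have "\<dots> = c" by (rule Vc) (simp add: frac_ge_0 frac_lt_1 less_imp_le)
    finally show ?thesis .
  qed
  thus False using nc by (auto simp: constant_on_def)
qed

lemma cnj_fourier_coeff:
  assumes "continuous_on {0..1} V" shows "cnj (fourier_coeff V n) = fourier_coeff V (- n)"
proof -
  have "(\<lambda>x. complex_of_real (V x) * fexp (- n) x) integrable_on {0..1}"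
    by (intro integrable_continuous_interval continuous_intros assms)
  from integral_linear[OF this bounded_linear_cnj]
  show ?thesis by (simp add: fourier_coeff_fexp o_def cnj_fexp)
qed

section \<open>The Laurent kernel of V - E\<close>

definition energy_kernel :: "(real \<Rightarrow> real) \<Rightarrow> real \<Rightarrow> int \<Rightarrow> complex" where
  "energy_kernel V E = (\<lambda>n. fourier_coeff V n - of_real E * kdelta n)"

text \<open>Unordered summability of complex families is absolute, so the single point z = e^r
  already gives membership at weight r.\<close>

lemma laurent_analytic_ell:
  assumes L: "laurent_analytic V h" and r: "- h < r" "r < h"
  shows "fourier_coeff V \<in> ell r" "energy_kernel V E \<in> ell r"
proof -
  have z: "cmod (complex_of_real (exp r)) = exp r" by simp
  hence "complex_of_real (exp r) \<in> annulus h" using r by (simp add: annulus_def)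
  hence "(\<lambda>n. fourier_coeff V n * complex_of_real (exp r) powi n) summable_on UNIV"
    using L by (auto simp: laurent_analytic_def)
  hence "(\<lambda>n. cmod (fourier_coeff V n * complex_of_real (exp r) powi n)) summable_on UNIV"
    by (rule summable_on_iff_abs_summable_on_complex[THEN iffD1])
  thus 1: "fourier_coeff V \<in> ell r" by (simp add: norm_mult norm_powi_exp[OF z] ell_def)
  show "energy_kernel V E \<in> ell r"
    unfolding energy_kernel_def by (intro ell_diff 1 ell_scale kdelta_ell)
qed

lemma symb_energy_kernel:
  assumes L: "laurent_analytic V h" and z: "z \<in> annulus h"
  shows "symb (energy_kernel V E) z = laurent V z - of_real E"
proof -
  have z': "z \<in> ann (- h) h" using z by (simp add: annulus_def ann_def)
  have "symb (\<lambda>n. fourier_coeff V n - of_real E * kdelta n) z = symb (fourier_coeff V) z - of_real E * symb kdelta z"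
    using laurent_analytic_ell(1)[OF L annD(2,3)[OF z']] by (intro symb_diff[OF _ kdelta_ell annD(4)[OF z']])
  thus ?thesis by (simp add: energy_kernel_def laurent_def symb_def[of "fourier_coeff V"])
qed

lemma symb_energy_kernel_nonzero:
  assumes "circle_analytic V" "\<not> V constant_on UNIV" "h > 0" and L: "laurent_analytic V h"
  shows "\<exists>z\<in>ann (- h) h. symb (energy_kernel V E) z \<noteq> 0"
proof (rule ccontr)
  assume neg: "\<not> (\<exists>z\<in>ann (- h) h. symb (energy_kernel V E) z \<noteq> 0)"
  have "energy_kernel V E = (\<lambda>_. 0)"
  proof (rule symb_eq_0_imp[of _ 0])
    show "energy_kernel V E \<in> ell 0" using laurent_analytic_ell(2)[OF L] assms(3) by auto
    show "symb (energy_kernel V E) z = 0" if "cmod z = exp 0" for z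
      using neg annI[OF that] assms(3) by auto
  qed
  hence "energy_kernel V E n = 0" for n by simp
  hence "fourier_coeff V n = 0" if "n \<noteq> 0" for n
    using that by (simp add: energy_kernel_def kdelta_def split: if_splits)
  thus False using nonconstant_fourier_coeff[OF assms(1,2)] by blast
qed

lemma symb_energy_kernel_real:
  assumes V: "circle_analytic V" and z: "cmod z = 1"
  shows "symb (energy_kernel V E) z \<in> \<real>"
proof -
  let ?a = "energy_kernel V E"
  have a: "cnj (?a n) = ?a (- n)" for n
    using cnj_fourier_coeff[OF circle_analytic_continuous[OF V]] by (simp add: energy_kernel_def kdelta_def)
  have cz: "cnj z = inverse z"
    using z by (metis complex_cnj_cnj complex_norm_square inverse_unique mult.commute of_real_1 power_one)
  have zp: "cnj (z powi n) = z powi (- n)" for n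
    using cz by (simp add: power_int_def)
  have "cnj (symb ?a z) = (\<Sum>\<^sub>\<infinity>n. cnj (?a n * z powi n))"
    unfolding symb_def by (rule infsum_cnj[symmetric])
  also have "\<dots> = (\<Sum>\<^sub>\<infinity>n. ?a (- n) * z powi (- n))"
    by (simp only: complex_cnj_mult a zp)
  also have "\<dots> = symb ?a z"
    unfolding symb_def by (rule infsum_reindex_bij_witness[of _ uminus uminus]) auto
  finally show ?thesis by (simp add: Reals_cnj_iff)
qed

text \<open>The symbol and V - E are known to agree only on the annulus; the order of a zero is
  local, so this suffices.\<close>

lemma circle_order_energy_kernel:
  assumes L: "laurent_analytic V h" and h: "h > 0"
  shows "circle_order (symb (energy_kernel V E)) = circle_zero_count V E"
proof -
  have circ: "z \<in> annulus h" if "cmod z = 1" for z using that h by (simp add: annulus_def)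
  have op: "open (annulus h)" using open_ann[of "- h" h] by (simp add: annulus_def ann_def)
  have "zorder (symb (energy_kernel V E)) z = zorder (\<lambda>w. laurent V w - of_real E) z" if "cmod z = 1" for z
  proof (rule zorder_cong)
    have "\<forall>\<^sub>F w in at z. w \<in> annulus h" using eventually_at_in_open'[OF op circ[OF that]] .
    thus "\<forall>\<^sub>F w in at z. symb (energy_kernel V E) w = laurent V w - of_real E"
      by eventually_elim (rule symb_energy_kernel[OF L])
  qed simp
  thus ?thesis
    unfolding circle_order_def circle_zero_count_def
    by (intro sum.cong) (auto simp: symb_energy_kernel[OF L circ])
qed

subsection \<open>The solution bundle\<close>


lemma sum_fun_apply: "(\<Sum>i\<in>I. f i) = (\<lambda>n. \<Sum>i\<in>I. f i n)" for f :: "'i \<Rightarrow> 'a \<Rightarrow> 'b :: comm_monoid_add"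
  by (induction I rule: infinite_finite_induct) (auto simp: fun_eq_iff zero_fun_def plus_fun_def)

lemma cscale_sum: "(\<Sum>i\<in>I. cscale (c i) (U i)) = (\<lambda>n. \<Sum>i\<in>I. c i * U i n)"
  by (simp add: sum_fun_apply cscale_def)

context dichotomy
begin

lemma subspaces: "cseq.subspace sol_u" "cseq.subspace sol_c" "cseq.subspace sol_s"
  using zero_sols sol_u_closed sol_c_closed sol_s_closed
  by (auto simp: cseq.subspace_def zero_fun_def plus_fun_def cscale_def)

lemma direct_sum: "direct_sum3 sol sol_u sol_c sol_s"
  unfolding direct_sum3_def
proof (intro conjI subspaces)
  have sub: "sol_u \<subseteq> sol" "sol_c \<subseteq> sol" "sol_s \<subseteq> sol"
    by (auto simp: sol_u_def sol_c_def sol_s_def)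
  have "inj_on (\<lambda>(x, y, z). x + y + z) (sol_u \<times> sol_c \<times> sol_s)"
  proof (rule inj_onI)
    fix s t
    assume st: "s \<in> sol_u \<times> sol_c \<times> sol_s" "t \<in> sol_u \<times> sol_c \<times> sol_s"
      and eq': "(\<lambda>(x, y, z). x + y + z) s = (\<lambda>(x, y, z). x + y + z) t"
    obtain x y z x' y' z' where xyz: "s = (x, y, z)" "t = (x', y', z')" by (metis prod_cases3)
    have m: "x \<in> sol_u" "y \<in> sol_c" "z \<in> sol_s" "x' \<in> sol_u" "y' \<in> sol_c" "z' \<in> sol_s"
      and eq: "x + y + z = x' + y' + z'" using st eq' xyz by auto
    have "x n + y n + z n = x' n + y' n + z' n" for n using fun_cong[OF eq, of n] by simp
    hence "(\<lambda>n. (x n - x' n) + (y n - y' n) + (z n - z' n)) = (\<lambda>_. 0)"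
      by (auto simp: fun_eq_iff algebra_simps)
    from independent[OF sol_u_closed(2)[OF m(1,4)] sol_c_closed(2)[OF m(2,5)] sol_s_closed(2)[OF m(3,6)] this]
    show "s = t" by (simp add: xyz fun_eq_iff)
  qed
  moreover have "(\<lambda>(x, y, z). x + y + z) ` (sol_u \<times> sol_c \<times> sol_s) = sol"
  proof (intro equalityI subsetI)
    fix u assume "u \<in> (\<lambda>(x, y, z). x + y + z) ` (sol_u \<times> sol_c \<times> sol_s)"
    then obtain x y z where "x \<in> sol_u" "y \<in> sol_c" "z \<in> sol_s" and u: "u = x + y + z" by auto
    hence m: "x \<in> sol" "y \<in> sol" "z \<in> sol" using sub by auto
    have "u = (\<lambda>n. (x n + y n) + z n)" by (simp add: u plus_fun_def)
    thus "u \<in> sol" using sol_closed(1)[OF sol_closed(1)[OF m(1,2)] m(3)] by simp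
  next
    fix u assume "u \<in> sol"
    then obtain x y z where "x \<in> sol_u" "y \<in> sol_c" "z \<in> sol_s" "u = (\<lambda>n. x n + y n + z n)"
      using decomposition by blast
    thus "u \<in> (\<lambda>(x, y, z). x + y + z) ` (sol_u \<times> sol_c \<times> sol_s)"
      by (intro image_eqI[of _ _ "(x, y, z)"]) (auto simp: plus_fun_def)
  qed
  ultimately show "bij_betw (\<lambda>(x, y, z). x + y + z) (sol_u \<times> sol_c \<times> sol_s) sol"
    by (simp add: bij_betw_def)
qed

end

text \<open>Independence and span are notions for sets, while the frame is an indexed family.
  Injectivity, which also follows from unique coordinates, carries sums over indices to sums over
  the set.\<close>

lemma frame_of_coordinates:
  fixes U :: "nat \<Rightarrow> int \<Rightarrow> complex"
  assumes F: "cseq.subspace F" and U: "\<And>i. i < d \<Longrightarrow> U i \<in> F"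
    and sp: "\<And>u. u \<in> F \<Longrightarrow> \<exists>c. u = (\<Sum>i<d. cscale (c i) (U i))"
    and ind: "\<And>c i. (\<Sum>i<d. cscale (c i) (U i)) = 0 \<Longrightarrow> i < d \<Longrightarrow> c i = 0"
  shows "inj_on U {..<d} \<and> cseq.independent (U ` {..<d}) \<and> cseq.span (U ` {..<d}) = F"
proof -
  have inj: "inj_on U {..<d}"
  proof (rule inj_onI, rule ccontr)
    fix i j assume ij: "i \<in> {..<d}" "j \<in> {..<d}" "U i = U j" "i \<noteq> j"
    \<comment> \<open>If two frame vectors coincided, their difference would be a vanishing
      combination with coefficients 1 and -1.\<close>
    define c :: "nat \<Rightarrow> complex" where "c k = (if k = i then 1 else if k = j then - 1 else 0)" for k
    have "(\<Sum>k<d. cscale (c k) (U k)) = (\<Sum>k\<in>{i, j}. cscale (c k) (U k))"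
      by (rule sum.mono_neutral_right) (use ij in \<open>auto simp: c_def cscale_def zero_fun_def\<close>)
    also have "\<dots> = 0" using ij by (simp add: c_def cscale_def plus_fun_def zero_fun_def)
    finally have "c i = 0" using ind ij(1) by blast
    thus False by (simp add: c_def)
  qed
  have re: "(\<Sum>v\<in>U ` {..<d}. cscale (c v) v) = (\<Sum>i<d. cscale (c (U i)) (U i))" for c
    by (rule sum.reindex_cong[OF inj]) auto
  have "cseq.independent (U ` {..<d})"
  proof (rule ccontr)
    assume "\<not> cseq.independent (U ` {..<d})"
    then obtain c v where c: "v \<in> U ` {..<d}" "c v \<noteq> 0" "(\<Sum>v\<in>U ` {..<d}. cscale (c v) v) = 0"
      by (auto simp: cseq.dependent_finite)
    thus False using ind[of "\<lambda>i. c (U i)"] unfolding re by auto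
  qed
  moreover have "cseq.span (U ` {..<d}) = F"
  proof
    show "cseq.span (U ` {..<d}) \<subseteq> F" by (rule cseq.span_minimal) (use U F in auto)
    show "F \<subseteq> cseq.span (U ` {..<d})"
    proof
      fix u assume "u \<in> F"
      then obtain c where u: "u = (\<Sum>i<d. cscale (c i) (U i))" using sp by blast
      show "u \<in> cseq.span (U ` {..<d})"
        unfolding u by (intro cseq.span_sum cseq.span_scale cseq.span_base) auto
    qed
  qed
  ultimately show ?thesis using inj by blast
qed

text \<open>Column j holds the coordinates of the shifted j-th vector in the second frame. The
  matrix of the backward shift between the same frames is its two-sided inverse.\<close>

lemma frame_cocycle:
  fixes U U' :: "nat \<Rightarrow> int \<Rightarrow> complex"
  assumes U: "\<And>i. i < d \<Longrightarrow> U i \<in> F" and sp: "\<And>u. u \<in> F \<Longrightarrow> \<exists>c. u = (\<Sum>i<d. cscale (c i) (U i))"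
    and ind: "\<And>c i. (\<Sum>i<d. cscale (c i) (U i)) = 0 \<Longrightarrow> i < d \<Longrightarrow> c i = 0"
    and U': "\<And>i. i < d \<Longrightarrow> U' i \<in> F'" and sp': "\<And>u. u \<in> F' \<Longrightarrow> \<exists>c. u = (\<Sum>i<d. cscale (c i) (U' i))"
    and ind': "\<And>c i. (\<Sum>i<d. cscale (c i) (U' i)) = 0 \<Longrightarrow> i < d \<Longrightarrow> c i = 0"
    and S: "shift 1 ` F = F'"
  shows "\<exists>C. C \<in> carrier_mat d d \<and> invertible_mat C \<and>
    (\<forall>j<d. shift 1 (U j) = (\<Sum>i<d. cscale (C $$ (i, j)) (U' i)))"
proof -
  have inv: "shift (- 1) (shift 1 u) = u" "shift 1 (shift (- 1) u) = u" for u by (simp_all add: shift_def)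
  have shift_sum: "shift k (\<Sum>i<d. cscale (c i) (V i)) = (\<Sum>i<d. cscale (c i) (shift k (V i)))" for k c V
    unfolding cscale_sum by (simp add: shift_def)
  have "\<exists>c. shift 1 (U j) = (\<Sum>i<d. cscale (c i) (U' i))" if "j < d" for j
    using sp' U[OF that] S by blast
  then obtain c where c: "\<And>j. j < d \<Longrightarrow> shift 1 (U j) = (\<Sum>i<d. cscale (c j i) (U' i))" by metis
  have "shift (- 1) u \<in> F" if "u \<in> F'" for u using that S inv(1) by auto
  hence "\<exists>c. shift (- 1) (U' j) = (\<Sum>i<d. cscale (c i) (U i))" if "j < d" for j
    using sp U'[OF that] by blast
  then obtain b where b: "\<And>j. j < d \<Longrightarrow> shift (- 1) (U' j) = (\<Sum>i<d. cscale (b j i) (U i))" by metis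
  \<comment> \<open>Stated for a shift by s and two frames, so that exchanging the frames and the
    sign of s yields both products.\<close>
  have prod: "(\<Sum>i<d. q i k * p j i) = (if k = j then 1 else 0)"
    if jk: "j < d" "k < d"
      and p: "\<And>j. j < d \<Longrightarrow> shift s (V j) = (\<Sum>i<d. cscale (p j i) (V' i))"
      and q: "\<And>j. j < d \<Longrightarrow> shift (- s) (V' j) = (\<Sum>i<d. cscale (q j i) (V i))"
      and ind: "\<And>c i. (\<Sum>i<d. cscale (c i) (V i)) = 0 \<Longrightarrow> i < d \<Longrightarrow> c i = 0"
    for j k p q s and V V' :: "nat \<Rightarrow> int \<Rightarrow> complex"
  proof -
    have "V j = shift (- s) (shift s (V j))" by (simp add: shift_def)
    also have "\<dots> = (\<Sum>i<d. cscale (p j i) (\<Sum>k<d. cscale (q i k) (V k)))"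
      unfolding p[OF jk(1)] shift_sum by (intro sum.cong) (auto simp: q)
    also have "\<dots> = (\<lambda>n. \<Sum>k<d. (\<Sum>i<d. q i k * p j i) * V k n)"
    proof
      fix n
      have "(\<Sum>i<d. cscale (p j i) (\<Sum>k<d. cscale (q i k) (V k))) n = (\<Sum>i<d. \<Sum>k<d. p j i * (q i k * V k n))"
        unfolding cscale_sum by (simp add: sum_distrib_left)
      also have "\<dots> = (\<Sum>k<d. (\<Sum>i<d. q i k * p j i) * V k n)"
        by (subst sum.swap) (simp add: sum_distrib_left mult_ac)
      finally show "(\<Sum>i<d. cscale (p j i) (\<Sum>k<d. cscale (q i k) (V k))) n = (\<Sum>k<d. (\<Sum>i<d. q i k * p j i) * V k n)" .
    qed
    finally have Vj: "V j = (\<lambda>n. \<Sum>k<d. (\<Sum>i<d. q i k * p j i) * V k n)" .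
    have "(\<Sum>k<d. cscale ((\<Sum>i<d. q i k * p j i) - (if k = j then 1 else 0)) (V k)) = 0"
    proof -
      have "(\<Sum>k<d. (if k = j then 1 else 0) * V k n) = V j n" for n
        using jk(1) by (simp add: if_distrib[of "\<lambda>x. x * _"] cong: if_cong)
      thus ?thesis
        unfolding cscale_sum zero_fun_def left_diff_distrib sum_subtractf
        using fun_cong[OF Vj] by (simp add: fun_eq_iff)
    qed
    from ind[OF this jk(2)] show ?thesis by simp
  qed
  have bc: "(\<Sum>i<d. b i k * c j i) = (if k = j then 1 else 0)" if jk: "j < d" "k < d" for j k
  proof (rule prod[where V = U and V' = U' and s = 1, OF jk])
    show "shift 1 (U j) = (\<Sum>i<d. cscale (c j i) (U' i))" if "j < d" for j by (rule c[OF that])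
    show "shift (- 1) (U' j) = (\<Sum>i<d. cscale (b j i) (U i))" if "j < d" for j by (rule b[OF that])
    show "x i = 0" if "(\<Sum>i<d. cscale (x i) (U i)) = 0" "i < d" for x i by (rule ind[OF that])
  qed
  have cb: "(\<Sum>i<d. c i k * b j i) = (if k = j then 1 else 0)" if jk: "j < d" "k < d" for j k
  proof (rule prod[where V = U' and V' = U and s = "- 1", OF jk])
    show "shift (- 1) (U' j) = (\<Sum>i<d. cscale (b j i) (U i))" if "j < d" for j by (rule b[OF that])
    show "shift (- (- 1)) (U j) = (\<Sum>i<d. cscale (c j i) (U' i))" if "j < d" for j using c[OF that] by simp
    show "x i = 0" if "(\<Sum>i<d. cscale (x i) (U' i)) = 0" "i < d" for x i by (rule ind'[OF that])
  qed
  define C where "C = Matrix.mat d d (\<lambda>(i, j). c j i)"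
  define B where "B = Matrix.mat d d (\<lambda>(i, j). b j i)"
  have "B * C = 1\<^sub>m d"
  proof (rule eq_matI)
    fix i j assume "i < dim_row (1\<^sub>m d :: complex mat)" "j < dim_col (1\<^sub>m d :: complex mat)"
    thus "(B * C) $$ (i, j) = 1\<^sub>m d $$ (i, j)"
      using bc[of j i] by (simp add: B_def C_def scalar_prod_def atLeast0LessThan)
  qed (auto simp: B_def C_def)
  moreover have "C * B = 1\<^sub>m d"
  proof (rule eq_matI)
    fix i j assume "i < dim_row (1\<^sub>m d :: complex mat)" "j < dim_col (1\<^sub>m d :: complex mat)"
    thus "(C * B) $$ (i, j) = 1\<^sub>m d $$ (i, j)"
      using cb[of j i] by (simp add: B_def C_def scalar_prod_def atLeast0LessThan)
  qed (auto simp: B_def C_def)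
  ultimately have "invertible_mat C"
    unfolding invertible_mat_def inverts_mat_def by (intro conjI exI[of _ B]) (auto simp: C_def B_def)
  moreover have "\<forall>j<d. shift 1 (U j) = (\<Sum>i<d. cscale (C $$ (i, j)) (U' i))"
    using c by (auto simp: C_def)
  ultimately show ?thesis by (intro exI[of _ C]) (auto simp: C_def)
qed

lemma conv_diff_kdelta:
  assumes "u \<in> conv_dom b"
  shows "conv (\<lambda>k. b k - c * kdelta k) u = (\<lambda>n. conv b u n - c * u n)"
proof
  fix n
  have s: "(\<lambda>k. - (c * kdelta k * u (n - k))) summable_on UNIV"
    by (rule finite_nonzero_values_imp_summable_on, rule finite_subset[of _ "{0}"]) (auto simp: kdelta_def)
  have "conv (\<lambda>k. b k - c * kdelta k) u n = (\<Sum>\<^sub>\<infinity>k. b k * u (n - k) + - (c * kdelta k * u (n - k)))"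
    unfolding conv_def by (intro infsum_cong) (simp add: algebra_simps)
  also have "\<dots> = conv b u n + (\<Sum>\<^sub>\<infinity>k. - (c * kdelta k * u (n - k)))"
    unfolding conv_def using assms s by (intro infsum_add) (auto simp: conv_dom_def)
  also have "(\<Sum>\<^sub>\<infinity>k. - (c * kdelta k * u (n - k))) = (\<Sum>\<^sub>\<infinity>k\<in>{0}. - (c * kdelta k * u (n - k)))"
    by (rule infsum_cong_neutral) (auto simp: kdelta_def)
  finally show "conv (\<lambda>k. b k - c * kdelta k) u n = conv b u n - c * u n" by (simp add: kdelta_def)
qed

definition potential :: "real \<Rightarrow> ('w \<Rightarrow> real) \<Rightarrow> ('w \<Rightarrow> 'w) \<Rightarrow> 'w \<Rightarrow> int \<Rightarrow> complex" where
  "potential \<epsilon> W T \<theta> n = of_real (\<epsilon> * W (int_iterate T n \<theta>))"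

text \<open>On X_\<xi> the convolution converges, because each half of the sequence does so at its
  own weight. The energy can therefore be absorbed into the kernel as a multiple of
  \<open>kdelta\<close>.\<close>

lemma solution_fiber_eq:
  assumes L: "laurent_analytic V h" and \<xi>: "0 < \<xi>" "\<xi> < h"
  shows "solution_fiber \<xi> V E \<epsilon> W T \<theta> = sol_space (refl_seq (energy_kernel V E)) (potential \<epsilon> W T \<theta>) \<xi>"
proof -
  let ?b = "refl_seq (fourier_coeff V)"
  have ak: "refl_seq (energy_kernel V E) = (\<lambda>k. ?b k - of_real E * kdelta k)"
    by (auto simp: refl_seq_def energy_kernel_def kdelta_def)
  have "long_range_op V \<epsilon> W T \<theta> u = cscale (of_real E) u \<longleftrightarrow>
     pconv (refl_seq (energy_kernel V E)) (potential \<epsilon> W T \<theta>) u = (\<lambda>_. 0)" if u: "u \<in> xspace \<xi>" for u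
  proof -
    have b: "?b \<in> ell (- \<xi>)" "?b \<in> ell \<xi>"
      unfolding refl_seq_ell using laurent_analytic_ell(1)[OF L] \<xi> by auto
    have "pos_part u \<in> conv_dom ?b" "neg_part u \<in> conv_dom ?b"
      using u b conv_dom_ell unfolding xspace_iff by blast+
    from conv_dom_add(1)[OF this] have ud: "u \<in> conv_dom ?b" by (simp add: pos_neg_part)
    have "(\<Sum>\<^sub>\<infinity>k. fourier_coeff V k * u (n + k)) = conv ?b u n" for n
      unfolding conv_def refl_seq_def
      by (rule infsum_reindex_bij_witness[of _ uminus uminus]) auto
    thus ?thesis
      unfolding long_range_op_def pconv_def ak conv_diff_kdelta[OF ud] potential_def cscale_def
      by (simp add: fun_eq_iff algebra_simps)
  qed
  thus ?thesis unfolding solution_fiber_def sol_space_def by blast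
qed

section \<open>The potential along orbits\<close>

lemma (in admissible) bij_T: "bij T"
proof -
  have "inv_into UNIV T (T x) = x" "T (inv_into UNIV T x) = x" for x
    using homeo by (auto simp: homeomorphism_def)
  thus ?thesis by (metis bijI')
qed

lemma (in admissible) int_iterate_add1: "int_iterate T n (T \<theta>) = int_iterate T (n + 1) \<theta>"
proof (cases "n \<ge> 0")
  case True
  hence "nat (n + 1) = Suc (nat n)" by simp
  thus ?thesis using True by (simp add: int_iterate_def funpow_swap1)
next
  case False
  then obtain k where k: "nat (- n) = Suc k" by (metis not_le not0_implies_Suc zero_less_nat_eq neg_0_less_iff_less less_irrefl)
  hence k': "nat (- (n + 1)) = k" by simp
  have "inv_into UNIV T (T \<theta>) = \<theta>" using bij_T by (simp add: bij_is_inj)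
  hence "(inv_into UNIV T ^^ Suc k) (T \<theta>) = (inv_into UNIV T ^^ k) \<theta>" by (simp add: funpow_swap1)
  \<comment> \<open>For n = -1 the exponent n + 1 is 0 and \<open>int_iterate\<close> changes to its
    other branch.\<close>
  moreover have "(inv_into UNIV T ^^ k) \<theta> = int_iterate T (n + 1) \<theta>"
    using False k' by (cases "n = - 1") (auto simp: int_iterate_def)
  ultimately show ?thesis using False k by (simp add: int_iterate_def)
qed

text \<open>For backward iterates surjectivity of the composition on the algebra is decisive: g
  composed with the inverse of T is the preimage of g, and it has the same norm.\<close>

lemma (in admissible) compose_iterate:
  assumes f: "f \<in> A"
  shows "(\<lambda>\<theta>. f (int_iterate T n \<theta>)) \<in> A \<and> N (\<lambda>\<theta>. f (int_iterate T n \<theta>)) = N f"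
proof -
  have T: "g \<circ> T \<in> A \<and> N (g \<circ> T) = N g" if "g \<in> A" for g
    using compose_bij compose_isometric[OF that] that by (auto simp: bij_betw_def)
  have I: "g \<circ> inv_into UNIV T \<in> A \<and> N (g \<circ> inv_into UNIV T) = N g" if g: "g \<in> A" for g
  proof -
    have "g \<in> (\<lambda>f. f \<circ> T) ` A" using compose_bij g by (simp add: bij_betw_def)
    then obtain g' where g': "g' \<in> A" "g' \<circ> T = g" by blast
    have "g \<circ> inv_into UNIV T = g'"
      using g'(2)[symmetric] bij_T by (auto simp: fun_eq_iff bij_is_surj surj_f_inv_f)
    thus ?thesis using g' compose_isometric[OF g'(1)] by auto
  qed
  have "f \<circ> (T ^^ k) \<in> A \<and> N (f \<circ> (T ^^ k)) = N f" for k
  proof (induction k)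
    case (Suc k)
    have "f \<circ> (T ^^ Suc k) = (f \<circ> (T ^^ k)) \<circ> T" by (simp add: fun_eq_iff funpow_swap1)
    with T[of "f \<circ> (T ^^ k)"] Suc show ?case by metis
  qed (use f in simp)
  moreover have "f \<circ> (inv_into UNIV T ^^ k) \<in> A \<and> N (f \<circ> (inv_into UNIV T ^^ k)) = N f" for k
  proof (induction k)
    case (Suc k)
    have "f \<circ> (inv_into UNIV T ^^ Suc k) = (f \<circ> (inv_into UNIV T ^^ k)) \<circ> inv_into UNIV T"
      by (simp add: fun_eq_iff funpow_swap1)
    with I[of "f \<circ> (inv_into UNIV T ^^ k)"] Suc show ?case by metis
  qed (use f in simp)
  ultimately show ?thesis by (auto simp: int_iterate_def o_def)
qed

lemma (in admissible) potential_bounds: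
  assumes W: "(\<lambda>\<theta>. complex_of_real (W \<theta>)) \<in> A"
  shows "(\<lambda>\<theta>. potential \<epsilon> W T \<theta> n) \<in> A"
    "N (\<lambda>\<theta>. potential \<epsilon> W T \<theta> n) = \<bar>\<epsilon>\<bar> * N (\<lambda>\<theta>. complex_of_real (W \<theta>))"
    "cmod (potential \<epsilon> W T \<theta> n) \<le> \<bar>\<epsilon>\<bar> * N (\<lambda>\<theta>. complex_of_real (W \<theta>))"
proof -
  have eq: "(\<lambda>\<theta>. potential \<epsilon> W T \<theta> n) = (\<lambda>\<theta>. complex_of_real \<epsilon> * complex_of_real (W (int_iterate T n \<theta>)))"
    by (simp add: potential_def)
  note c = compose_iterate[OF W, of n]
  show 1: "(\<lambda>\<theta>. potential \<epsilon> W T \<theta> n) \<in> A" unfolding eq using c by (intro scale) auto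
  show 2: "N (\<lambda>\<theta>. potential \<epsilon> W T \<theta> n) = \<bar>\<epsilon>\<bar> * N (\<lambda>\<theta>. complex_of_real (W \<theta>))"
    unfolding eq using c by (subst norm_scale) auto
  show "cmod (potential \<epsilon> W T \<theta> n) \<le> \<bar>\<epsilon>\<bar> * N (\<lambda>\<theta>. complex_of_real (W \<theta>))"
    using sup_le_norm[OF 1, of \<theta>] 2 by simp
qed

lemma (in admissible) potential_shift: "shift 1 (potential \<epsilon> W T \<theta>) = potential \<epsilon> W T (T \<theta>)"
  by (simp add: shift_def potential_def int_iterate_add1 fun_eq_iff)

lemma shift_image_eq:
  assumes "\<And>u. u \<in> F \<Longrightarrow> shift 1 u \<in> F'" "\<And>u. u \<in> F' \<Longrightarrow> shift (- 1) u \<in> F"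
  shows "shift 1 ` F = F'"
proof
  show "shift 1 ` F \<subseteq> F'" using assms(1) by blast
  show "F' \<subseteq> shift 1 ` F"
  proof
    fix u assume "u \<in> F'"
    moreover have "u = shift 1 (shift (- 1) u)" by (simp add: shift_def)
    ultimately show "u \<in> shift 1 ` F" using assms(2) by blast
  qed
qed

lemma (in admissible) shift_invariant_sols:
  shows "shift_invariant T (\<lambda>\<theta>. unstable_sol a (potential \<epsilon> W T \<theta>) \<xi> \<eta>)" (is ?U)
    and "shift_invariant T (\<lambda>\<theta>. center_sol a (potential \<epsilon> W T \<theta>) \<xi> \<eta>)" (is ?C)
    and "shift_invariant T (\<lambda>\<theta>. stable_sol a (potential \<epsilon> W T \<theta>) \<xi> \<eta>)" (is ?S)
proof -
  have shift_back: "shift (- 1) (potential \<epsilon> W T (T \<theta>)) = potential \<epsilon> W T \<theta>" for \<theta>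
    unfolding potential_shift[symmetric] by (simp add: shift_def)
  show ?U unfolding shift_invariant_def
    by (intro allI shift_image_eq) (metis shift_sols(2) potential_shift, metis shift_sols(2) shift_back)
  show ?C unfolding shift_invariant_def
    by (intro allI shift_image_eq) (metis shift_sols(3) potential_shift, metis shift_sols(3) shift_back)
  show ?S unfolding shift_invariant_def
    by (intro allI shift_image_eq) (metis shift_sols(1) potential_shift, metis shift_sols(1) shift_back)
qed

text \<open>The threshold is chosen before T. Composition with T preserves the norm, so all
  coordinates of the potential have norm |\<epsilon>| N(W), and T does not enter the
  constants.\<close>

theorem theorem1p1:
  fixes A :: "('w::metric_space \<Rightarrow> complex) set"
    and N :: "('w \<Rightarrow> complex) \<Rightarrow> real"
    and W :: "'w \<Rightarrow> real"
    and V :: "real \<Rightarrow> real"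
    and h \<xi> E :: real
  assumes "continuous_on UNIV W"
    and "(\<lambda>\<theta>. complex_of_real (W \<theta>)) \<in> A"
    and "circle_analytic V"
    and "\<not> V constant_on UNIV"
    and "h > 0" and "laurent_analytic V h"
    and "0 < \<xi>" and "\<xi> < h"
  shows "\<exists>\<epsilon>0>0. \<forall>T. admissible A N T \<longrightarrow> (\<forall>\<epsilon>::real. \<bar>\<epsilon>\<bar> < \<epsilon>0 \<longrightarrow>
    (\<exists>Mu Mc Ms.
       (\<forall>\<theta>. direct_sum3 (solution_fiber \<xi> V E \<epsilon> W T \<theta>) (Mu \<theta>) (Mc \<theta>) (Ms \<theta>)) \<and>
       shift_invariant T Mu \<and> shift_invariant T Mc \<and> shift_invariant T Ms \<and>
       (\<exists>rs rm rp ru C. 0 < rs \<and> rs < rm \<and> rm < 1 \<and> 1 < rp \<and> rp < ru \<and> 0 < C \<and>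
          (\<forall>\<theta>. \<forall>n::nat.
             fiber_opnorm \<xi> (shift (int n)) (Ms \<theta>) \<le> C * rs ^ n \<and>
             fiber_opnorm \<xi> (shift (- int n)) (Mu \<theta>) \<le> C * ru powi (- int n) \<and>
             fiber_opnorm \<xi> (shift (int n)) (Mc \<theta>) \<le> C * rp ^ n \<and>
             fiber_opnorm \<xi> (shift (- int n)) (Mc \<theta>) \<le> C * rm powi (- int n))) \<and>
       (\<forall>\<theta>. cseq.dim (Mc \<theta>) = 2 * half_zero_count V E) \<and>
       globally_trivial Mc \<and>
       (\<exists>U Cm. global_frame Mc (2 * half_zero_count V E) U \<and>
          (\<forall>i < 2 * half_zero_count V E. \<forall>k. (\<lambda>\<theta>. U i \<theta> k) \<in> A) \<and>
          (\<forall>\<theta>. Cm \<theta> \<in> carrier_mat (2 * half_zero_count V E) (2 * half_zero_count V E) \<and>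
               invertible_mat (Cm \<theta>) \<and>
               (\<forall>j < 2 * half_zero_count V E.
                  shift 1 (U j \<theta>) =
                    (\<Sum>i < 2 * half_zero_count V E. cscale (Cm \<theta> $$ (i, j)) (U i (T \<theta>))))))))"
proof -
  note WA = assms(2) and V = assms(3) and Vnc = assms(4) and h = assms(5)
    and L = assms(6) and \<xi> = assms(7,8)
  define a0 where "a0 = energy_kernel V E"
  define a where "a = refl_seq a0"
  define d where "d = circle_order (symb a0)"
  have a0: "a0 \<in> ell r" if "- h < r" "r < h" for r
    unfolding a0_def by (rule laurent_analytic_ell(2)[OF L that])
  have nz: "\<exists>z\<in>ann (- h) h. symb a0 z \<noteq> 0"
    unfolding a0_def by (rule symb_energy_kernel_nonzero[OF V Vnc h L])
  have real: "symb a0 z \<in> \<real>" if "cmod z = 1" for z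
    unfolding a0_def by (rule symb_energy_kernel_real[OF V that])
  have "even d" unfolding d_def by (rule even_circle_order[OF h a0 nz real])
  moreover have "d = circle_zero_count V E"
    unfolding d_def a0_def by (rule circle_order_energy_kernel[OF L h])
  ultimately have d2: "2 * half_zero_count V E = d" by (simp add: half_zero_count_def)
  obtain \<eta> K e0 g1 g2 where \<eta>: "\<eta> > 0" "2 * \<eta> < \<xi>"
    and C0: "complemented \<eta> (2 * \<eta>) (conv a0) 0 e0 K" "complemented (- 2 * \<eta>) (- \<eta>) (conv a0) 0 e0 K"
      "complemented \<eta> \<eta> (conv a0) 0 e0 K" "complemented (- \<eta>) (- \<eta>) (conv a0) 0 e0 K"
      "complemented (- \<eta>) \<eta> (conv a0) d e0 K"
    and g: "g1 \<in> ell \<eta>" "conv a0 g1 = kdelta" "g2 \<in> ell (- \<eta>)" "conv a0 g2 = kdelta"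
    using kernel_dichotomy[OF \<xi> a0 nz] unfolding d_def by blast
  define e where "e = (\<lambda>j. refl_seq (e0 j))"
  \<comment> \<open>Reflection reverses the weights, so the inverse kernel at \<eta> for V - E
    becomes the one at -\<eta> for the operator, and conversely.\<close>
  define gu where "gu = refl_seq g1"
  define gs where "gs = refl_seq g2"
  have C: "complemented \<eta> (2 * \<eta>) (conv a) 0 e K" "complemented (- 2 * \<eta>) (- \<eta>) (conv a) 0 e K"
    "complemented \<eta> \<eta> (conv a) 0 e K" "complemented (- \<eta>) (- \<eta>) (conv a) 0 e K"
    "complemented (- \<eta>) \<eta> (conv a) d e K"
    using complemented_refl[OF C0(1)] complemented_refl[OF C0(2)] complemented_refl[OF C0(3)]
      complemented_refl[OF C0(4)] complemented_refl[OF C0(5)] by (simp_all add: a_def e_def)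
  have gs: "gs \<in> ell \<eta>" "conv a gs = kdelta" and gu: "gu \<in> ell (- \<eta>)" "conv a gu = kdelta"
    using g by (auto simp: gs_def gu_def a_def refl_seq_ell conv_refl_seq) (auto simp: refl_seq_def kdelta_def)
  have a: "a \<in> ell r" if "\<bar>r\<bar> \<le> \<xi>" for r
    unfolding a_def refl_seq_ell using that \<xi> by (intro a0) auto
  have a_\<eta>: "a \<in> ell \<eta>" "a \<in> ell (2 * \<eta>)" "a \<in> ell (- \<eta>)" "a \<in> ell (- 2 * \<eta>)"
    using a \<eta> by auto
  have K: "K > 0" using C(1) by (simp add: complemented_def)
  have e: "e j \<in> ell \<eta>" "e j \<in> ell (- \<eta>)" if "j < d" for j using C(5) that by (auto simp: complemented_def)
  define NW where "NW = N (\<lambda>\<theta>. complex_of_real (W \<theta>))"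
  \<comment> \<open>This dominates the three quantities whose product with \<delta> must be at most
    1/2: K for the perturbed complement, and the two kernel norms for the algebra-valued
    solutions.\<close>
  define B where "B = K + enorm \<eta> gs + enorm (- \<eta>) gu"
  have B: "B > 0" using K by (simp add: B_def add_pos_nonneg)
  \<comment> \<open>Chosen so that \<delta> B <= 1/2 for \<delta> = |\<epsilon>| N(W). The form 1 +
    |NW| is positive without knowing the sign of NW, which becomes available only once admissibility
    is assumed.\<close>
  define \<epsilon>0 where "\<epsilon>0 = 1 / (2 * B * (1 + \<bar>NW\<bar>))"
  \<comment> \<open>The perturbed constant for d complementary vectors also dominates the one for
    none.\<close>
  define K' where "K' = 2 * K * (2 + real d)"
  have main: "\<exists>Mu Mc Ms.
       (\<forall>\<theta>. direct_sum3 (solution_fiber \<xi> V E \<epsilon> W T \<theta>) (Mu \<theta>) (Mc \<theta>) (Ms \<theta>)) \<and>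
       shift_invariant T Mu \<and> shift_invariant T Mc \<and> shift_invariant T Ms \<and>
       (\<exists>rs rm rp ru C. 0 < rs \<and> rs < rm \<and> rm < 1 \<and> 1 < rp \<and> rp < ru \<and> 0 < C \<and>
          (\<forall>\<theta>. \<forall>n::nat.
             fiber_opnorm \<xi> (shift (int n)) (Ms \<theta>) \<le> C * rs ^ n \<and>
             fiber_opnorm \<xi> (shift (- int n)) (Mu \<theta>) \<le> C * ru powi (- int n) \<and>
             fiber_opnorm \<xi> (shift (int n)) (Mc \<theta>) \<le> C * rp ^ n \<and>
             fiber_opnorm \<xi> (shift (- int n)) (Mc \<theta>) \<le> C * rm powi (- int n))) \<and>
       (\<forall>\<theta>. cseq.dim (Mc \<theta>) = d) \<and> globally_trivial Mc \<and>
       (\<exists>U Cm. global_frame Mc d U \<and> (\<forall>i < d. \<forall>k. (\<lambda>\<theta>. U i \<theta> k) \<in> A) \<and>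
          (\<forall>\<theta>. Cm \<theta> \<in> carrier_mat d d \<and> invertible_mat (Cm \<theta>) \<and>
               (\<forall>j < d. shift 1 (U j \<theta>) = (\<Sum>i < d. cscale (Cm \<theta> $$ (i, j)) (U i (T \<theta>))))))"
    if adm: "admissible A N T" and \<epsilon>: "\<bar>\<epsilon>\<bar> < \<epsilon>0" for T :: "'w \<Rightarrow> 'w" and \<epsilon> :: real
  proof -
    interpret admissible A N T by (rule adm)
    define \<delta> where "\<delta> = \<bar>\<epsilon>\<bar> * NW"
    define w where "w = potential \<epsilon> W T"
    have NW0: "NW \<ge> 0" unfolding NW_def by (rule norm_nonneg[OF WA])
    have \<delta>0: "\<delta> \<ge> 0" using NW0 by (simp add: \<delta>_def)
    have \<delta>B: "\<delta> * B \<le> 1 / 2"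
    proof -
      have "\<delta> \<le> \<epsilon>0 * (1 + \<bar>NW\<bar>)" unfolding \<delta>_def using \<epsilon> NW0 by (intro mult_mono) auto
      hence "\<delta> * B \<le> \<epsilon>0 * (1 + \<bar>NW\<bar>) * B" using B by (intro mult_right_mono) auto
      also have "\<dots> = 1 / 2"
      proof -
        have "1 / (2 * B * x) * x * B = 1 / 2" if "x > 0" for x using B that by (simp add: field_simps)
        from this[of "1 + \<bar>NW\<bar>"] show ?thesis by (simp add: \<epsilon>0_def)
      qed
      finally show ?thesis .
    qed
    have \<delta>le: "\<delta> * x \<le> 1 / 2" if "x \<le> B" for x
      using mult_left_mono[OF that \<delta>0] \<delta>B by linarith
    have \<delta>K: "\<delta> * K \<le> 1 / 2" "\<delta> * enorm \<eta> gs \<le> 1 / 2" "\<delta> * enorm (- \<eta>) gu \<le> 1 / 2"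
      using \<delta>le[of K] \<delta>le[of "enorm \<eta> gs"] \<delta>le[of "enorm (- \<eta>) gu"] K by (auto simp: B_def)
    note pot = potential_bounds[OF WA, folded NW_def, of \<epsilon>, folded \<delta>_def w_def]
    have w: "cmod (w \<theta> n) \<le> \<delta>" for \<theta> n by (rule pot(3))
    have pert: "complemented s t (pconv a (w \<theta>)) k e K'" if "complemented s t (conv a) k e K" "a \<in> ell s" "a \<in> ell t" "k \<le> d" for s t k \<theta>
    proof -
      have "complemented s t (pconv a (w \<theta>)) k e (2 * K * (2 + real k))"
        unfolding pconv_def by (rule complemented_perturb[OF that(1,2,3) w \<delta>K(1)])
      moreover have "2 * K * (2 + real k) \<le> K'" unfolding K'_def using that(4) K by (intro mult_left_mono) auto
      ultimately show ?thesis by (rule complemented_mono)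
    qed
    \<comment> \<open>The constants K' and \<delta> and the vectors e are the same for every
      \<theta>; this makes the rates uniform and the frame global.\<close>
    have D: "dichotomy a (w \<theta>) \<xi> \<eta> K' \<delta> d e" for \<theta>
    proof
      show "\<eta> > 0" "2 * \<eta> \<le> \<xi>" using \<eta> by auto
      show "a \<in> ell r" if "\<bar>r\<bar> \<le> \<xi>" for r by (rule a[OF that])
      show "cmod (w \<theta> n) \<le> \<delta>" for n by (rule w)
      show "complemented \<eta> (2 * \<eta>) (pconv a (w \<theta>)) 0 e K'" by (rule pert[OF C(1)]) (use a_\<eta> in auto)
      show "complemented (- 2 * \<eta>) (- \<eta>) (pconv a (w \<theta>)) 0 e K'" by (rule pert[OF C(2)]) (use a_\<eta> in auto)
      show "complemented (- \<eta>) \<eta> (pconv a (w \<theta>)) d e K'" by (rule pert[OF C(5)]) (use a_\<eta> in auto)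
      show "u = (\<lambda>_. 0)" if "u \<in> ell \<eta>" "pconv a (w \<theta>) u = (\<lambda>_. 0)" for u
        by (rule complemented_injD(1)[OF pert[OF C(3) a_\<eta>(1,1)] that(1,1), where c = "\<lambda>_. 0"]) (use that in auto)
      show "u = (\<lambda>_. 0)" if "u \<in> ell (- \<eta>)" "pconv a (w \<theta>) u = (\<lambda>_. 0)" for u
        by (rule complemented_injD(1)[OF pert[OF C(4) a_\<eta>(3,3)] that(1,1), where c = "\<lambda>_. 0"]) (use that in auto)
    qed
    \<comment> \<open>For each j the whole family over \<theta> is chosen at once, since membership
      of its coordinates in the algebra is a property of the family.\<close>
    have "\<forall>j\<in>{..<d}. \<exists>v. (\<forall>\<theta>. v \<theta> \<in> ell \<eta> \<and> pconv a (w \<theta>) (v \<theta>) = e j) \<and> (\<forall>n. (\<lambda>\<theta>. v \<theta> n) \<in> A)"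
    proof
      fix j assume "j \<in> {..<d}"
      hence j: "j < d" by simp
      show "\<exists>v. (\<forall>\<theta>. v \<theta> \<in> ell \<eta> \<and> pconv a (w \<theta>) (v \<theta>) = e j) \<and> (\<forall>n. (\<lambda>\<theta>. v \<theta> n) \<in> A)"
        using algebra_valued_solution[OF a_\<eta>(1) gs e(1)[OF j] pot(1) eq_refl[OF pot(2)] \<delta>K(2)]
        unfolding pconv_def fun_eq_iff .
    qed
    from bchoice[OF this] obtain p where p_all: "\<forall>j\<in>{..<d}. (\<forall>\<theta>. p j \<theta> \<in> ell \<eta> \<and> pconv a (w \<theta>) (p j \<theta>) = e j) \<and>
        (\<forall>n. (\<lambda>\<theta>. p j \<theta> n) \<in> A)" ..
    have p: "p j \<theta> \<in> ell \<eta>" "pconv a (w \<theta>) (p j \<theta>) = e j" "(\<lambda>\<theta>. p j \<theta> n) \<in> A" if "j < d" for j \<theta> n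
      using bspec[OF p_all, of j] that by auto
    have "\<forall>j\<in>{..<d}. \<exists>v. (\<forall>\<theta>. v \<theta> \<in> ell (- \<eta>) \<and> pconv a (w \<theta>) (v \<theta>) = e j) \<and> (\<forall>n. (\<lambda>\<theta>. v \<theta> n) \<in> A)"
    proof
      fix j assume "j \<in> {..<d}"
      hence j: "j < d" by simp
      show "\<exists>v. (\<forall>\<theta>. v \<theta> \<in> ell (- \<eta>) \<and> pconv a (w \<theta>) (v \<theta>) = e j) \<and> (\<forall>n. (\<lambda>\<theta>. v \<theta> n) \<in> A)"
        using algebra_valued_solution[OF a_\<eta>(3) gu e(2)[OF j] pot(1) eq_refl[OF pot(2)] \<delta>K(3)]
        unfolding pconv_def fun_eq_iff .
    qed
    from bchoice[OF this] obtain q where q_all: "\<forall>j\<in>{..<d}. (\<forall>\<theta>. q j \<theta> \<in> ell (- \<eta>) \<and> pconv a (w \<theta>) (q j \<theta>) = e j) \<and>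
        (\<forall>n. (\<lambda>\<theta>. q j \<theta> n) \<in> A)" ..
    have q: "q j \<theta> \<in> ell (- \<eta>)" "pconv a (w \<theta>) (q j \<theta>) = e j" "(\<lambda>\<theta>. q j \<theta> n) \<in> A" if "j < d" for j \<theta> n
      using bspec[OF q_all, of j] that by auto
    define Mu where "Mu = (\<lambda>\<theta>. unstable_sol a (w \<theta>) \<xi> \<eta>)"
    define Mc where "Mc = (\<lambda>\<theta>. center_sol a (w \<theta>) \<xi> \<eta>)"
    define Ms where "Ms = (\<lambda>\<theta>. stable_sol a (w \<theta>) \<xi> \<eta>)"
    define U where "U j \<theta> = (\<lambda>n. q j \<theta> n - p j \<theta> n)" for j \<theta>
    have UA: "(\<lambda>\<theta>. U j \<theta> n) \<in> A" if "j < d" for j n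
      unfolding U_def using add[OF q(3)[OF that] minus_in(1)[OF p(3)[OF that]]] by simp
    have Uin: "U j \<theta> \<in> Mc \<theta>" if "j < d" for j \<theta>
      unfolding U_def Mc_def
      by (rule dichotomy.center_frame_in[OF D, where p = "\<lambda>j. p j \<theta>" and q = "\<lambda>j. q j \<theta>"]) (use p q that in auto)
    have Usp: "\<exists>c. u = (\<Sum>i<d. cscale (c i) (U i \<theta>))" if "u \<in> Mc \<theta>" for u \<theta>
      unfolding cscale_sum U_def
      by (rule dichotomy.center_frame_span[OF D, where p = "\<lambda>j. p j \<theta>" and q = "\<lambda>j. q j \<theta>"]) (use p q that in \<open>auto simp: Mc_def\<close>)
    have Uind: "c i = 0" if "(\<Sum>i<d. cscale (c i) (U i \<theta>)) = 0" "i < d" for c i \<theta>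
      by (rule dichotomy.center_frame_independent[OF D, where p = "\<lambda>j. p j \<theta>" and q = "\<lambda>j. q j \<theta>"])
        (use p q that in \<open>auto simp: cscale_sum U_def zero_fun_def\<close>)
    have sub: "cseq.subspace (Mc \<theta>)" for \<theta>
      unfolding Mc_def by (rule dichotomy.subspaces(2)[OF D])
    have frame: "inj_on (\<lambda>i. U i \<theta>) {..<d} \<and> cseq.independent ((\<lambda>i. U i \<theta>) ` {..<d}) \<and>
        cseq.span ((\<lambda>i. U i \<theta>) ` {..<d}) = Mc \<theta>" for \<theta>
    proof (rule frame_of_coordinates[OF sub])
      show "U i \<theta> \<in> Mc \<theta>" if "i < d" for i by (rule Uin[OF that])
      show "\<exists>c. u = (\<Sum>i<d. cscale (c i) (U i \<theta>))" if "u \<in> Mc \<theta>" for u by (rule Usp[OF that])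
      show "c i = 0" if "(\<Sum>i<d. cscale (c i) (U i \<theta>)) = 0" "i < d" for c i by (rule Uind[OF that])
    qed
    have gf: "global_frame Mc d U"
      unfolding global_frame_def using frame by blast
    have inv: "shift_invariant T Mu" "shift_invariant T Mc" "shift_invariant T Ms"
      unfolding Mu_def Mc_def Ms_def w_def by (rule shift_invariant_sols)+
    have "\<exists>C. C \<in> carrier_mat d d \<and> invertible_mat C \<and>
        (\<forall>j<d. shift 1 (U j \<theta>) = (\<Sum>i<d. cscale (C $$ (i, j)) (U i (T \<theta>))))" for \<theta>
    proof (rule frame_cocycle[where F = "Mc \<theta>" and F' = "Mc (T \<theta>)"])
      show "shift 1 ` Mc \<theta> = Mc (T \<theta>)" using inv(2) by (simp add: shift_invariant_def)
      show "U i \<theta> \<in> Mc \<theta>" if "i < d" for i by (rule Uin[OF that])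
      show "\<exists>c. u = (\<Sum>i<d. cscale (c i) (U i \<theta>))" if "u \<in> Mc \<theta>" for u by (rule Usp[OF that])
      show "c i = 0" if "(\<Sum>i<d. cscale (c i) (U i \<theta>)) = 0" "i < d" for c i by (rule Uind[OF that])
      show "U i (T \<theta>) \<in> Mc (T \<theta>)" if "i < d" for i by (rule Uin[OF that])
      show "\<exists>c. u = (\<Sum>i<d. cscale (c i) (U i (T \<theta>)))" if "u \<in> Mc (T \<theta>)" for u by (rule Usp[OF that])
      show "c i = 0" if "(\<Sum>i<d. cscale (c i) (U i (T \<theta>))) = 0" "i < d" for c i by (rule Uind[OF that])
    qed
    then obtain Cm where Cm: "\<And>\<theta>. Cm \<theta> \<in> carrier_mat d d \<and> invertible_mat (Cm \<theta>) \<and>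
        (\<forall>j<d. shift 1 (U j \<theta>) = (\<Sum>i<d. cscale (Cm \<theta> $$ (i, j)) (U i (T \<theta>))))" by metis
    define Cb where "Cb = 4 * K' * dichotomy.source_bound a \<xi> \<delta> + 1"
    have Cb: "Cb > 0"
      using dichotomy.K_pos[OF D] dichotomy.source_bound_nonneg[OF D] by (simp add: Cb_def add_nonneg_pos)
    have rates: "fiber_opnorm \<xi> (shift (int n)) (Ms \<theta>) \<le> Cb * exp (- 2 * \<eta>) ^ n \<and>
             fiber_opnorm \<xi> (shift (- int n)) (Mu \<theta>) \<le> Cb * exp (2 * \<eta>) powi (- int n) \<and>
             fiber_opnorm \<xi> (shift (int n)) (Mc \<theta>) \<le> Cb * exp \<eta> ^ n \<and>
             fiber_opnorm \<xi> (shift (- int n)) (Mc \<theta>) \<le> Cb * exp (- \<eta>) powi (- int n)" for \<theta> n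
      unfolding Ms_def Mu_def Mc_def Cb_def by (intro conjI dichotomy.opnorm_bounds[OF D])
    have ds: "direct_sum3 (solution_fiber \<xi> V E \<epsilon> W T \<theta>) (Mu \<theta>) (Mc \<theta>) (Ms \<theta>)" for \<theta>
      unfolding solution_fiber_eq[OF L \<xi>] Mu_def Mc_def Ms_def
      using dichotomy.direct_sum[OF D, of \<theta>] by (simp add: w_def a_def a0_def)
    have dim: "cseq.dim (Mc \<theta>) = d" for \<theta>
      using cseq.dim_span_eq_card_independent[of "(\<lambda>i. U i \<theta>) ` {..<d}"] frame[of \<theta>] card_image[of "\<lambda>i. U i \<theta>" "{..<d}"]
      by simp
    show ?thesis
    proof (rule exI[of _ Mu], rule exI[of _ Mc], rule exI[of _ Ms], intro conjI allI)
      show "direct_sum3 (solution_fiber \<xi> V E \<epsilon> W T \<theta>) (Mu \<theta>) (Mc \<theta>) (Ms \<theta>)" for \<theta> by (rule ds)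
      show "shift_invariant T Mu" "shift_invariant T Mc" "shift_invariant T Ms" by (rule inv)+
      show "cseq.dim (Mc \<theta>) = d" for \<theta> by (rule dim)
      show "globally_trivial Mc" unfolding globally_trivial_def using gf by blast
      show "\<exists>U Cm. global_frame Mc d U \<and> (\<forall>i < d. \<forall>k. (\<lambda>\<theta>. U i \<theta> k) \<in> A) \<and>
          (\<forall>\<theta>. Cm \<theta> \<in> carrier_mat d d \<and> invertible_mat (Cm \<theta>) \<and>
               (\<forall>j < d. shift 1 (U j \<theta>) = (\<Sum>i < d. cscale (Cm \<theta> $$ (i, j)) (U i (T \<theta>)))))"
        by (intro exI[of _ U] exI[of _ Cm] conjI allI impI gf UA) (use Cm in auto)
      show "\<exists>rs rm rp ru C. 0 < rs \<and> rs < rm \<and> rm < 1 \<and> 1 < rp \<and> rp < ru \<and> 0 < C \<and>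
          (\<forall>\<theta>. \<forall>n::nat.
             fiber_opnorm \<xi> (shift (int n)) (Ms \<theta>) \<le> C * rs ^ n \<and>
             fiber_opnorm \<xi> (shift (- int n)) (Mu \<theta>) \<le> C * ru powi (- int n) \<and>
             fiber_opnorm \<xi> (shift (int n)) (Mc \<theta>) \<le> C * rp ^ n \<and>
             fiber_opnorm \<xi> (shift (- int n)) (Mc \<theta>) \<le> C * rm powi (- int n))"
        by (rule exI[of _ "exp (- 2 * \<eta>)"], rule exI[of _ "exp (- \<eta>)"], rule exI[of _ "exp \<eta>"],
            rule exI[of _ "exp (2 * \<eta>)"], rule exI[of _ Cb])
          (use \<eta> Cb rates in auto)
    qed
  qed
  have "\<epsilon>0 > 0" using B by (simp add: \<epsilon>0_def)
  with main show ?thesis unfolding d2 by blast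
qed

end
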